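(* Let $d\in\mathbb{N}$, let $h:\mathbb{R}\times\mathbb{T}^d\to\mathbb{R}$ be real analytic, and consider the ordinary differential equation in $\mathbb{R}$ $$\varepsilon\,\ddot x+\dot x+\varepsilon\,h(x,\omega t)=0,$$ where $\varepsilon\in\mathbb{R}$ and $\omega\in\mathbb{R}^d$. Let $h_{0}(x)$ denote the average of $\psi\mapsto h(x,\psi)$ over $\mathbb{T}^d$, and assume that the function $h_{0}$ has a simple zero $c_0\in\mathbb{R}$. Then for any frequency vector $\omega\in\mathbb{R}^d$ with rationally independent components (that is, $\omega\cdot\nu\neq0$ for all $\nu\in\mathbb{Z}^d\setminus\{0\}$) there exists $\varepsilon_0>0$ such that for all $|\varepsilon|<\varepsilon_0$ there is at least one quasi-periodic solution of the form $x_0(t)=c_0+X(\omega t,\varepsilon)$, where $X(\psi,\varepsilon)$ is analytic in $\psi\in\mathbb{T}^d$ and goes to $0$ as $\varepsilon\to0$.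
   Context: $\mathbb{T}=\mathbb{R}/2\pi\mathbb{Z}$. Fourier expansion: $h(x,\psi)=\sum_{\nu\in\mathbb{Z}^d}e^{\mathrm{i}\nu\cdot\psi}h_\nu(x)$, so that $h_0$ is the coefficient of index $\nu=0\in\mathbb{Z}^d$. A simple zero $c_0$ of $h_0$ means $h_0(c_0)=0$ and $h_0'(c_0)\neq0$. *)

theory Defs
  imports "HOL-Analysis.Analysis"
begin

text \<open>
  Functions on \<open>\<T>\<^sup>d\<close>, where \<open>\<T> = \<real>/2\<pi>\<int>\<close>, are represented by functions on \<open>\<real>\<^sup>d\<close> (\<open>d = CARD('d)\<close>)
  that are \<open>2\<pi>\<close>-periodic in every coordinate.
\<close>

definition torus_periodic :: "(real ^ 'd \<Rightarrow> 'b) \<Rightarrow> bool" where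
  "torus_periodic f \<longleftrightarrow> (\<forall>\<psi> i. f (\<psi> + axis i (2 * pi)) = f \<psi>)"

text \<open>
  Local expandability into an (unconditionally) convergent multivariate power series. A multi-index
  is an extensional function \<open>m\<close> from the standard basis to \<open>nat\<close>.
\<close>

definition real_analytic_on :: "('a::euclidean_space \<Rightarrow> real) \<Rightarrow> 'a set \<Rightarrow> bool" where
  "real_analytic_on f S \<longleftrightarrow>
     (\<forall>a\<in>S. \<exists>r>0. \<exists>c :: ('a \<Rightarrow> nat) \<Rightarrow> real. \<forall>y\<in>ball a r.
        ((\<lambda>m. c m * (\<Prod>b\<in>Basis. ((y - a) \<bullet> b) ^ m b)) has_sum f y) (Basis \<rightarrow>\<^sub>E UNIV))"

definition torus_average :: "(real ^ 'd \<Rightarrow> real) \<Rightarrow> real" where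
  "torus_average f = integral (cbox 0 (\<chi> i. 2 * pi)) f / (2 * pi) ^ CARD('d)"

definition simple_zero :: "(real \<Rightarrow> real) \<Rightarrow> real \<Rightarrow> bool" where
  "simple_zero f c \<longleftrightarrow> f c = 0 \<and> (\<exists>D. (f has_real_derivative D) (at c) \<and> D \<noteq> 0)"

definition rationally_independent :: "real ^ 'd \<Rightarrow> bool" where
  "rationally_independent \<omega> \<longleftrightarrow>
     (\<forall>\<nu> :: int ^ 'd. \<nu> \<noteq> 0 \<longrightarrow> (\<Sum>i\<in>UNIV. \<omega> $ i * of_int (\<nu> $ i)) \<noteq> 0)"

text \<open>The function \<open>x\<close> solves \<open>\<epsilon> x'' + x' + \<epsilon> h(x, \<omega>t) = 0\<close> on the whole real line.\<close>

definition solves_ode ::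
  "real \<Rightarrow> (real \<times> (real ^ 'd) \<Rightarrow> real) \<Rightarrow> real ^ 'd \<Rightarrow> (real \<Rightarrow> real) \<Rightarrow> bool" where
  "solves_ode \<epsilon> h \<omega> x \<longleftrightarrow>
     (\<exists>x' x''. \<forall>t. (x has_real_derivative x' t) (at t) \<and> (x' has_real_derivative x'' t) (at t) \<and>
        \<epsilon> * x'' t + x' t + \<epsilon> * h (x t, t *\<^sub>R \<omega>) = 0)"

definition quasi_periodic :: "real ^ 'd \<Rightarrow> (real \<Rightarrow> real) \<Rightarrow> bool" where
  "quasi_periodic \<omega> x \<longleftrightarrow>
     (\<exists>F. torus_periodic F \<and> continuous_on UNIV F \<and> (\<forall>t. x t = F (t *\<^sub>R \<omega>)))"

end

theory Submission
  imports Defs "HOL-Complex_Analysis.Cauchy_Integral_Formula"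
begin

text \<open>
  Look for \<open>x(t) = c\<^sub>0 + X(\<omega>t)\<close> with \<open>X\<close> in the algebra of Fourier series with exponentially weighted
  absolutely summable coefficients. Writing \<open>h(c\<^sub>0 + x, \<psi>) = \<Sum>\<^sub>k a\<^sub>k(\<psi>) x\<^sup>k\<close>, \<open>D\<close> for the derivative at
  \<open>c\<^sub>0\<close> of the average of \<open>h\<close>, \<open>g = a\<^sub>0\<close> and \<open>b = a\<^sub>1 - D\<close> (both of zero average), the equation becomes
  \<open>X + T(g + bX + Q(X)) = 0\<close>, where \<open>Q\<close> is at least quadratic and \<open>T\<close> is the Fourier multiplier
  \<open>\<epsilon> / (\<epsilon>D - \<epsilon>s\<^sup>2 + \<i>s)\<close> at the frequency \<open>s = \<omega>\<cdot>\<nu>\<close>. This multiplier is bounded by \<open>2 / \<bar>D\<bar>\<close> for small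
  \<open>\<epsilon>\<close>, and by \<open>\<bar>\<epsilon>\<bar> / \<bar>s\<bar>\<close> as well.

  The linear operator \<open>K = Tb\<close> is not small, but \<open>K\<^sup>2\<close> is: \<open>b\<close> has zero average, so multiplication by \<open>b\<close>
  couples frequencies at distance \<open>\<omega>\<cdot>\<mu> \<noteq> 0\<close>, and one of the two factors \<open>T\<close> in \<open>TbT\<close> is \<open>O(\<bar>\<epsilon>\<bar>)\<close>. Applying
  \<open>1 - K\<close> to the equation gives the contraction \<open>X \<mapsto> K\<^sup>2X - (1 - K)T(g + Q(X))\<close>, without any
  Diophantine condition on \<open>\<omega>\<close>.
\<close>

section \<open>Summable families\<close>

text \<open>Analyticity of \<open>h\<close> is given only as local real power series, and no complex
  extension is built. The weight comes from shifting one angle at a time: Taylor bounds that hold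
  uniformly on the torus force exponential decay of the Fourier coefficients, at a rate common to
  all \<open>a\<^sub>k\<close>, so that one algebra contains them all. The simple zero enters twice.
  Its being a zero removes frequency 0 from \<open>g\<close>, so \<open>T g\<close> tends to 0 with
  \<open>\<epsilon>\<close>; this keeps the iteration in a small ball and makes \<open>X\<close>
  vanish in the limit. Its simplicity makes \<open>T\<close> equal to \<open>1 / D\<close> at
  frequency 0, where the differential part vanishes. Since \<open>\<omega>\<cdot>\<nu>\<close> can
  be arbitrarily small, no rate in \<open>\<epsilon>\<close> is obtained for \<open>T g\<close> or
  \<open>T b T\<close>; convergence to 0 is all that is proved, and all that a contraction asks for.
  Applying \<open>1 - K\<close> loses no information: a residual killed by it is fixed by
  \<open>K\<^sup>2\<close>, hence zero. Real values follow from uniqueness of the fixed point, the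
  iteration being compatible with complex conjugation.\<close>

abbreviation asummable_on :: "('a \<Rightarrow> 'b::real_normed_vector) \<Rightarrow> 'a set \<Rightarrow> bool" (infix "asummable'_on" 46) where
  "f asummable_on A \<equiv> (\<lambda>x. norm (f x)) summable_on A"

text \<open>A type of its own makes this space an instance of \<open>banach\<close>, so that series,
  bounded linear maps and the contraction principle apply directly. The weight is kept out of the
  type: elements store coefficients already multiplied by it.\<close>

typedef 'a l1 = "{f :: 'a \<Rightarrow> complex. f asummable_on UNIV}"
  morphisms coef Abs_l1
  by (rule exI[of _ "\<lambda>_. 0"]) simp

lemma coef_summable [simp]: "coef u asummable_on UNIV"
  using coef[of u] by simp

lemma coef_Abs: "f asummable_on UNIV \<Longrightarrow> coef (Abs_l1 f) = f"
  by (simp add: Abs_l1_inverse)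

lemma l1_eqI: "(\<And>i. coef u i = coef v i) \<Longrightarrow> u = v"
  using coef_inject[of u v] by auto

lemma abs_summable_add:
  fixes f g :: "'a \<Rightarrow> 'b::real_normed_vector"
  assumes "f asummable_on A" "g asummable_on A"
  shows "(\<lambda>x. f x + g x) asummable_on A"
  by (rule Infinite_Sum.abs_summable_on_comparison_test'[OF summable_on_add[OF assms]]) (rule norm_triangle_ineq)

lemma abs_summable_scaleR:
  fixes f :: "'a \<Rightarrow> 'b::real_normed_vector"
  assumes "f asummable_on A"
  shows "(\<lambda>x. c *\<^sub>R f x) asummable_on A"
  using summable_on_cmult_right[OF assms, of "\<bar>c\<bar>"] by simp

instantiation l1 :: (type) real_normed_vector
begin

definition "0 = Abs_l1 (\<lambda>_. 0)"
definition "u + v = Abs_l1 (\<lambda>i. coef u i + coef v i)"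
definition "u - v = Abs_l1 (\<lambda>i. coef u i - coef v i)"
definition "- u = Abs_l1 (\<lambda>i. - coef u i)"
definition "c *\<^sub>R u = Abs_l1 (\<lambda>i. c *\<^sub>R coef u i)"
definition "norm u = (\<Sum>\<^sub>\<infinity>i. norm (coef u i))"
definition "dist u v = norm (u - v :: 'a l1)"
definition sgn_l1 :: "'a l1 \<Rightarrow> 'a l1" where "sgn_l1 u = inverse (norm u) *\<^sub>R u"
definition "uniformity = (INF e\<in>{0<..}. principal {(u, v). dist u (v :: 'a l1) < e})"
definition "open U = (\<forall>u\<in>U. eventually (\<lambda>(u', v). u' = u \<longrightarrow> v \<in> U) (uniformity :: ('a l1 \<times> 'a l1) filter))"

lemma coef_0 [simp]: "coef 0 i = 0"
  by (simp add: zero_l1_def coef_Abs)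

lemma coef_add [simp]: "coef (u + v) i = coef u i + coef v i"
  by (simp add: plus_l1_def coef_Abs abs_summable_add)

lemma coef_uminus [simp]: "coef (- u) i = - coef u i"
  by (simp add: uminus_l1_def coef_Abs)

lemma coef_diff [simp]: "coef (u - v) i = coef u i - coef v i"
proof -
  have "(\<lambda>i. coef u i + coef (- v) i) asummable_on UNIV"
    by (rule abs_summable_add) auto
  then show ?thesis
    by (simp add: minus_l1_def coef_Abs)
qed

lemma coef_scaleR [simp]: "coef (c *\<^sub>R u) i = c *\<^sub>R coef u i"
proof -
  have "(\<lambda>i. c *\<^sub>R coef u i) asummable_on UNIV"
    by (rule abs_summable_scaleR) auto
  then show ?thesis
    by (simp only: scaleR_l1_def coef_Abs)
qed

instance
proof
  fix u v w :: "'a l1" and c d :: real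
  show "u + v + w = u + (v + w)" "u + v = v + u" "0 + u = u" "- u + u = 0" "u - v = u + - v"
    "c *\<^sub>R (u + v) = c *\<^sub>R u + c *\<^sub>R v" "(c + d) *\<^sub>R u = c *\<^sub>R u + d *\<^sub>R u"
    "c *\<^sub>R d *\<^sub>R u = (c * d) *\<^sub>R u" "1 *\<^sub>R u = u"
    by (auto intro!: l1_eqI simp: algebra_simps)
  show "norm u = 0 \<longleftrightarrow> u = 0"
  proof
    assume "norm u = 0"
    then have "norm (coef u i) = 0" for i
      using nonneg_infsum_le_0D[of "\<lambda>i. norm (coef u i)" UNIV i] by (simp add: norm_l1_def)
    then show "u = 0"
      by (auto intro: l1_eqI)
  qed (simp add: norm_l1_def)
  have "(\<Sum>\<^sub>\<infinity>i. norm (coef (u + v) i)) \<le> (\<Sum>\<^sub>\<infinity>i. norm (coef u i) + norm (coef v i))"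
    by (rule infsum_mono)
      (auto intro: norm_triangle_ineq summable_on_add abs_summable_add)
  also have "\<dots> = norm u + norm v"
    by (simp add: norm_l1_def infsum_add)
  finally show "norm (u + v) \<le> norm u + norm v"
    by (simp add: norm_l1_def)
  show "norm (c *\<^sub>R u) = \<bar>c\<bar> * norm u"
    by (simp add: norm_l1_def infsum_cmult_right')
qed (simp_all add: dist_l1_def sgn_l1_def uniformity_l1_def open_l1_def)

end

lemma norm_coef_le: "norm (coef u i) \<le> norm u"
  using finite_sum_le_infsum[of "\<lambda>i. norm (coef u i)" UNIV "{i}"] by (simp add: norm_l1_def)

lemma l1_sum_le_norm: "finite F \<Longrightarrow> (\<Sum>i\<in>F. norm (coef u i)) \<le> norm u"
  using finite_sum_le_infsum[of "\<lambda>i. norm (coef u i)" UNIV F] by (simp add: norm_l1_def)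

lemma norm_l1_leI:
  assumes "\<And>F. finite F \<Longrightarrow> (\<Sum>i\<in>F. norm (coef u i)) \<le> B"
  shows "norm u \<le> B"
  unfolding norm_l1_def by (rule infsum_le_finite_sums) (use assms in auto)

lemma bounded_linear_coef: "bounded_linear (\<lambda>u. coef u i)"
  by (rule bounded_linear_intro[of _ 1]) (auto intro: norm_coef_le)

instance l1 :: (type) banach
proof
  fix X :: "nat \<Rightarrow> 'a l1"
  assume "Cauchy X"
  have "convergent (\<lambda>n. coef (X n) i)" for i
    using bounded_linear.Cauchy[OF bounded_linear_coef \<open>Cauchy X\<close>] by (simp add: Cauchy_convergent)
  then obtain L where L: "(\<lambda>n. coef (X n) i) \<longlonglongrightarrow> L i" for i
    unfolding convergent_def by metis
  have close: "(\<Sum>i\<in>F. norm (L i - coef (X n) i)) \<le> e"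
    if "finite F" and N: "\<And>m. m \<ge> N \<Longrightarrow> norm (X m - X n) \<le> e" for F n N e
  proof (rule LIMSEQ_le_const2)
    show "(\<lambda>m. \<Sum>i\<in>F. norm (coef (X m) i - coef (X n) i)) \<longlonglongrightarrow> (\<Sum>i\<in>F. norm (L i - coef (X n) i))"
      by (intro tendsto_intros L)
    have "(\<Sum>i\<in>F. norm (coef (X m) i - coef (X n) i)) \<le> e" if "m \<ge> N" for m
      using order_trans[OF l1_sum_le_norm[OF \<open>finite F\<close>, of "X m - X n"] N[OF that]] by simp
    then show "\<exists>N. \<forall>m\<ge>N. (\<Sum>i\<in>F. norm (coef (X m) i - coef (X n) i)) \<le> e"
      by blast
  qed
  obtain N where N: "\<And>m n. m \<ge> N \<Longrightarrow> n \<ge> N \<Longrightarrow> norm (X m - X n) < 1"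
    using CauchyD[OF \<open>Cauchy X\<close>, of 1] by auto
  have "(\<lambda>i. L i - coef (X N) i) asummable_on UNIV"
  proof (rule nonneg_bdd_above_summable_on)
    show "bdd_above (sum (\<lambda>i. norm (L i - coef (X N) i)) ` {F. F \<subseteq> UNIV \<and> finite F})"
      using close[of _ N N 1] N by (auto intro!: bdd_aboveI2[where M=1] simp: less_imp_le)
  qed auto
  then have "(\<lambda>i. (L i - coef (X N) i) + coef (X N) i) asummable_on UNIV"
    by (rule abs_summable_add) simp
  then have L_coef: "coef (Abs_l1 L) = L"
    by (simp add: coef_Abs)
  have "X \<longlonglongrightarrow> Abs_l1 L"
  proof (rule LIMSEQ_I)
    fix e :: real assume "e > 0"
    then obtain N where N: "\<And>m n. m \<ge> N \<Longrightarrow> n \<ge> N \<Longrightarrow> norm (X m - X n) < e / 2"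
      using CauchyD[OF \<open>Cauchy X\<close>, of "e / 2"] by auto
    have "norm (X n - Abs_l1 L) \<le> e / 2" if "n \<ge> N" for n
      unfolding norm_minus_commute[of "X n"]
      by (rule norm_l1_leI) (use close[of _ N n "e / 2"] N that in \<open>auto simp: L_coef less_imp_le\<close>)
    then show "\<exists>N. \<forall>n\<ge>N. norm (X n - Abs_l1 L) < e"
      using \<open>e > 0\<close> by (intro exI[of _ N]) (fastforce intro: le_less_trans)
  qed
  then show "convergent X"
    by (auto simp: convergent_def)
qed

text \<open>Young's inequality for l1, for any kernel dominated by a convolution kernel. This
  generality covers the weighted product, the operator in \<open>norm_mult_conv_mult\<close> and the
  double series in \<open>ev_conv\<close>.\<close>

lemma abs_summable_kernel:
  fixes b :: "'a::ab_group_add \<Rightarrow> real" and u :: "'a \<Rightarrow> real" and k :: "'a \<Rightarrow> 'a \<Rightarrow> 'b::banach"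
  assumes b: "b summable_on UNIV" and u: "u summable_on UNIV"
    and k: "\<And>i j. norm (k i j) \<le> b (i - j) * u j"
    and nonneg: "\<And>i. 0 \<le> b i" "\<And>i. 0 \<le> u i"
  shows "(\<lambda>(i, j). k i j) asummable_on UNIV \<times> UNIV"
    and "k i asummable_on UNIV"
    and "(\<lambda>i. \<Sum>\<^sub>\<infinity>j. k i j) asummable_on UNIV"
    and "(\<Sum>\<^sub>\<infinity>i. norm (\<Sum>\<^sub>\<infinity>j. k i j)) \<le> infsum b UNIV * infsum u UNIV"
proof -
  have shift: "((\<lambda>i. b (i - j) * u j) has_sum infsum b UNIV * u j) UNIV" for j
  proof (rule has_sum_cmult_left)
    have "bij_betw (\<lambda>i. i - j) UNIV UNIV"
      by (rule bij_betwI[of _ _ _ "\<lambda>i. i + j"]) auto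
    from has_sum_reindex_bij_betw[OF this, of b] show "((\<lambda>i. b (i - j)) has_sum infsum b UNIV) UNIV"
      using b by simp
  qed
  have "((\<lambda>(j, i). b (i - j) * u j) has_sum (infsum b UNIV * infsum u UNIV)) (UNIV \<times> UNIV)"
  proof (rule has_sum_SigmaI)
    show "((\<lambda>i. case (j, i) of (j, i) \<Rightarrow> b (i - j) * u j) has_sum infsum b UNIV * u j) UNIV" for j
      using shift by simp
    then show "(\<lambda>(j, i). b (i - j) * u j) summable_on UNIV \<times> UNIV"
      by (rule summable_on_SigmaI) (use nonneg u in \<open>auto intro!: summable_on_cmult_right\<close>)
  qed (use u in \<open>auto intro!: has_sum_cmult_right\<close>)
  then have dom: "((\<lambda>(i, j). b (i - j) * u j) has_sum (infsum b UNIV * infsum u UNIV)) (UNIV \<times> UNIV)"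
    by (subst has_sum_swap) simp
  show abs: "(\<lambda>(i, j). k i j) asummable_on UNIV \<times> UNIV"
    by (rule Infinite_Sum.abs_summable_on_comparison_test'[OF has_sum_imp_summable[OF dom]]) (use k in auto)
  note sigma = Infinite_Sum.abs_summable_on_Sigma_iff[THEN iffD1, OF this]
  show row: "k i asummable_on UNIV" for i
    using sigma by auto
  have rows: "(\<lambda>i. \<Sum>\<^sub>\<infinity>j. norm (k i j)) summable_on UNIV"
    using sigma summable_on_iff_abs_summable_on_real by auto
  show "(\<lambda>i. \<Sum>\<^sub>\<infinity>j. k i j) asummable_on UNIV"
    by (rule Infinite_Sum.abs_summable_on_comparison_test'[OF rows norm_infsum_bound[OF row]])
  then have "(\<Sum>\<^sub>\<infinity>i. norm (\<Sum>\<^sub>\<infinity>j. k i j)) \<le> (\<Sum>\<^sub>\<infinity>i. \<Sum>\<^sub>\<infinity>j. norm (k i j))"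
    by (rule infsum_mono) (auto intro: rows norm_infsum_bound row)
  also have "\<dots> = (\<Sum>\<^sub>\<infinity>(i, j)\<in>UNIV \<times> UNIV. norm (k i j))"
    using abs by (intro infsum_Sigma'_banach) (simp add: case_prod_unfold)
  also have "\<dots> \<le> infsum b UNIV * infsum u UNIV"
    unfolding infsumI[OF dom, symmetric]
    by (rule infsum_mono) (use abs k dom in \<open>auto simp: case_prod_unfold has_sum_iff\<close>)
  finally show "(\<Sum>\<^sub>\<infinity>i. norm (\<Sum>\<^sub>\<infinity>j. k i j)) \<le> infsum b UNIV * infsum u UNIV" .
qed

section \<open>A Newton-like fixed point and weighted convolution\<close>

text \<open>The map \<open>\<Phi>\<close> of the proof has Lipschitz constant 1/4 from
  \<open>K (K u)\<close> plus 1/4 from the nonlinear term, where \<open>1 + B\<close> bounds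
  \<open>1 - K\<close>. Only \<open>T g\<close> has to be small, not \<open>g\<close>. The map
  \<open>S\<close> stands for complex conjugation of functions; it is carried along so that the
  solution comes out real.\<close>

theorem quasi_newton_fixed_point:
  fixes T K S Q :: "'a::banach \<Rightarrow> 'a"
  assumes T: "linear T" "\<And>u. norm (T u) \<le> C * norm u"
    and K: "linear K" "\<And>u. norm (K u) \<le> B * norm u" "\<And>u. norm (K (K u)) \<le> norm u / 4"
    and S: "linear S" "\<And>u. norm (S u) \<le> norm u"
      "\<And>u. S (T u) = T (S u)" "\<And>u. S (K u) = K (S u)" "S g = g"
    and Q: "\<And>u v. norm u \<le> \<rho> \<Longrightarrow> norm v \<le> \<rho> \<Longrightarrow> norm (Q u - Q v) \<le> L * norm (u - v)"
      "Q 0 = 0" "\<And>u. norm u \<le> \<rho> \<Longrightarrow> S (Q u) = Q (S u)"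
    and nonneg: "0 \<le> B" "0 \<le> C" "0 \<le> \<rho>"
    and small: "(1 + B) * C * L \<le> 1 / 4" "(1 + B) * norm (T g) \<le> \<rho> / 2"
  shows "\<exists>X. norm X \<le> \<rho> \<and> S X = X \<and> X + K X + T (g + Q X) = 0 \<and> norm X \<le> 2 * (1 + B) * norm (T g)"
proof -
  interpret T: linear T by fact
  interpret K: linear K by fact
  interpret S: linear S by fact
  define P where "P u = T u - K (T u)" for u
  define \<Phi> where "\<Phi> u = K (K u) - P (g + Q u)" for u
  have P_diff: "P (u - v) = P u - P v" and P_add: "P (u + v) = P u + P v" for u v
    by (simp_all add: P_def T.diff K.diff T.add K.add)
  have P_le: "norm (P u) \<le> (1 + B) * norm (T u)" for u
  proof -
    have "norm (P u) \<le> norm (T u) + norm (K (T u))"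
      unfolding P_def by (rule norm_triangle_ineq4)
    also have "\<dots> \<le> (1 + B) * norm (T u)"
      using K(2)[of "T u"] by (simp add: algebra_simps)
    finally show ?thesis .
  qed
  have P_C: "norm (P u) \<le> (1 + B) * C * norm u" for u
  proof -
    have "(1 + B) * norm (T u) \<le> (1 + B) * (C * norm u)"
      using T(2) nonneg(1) by (intro mult_left_mono) auto
    then show ?thesis
      using P_le[of u] by (simp only: mult.assoc)
  qed
  have lip: "norm (\<Phi> u - \<Phi> v) \<le> 1 / 2 * norm (u - v)" if "norm u \<le> \<rho>" "norm v \<le> \<rho>" for u v
  proof -
    have "\<Phi> u - \<Phi> v = K (K (u - v)) - P (Q u - Q v)"
      by (simp add: \<Phi>_def K.diff P_diff P_add)
    also have "norm \<dots> \<le> norm (u - v) / 4 + (1 + B) * C * norm (Q u - Q v)"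
      by (rule order_trans[OF norm_triangle_ineq4 add_mono[OF K(3) P_C]])
    also have "(1 + B) * C * norm (Q u - Q v) \<le> (1 + B) * C * (L * norm (u - v))"
      using Q(1)[OF that] nonneg by (intro mult_left_mono) auto
    also have "\<dots> = (1 + B) * C * L * norm (u - v)"
      by simp
    also have "\<dots> \<le> 1 / 4 * norm (u - v)"
      using small(1) by (rule mult_right_mono) simp
    finally show ?thesis
      by simp
  qed
  have \<Phi>0: "norm (\<Phi> 0) \<le> (1 + B) * norm (T g)"
    using P_le[of g] by (simp add: \<Phi>_def K.zero Q(2))
  have grow: "norm (\<Phi> u) \<le> 1 / 2 * norm u + (1 + B) * norm (T g)" if "norm u \<le> \<rho>" for u
    using lip[OF that, of 0] \<Phi>0 nonneg norm_triangle_sub[of "\<Phi> u" "\<Phi> 0"] by simp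
  have "\<exists>!X\<in>cball 0 \<rho>. \<Phi> X = X"
  proof (rule Banach_fix[where c="1/2"])
    show "complete (cball 0 \<rho> :: 'a set)"
      by (simp add: complete_eq_closed)
    show "\<Phi> ` cball 0 \<rho> \<subseteq> cball 0 \<rho>"
    proof
      fix v assume "v \<in> \<Phi> ` cball 0 \<rho>"
      then obtain u where u: "v = \<Phi> u" "norm u \<le> \<rho>"
        by auto
      then show "v \<in> cball 0 \<rho>"
        using grow[OF u(2)] small(2) by simp
    qed
    show "cball (0 :: 'a) \<rho> \<noteq> {}"
      using nonneg(3) by simp
    show "dist (\<Phi> u) (\<Phi> v) \<le> 1 / 2 * dist u v" if "u \<in> cball 0 \<rho>" "v \<in> cball 0 \<rho>" for u v
      unfolding dist_norm by (rule lip) (use that in auto)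
  qed auto
  then obtain X where X_mem: "X \<in> cball 0 \<rho>" and X_fix: "\<Phi> X = X"
    and uniq: "\<And>Y. Y \<in> cball 0 \<rho> \<Longrightarrow> \<Phi> Y = Y \<Longrightarrow> Y = X"
    by blast
  have X: "norm X \<le> \<rho>"
    using X_mem by simp
  \<comment> \<open>\<open>S\<close> commutes with \<open>\<Phi>\<close> and, being nonexpansive,
    keeps \<open>X\<close> in the ball, so uniqueness of the fixed point forces
    \<open>S X = X\<close>.\<close>
  have "\<Phi> (S X) = S (\<Phi> X)"
    by (simp only: \<Phi>_def P_def S(3-5) S.diff S.add Q(3)[OF X])
  then have "\<Phi> (S X) = S X"
    by (simp only: X_fix)
  moreover have "S X \<in> cball 0 \<rho>"
    using order_trans[OF S(2) X] by simp
  ultimately have SX: "S X = X"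
    by (intro uniq)
  define R where "R = X + K X + T (g + Q X)"
  \<comment> \<open>This is \<open>1 - K\<close> applied to the residual \<open>R\<close>. As
    \<open>X\<close> is fixed, \<open>R = K R = K (K R)\<close>, and the factor 1/4 on
    \<open>K (K R)\<close> leaves only \<open>R = 0\<close>.\<close>
  have "R - K R = X - \<Phi> X"
    by (simp add: R_def \<Phi>_def P_def K.add)
  then have "K (K R) = R"
    using X_fix by simp
  then have "R = 0"
    using K(3)[of R] by simp
  moreover have "norm X \<le> 2 * (1 + B) * norm (T g)"
    using grow[OF X] unfolding X_fix by linarith
  ultimately show ?thesis
    using X SX unfolding R_def by blast
qed

section \<open>Weighted convolution algebras\<close>

text \<open>A submultiplicative weight makes the weighted sequences a Banach algebra under
  convolution, a Beurling algebra. Together with symmetry and \<open>w 0 = 1\<close> it forces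
  \<open>w i \<ge> 1\<close>, so the represented series converge absolutely.\<close>

locale l1_weight =
  fixes w :: "'a::ab_group_add \<Rightarrow> real"
  assumes w_pos: "0 < w i" and w_add: "w (i + j) \<le> w i * w j" and w_0: "w 0 = 1" and w_minus: "w (- i) = w i"
begin

lemma w_ge_1: "1 \<le> w i"
proof -
  have "1 \<le> w i * w i"
    using w_add[of i "- i"] by (simp add: w_0 w_minus)
  then show ?thesis
    using w_pos[of i] by (metis less_1_mult less_imp_le linorder_not_le mult_less_cancel_right2 order.strict_trans2)
qed

lemma ratio_le_1: "w i / (w (i - j) * w j) \<le> 1"
  using w_add[of "i - j" j] w_pos by (simp add: divide_le_eq mult_less_0_iff zero_less_mult_iff)

text \<open>Stored coefficients carry a factor \<open>w\<close>, so an entry of the ordinary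
  convolution picks up this ratio, which is at most 1 by submultiplicativity.\<close>

definition "conv_kernel u v i j = of_real (w i / (w (i - j) * w j)) * coef u (i - j) * coef v j"

lemma norm_conv_kernel: "norm (conv_kernel u v i j) \<le> norm (coef u (i - j)) * norm (coef v j)"
proof -
  have "norm (conv_kernel u v i j) = (w i / (w (i - j) * w j)) * (norm (coef u (i - j)) * norm (coef v j))"
    using w_pos by (simp add: conv_kernel_def norm_mult norm_divide less_imp_le)
  also have "\<dots> \<le> 1 * (norm (coef u (i - j)) * norm (coef v j))"
    by (rule mult_right_mono[OF ratio_le_1]) simp
  finally show ?thesis by simp
qed

lemmas conv_kernel_summable =
  abs_summable_kernel[OF coef_summable coef_summable norm_conv_kernel norm_ge_zero norm_ge_zero]

text \<open>An element \<open>u\<close> stands for the family \<open>coef u i / w i\<close>; the product below is the convolution of these families.\<close>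

definition conv :: "'a l1 \<Rightarrow> 'a l1 \<Rightarrow> 'a l1" where
  "conv u v = Abs_l1 (\<lambda>i. \<Sum>\<^sub>\<infinity>j. conv_kernel u v i j)"

lemma coef_conv: "coef (conv u v) i = (\<Sum>\<^sub>\<infinity>j. conv_kernel u v i j)"
  by (simp add: conv_def coef_Abs conv_kernel_summable)

lemma norm_conv: "norm (conv u v) \<le> norm u * norm v"
  using conv_kernel_summable(4)[of u v] by (simp add: norm_l1_def coef_conv)

lemma bounded_bilinear_conv: "bounded_bilinear conv"
proof -
  have sum: "conv_kernel u v i summable_on UNIV" for u v i
    by (rule abs_summable_summable) (rule conv_kernel_summable)
  show ?thesis
  proof
    fix u u' v v' :: "'a l1" and r :: real
    have "conv_kernel (u + u') v i j = conv_kernel u v i j + conv_kernel u' v i j"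
      "conv_kernel u (v + v') i j = conv_kernel u v i j + conv_kernel u v' i j"
      "conv_kernel (r *\<^sub>R u) v i j = r *\<^sub>R conv_kernel u v i j"
      "conv_kernel u (r *\<^sub>R v) i j = r *\<^sub>R conv_kernel u v i j" for i j
      by (simp_all only: conv_kernel_def coef_add coef_scaleR distrib_left distrib_right
          mult_scaleR_left mult_scaleR_right)
    then show "conv (u + u') v = conv u v + conv u' v" "conv u (v + v') = conv u v + conv u v'"
      "conv (r *\<^sub>R u) v = r *\<^sub>R conv u v" "conv u (r *\<^sub>R v) = r *\<^sub>R conv u v"
      by (auto intro!: l1_eqI simp: coef_conv infsum_add[OF sum sum] infsum_scaleR_right)
    show "\<exists>K. \<forall>u v. norm (conv u v) \<le> norm u * norm v * K"
      by (rule exI[of _ 1]) (simp add: norm_conv)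
  qed
qed

sublocale conv: bounded_bilinear conv
  by (rule bounded_bilinear_conv)

definition unit :: "'a l1" where "unit = Abs_l1 (\<lambda>i. if i = 0 then 1 else 0)"

lemma coef_unit: "coef unit i = (if i = 0 then 1 else 0)"
proof -
  have "(\<lambda>i::'a. if i = 0 then 1 else 0 :: complex) asummable_on UNIV"
    by (rule finite_nonzero_values_imp_summable_on) auto
  then show ?thesis
    by (simp add: unit_def coef_Abs)
qed

lemma norm_unit: "norm unit = 1"
proof -
  have "(\<Sum>\<^sub>\<infinity>i. norm (coef unit i)) = (\<Sum>\<^sub>\<infinity>i\<in>{0}. norm (coef unit i))"
    by (rule infsum_cong_neutral) (auto simp: coef_unit)
  then show ?thesis
    by (simp add: norm_l1_def coef_unit)
qed

lemma conv_unit: "conv unit u = u"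
proof (rule l1_eqI)
  fix i
  have "(\<Sum>\<^sub>\<infinity>j. conv_kernel unit u i j) = (\<Sum>\<^sub>\<infinity>j\<in>{i}. conv_kernel unit u i j)"
    by (rule infsum_cong_neutral) (auto simp: coef_unit conv_kernel_def)
  then show "coef (conv unit u) i = coef u i"
    using w_pos[of i] by (simp add: coef_conv coef_unit conv_kernel_def w_0)
qed

lemma conv_unit_right: "conv u unit = u"
proof (rule l1_eqI)
  fix i
  have "(\<Sum>\<^sub>\<infinity>j. conv_kernel u unit i j) = (\<Sum>\<^sub>\<infinity>j\<in>{0}. conv_kernel u unit i j)"
    by (rule infsum_cong_neutral) (auto simp: coef_unit conv_kernel_def)
  then show "coef (conv u unit) i = coef u i"
    using w_pos[of i] by (simp add: coef_conv coef_unit conv_kernel_def w_0)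
qed

fun cpow :: "'a l1 \<Rightarrow> nat \<Rightarrow> 'a l1" where
  "cpow u 0 = unit"
| "cpow u (Suc n) = conv u (cpow u n)"

lemma norm_cpow: "norm (cpow u n) \<le> norm u ^ n"
proof (induction n)
  case (Suc n)
  then show ?case
    using order_trans[OF norm_conv mult_left_mono[OF Suc, of "norm u"]] by simp
qed (simp add: norm_unit)

text \<open>Telescoping, as for scalars: a product difference splits into \<open>u\<close> times the
  difference of the lower powers plus \<open>u - v\<close> times a power of \<open>v\<close>. For
  exponent 0 the truncated \<open>n - 1\<close> is harmless because of the factor
  \<open>n\<close>.\<close>

lemma norm_cpow_diff:
  assumes "norm u \<le> \<rho>" "norm v \<le> \<rho>"
  shows "norm (cpow u n - cpow v n) \<le> n * \<rho> ^ (n - 1) * norm (u - v)"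
proof (induction n)
  case (Suc n)
  have \<rho>: "0 \<le> \<rho>"
    using assms(1) norm_ge_zero order_trans by blast
  have pow: "norm v ^ n \<le> \<rho> ^ n"
    using assms(2) by (rule power_mono) simp
  have step: "real n * \<rho> ^ n = \<rho> * (real n * \<rho> ^ (n - 1))"
    by (cases n) auto
  have "cpow u (Suc n) - cpow v (Suc n) = conv u (cpow u n - cpow v n) + conv (u - v) (cpow v n)"
    by (simp add: conv.diff_left conv.diff_right)
  also have "norm \<dots> \<le> norm u * norm (cpow u n - cpow v n) + norm (u - v) * norm (cpow v n)"
    by (rule order_trans[OF norm_triangle_ineq add_mono[OF norm_conv norm_conv]])
  also have "\<dots> \<le> \<rho> * (n * \<rho> ^ (n - 1) * norm (u - v)) + norm (u - v) * \<rho> ^ n"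
    by (intro add_mono mult_mono Suc assms \<rho> norm_ge_zero order_refl order_trans[OF norm_cpow pow])
  also have "\<dots> = real (Suc n) * \<rho> ^ n * norm (u - v)"
    using step by (auto simp: algebra_simps)
  finally show ?case
    by simp
qed simp

text \<open>A Fourier multiplier. Being diagonal it commutes with the rescaling by the weight, so no
  \<open>w\<close> occurs. A bounded \<open>m\<close> keeps the product summable and
  \<open>Abs_l1\<close> meaningful, hence the bound assumed in the facts about it.\<close>

definition mult :: "('a \<Rightarrow> complex) \<Rightarrow> 'a l1 \<Rightarrow> 'a l1" where
  "mult m u = Abs_l1 (\<lambda>i. m i * coef u i)"

lemma mult_summable:
  assumes "\<And>i. norm (m i) \<le> C"
  shows "(\<lambda>i. m i * coef u i) asummable_on UNIV"
  by (rule Infinite_Sum.abs_summable_on_comparison_test'[where g="\<lambda>i. C * norm (coef u i)"])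
     (auto intro!: summable_on_cmult_right simp: norm_mult mult_right_mono assms)

lemma coef_mult: "(\<And>i. norm (m i) \<le> C) \<Longrightarrow> coef (mult m u) i = m i * coef u i"
  unfolding mult_def by (rule coef_Abs[OF mult_summable, THEN fun_cong])

lemma norm_mult_le:
  assumes "\<And>i. norm (m i) \<le> C"
  shows "norm (mult m u) \<le> C * norm u"
proof -
  have "(\<Sum>\<^sub>\<infinity>i. norm (m i * coef u i)) \<le> (\<Sum>\<^sub>\<infinity>i. C * norm (coef u i))"
    by (rule infsum_mono[OF mult_summable[OF assms]])
       (auto intro!: summable_on_cmult_right simp: norm_mult mult_right_mono assms)
  then show ?thesis
    by (simp add: norm_l1_def coef_mult[OF assms] infsum_cmult_right')
qed

lemma linear_mult:
  assumes "\<And>i. norm (m i) \<le> C"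
  shows "linear (mult m)"
  by (rule linearI) (auto intro!: l1_eqI simp: coef_mult[OF assms] algebra_simps)

text \<open>The matrix entries are \<open>m i * b (i - j) * m j\<close> up to weight ratios. A bound
  on \<open>m i * m j\<close> that depends only on \<open>i - j\<close> can be moved onto
  \<open>b\<close>, and Young's inequality remains. For the resolvent this bound tends to 0 with
  \<open>\<epsilon>\<close> off the diagonal, which is the source of the smallness of
  \<open>K (K u)\<close>.\<close>

lemma norm_mult_conv_mult:
  assumes m: "\<And>i. norm (m i) \<le> C" and \<kappa>: "\<And>i j. norm (m i * m j) \<le> \<kappa> (i - j)"
    and sum: "(\<lambda>i. norm (coef b i) * \<kappa> i) summable_on UNIV"
  shows "norm (mult m (conv b (mult m u))) \<le> (\<Sum>\<^sub>\<infinity>i. norm (coef b i) * \<kappa> i) * norm u"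
proof -
  have \<kappa>_nonneg: "0 \<le> \<kappa> i" for i
    using order_trans[OF norm_ge_zero \<kappa>[of i 0]] by simp
  have bound: "norm (m i * conv_kernel b (mult m u) i j) \<le> (norm (coef b (i - j)) * \<kappa> (i - j)) * norm (coef u j)" for i j
  proof -
    have "norm (m i * conv_kernel b (mult m u) i j) \<le> norm (m i) * (norm (coef b (i - j)) * norm (m j * coef u j))"
      using mult_left_mono[OF norm_conv_kernel[of b "mult m u" i j], of "norm (m i)"]
      by (simp add: norm_mult coef_mult[OF m])
    also have "\<dots> = norm (coef b (i - j)) * norm (m i * m j) * norm (coef u j)"
      by (simp add: norm_mult)
    also have "\<dots> \<le> norm (coef b (i - j)) * \<kappa> (i - j) * norm (coef u j)"
      by (intro mult_right_mono mult_left_mono \<kappa>) auto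
    finally show ?thesis .
  qed
  have "coef (mult m (conv b (mult m u))) i = (\<Sum>\<^sub>\<infinity>j. m i * conv_kernel b (mult m u) i j)" for i
    by (simp add: coef_mult[OF m] coef_conv infsum_cmult_right')
  then show ?thesis
    using abs_summable_kernel(4)[OF sum coef_summable bound] \<kappa>_nonneg by (simp add: norm_l1_def)
qed

text \<open>Complex conjugation of the represented function, seen on coefficients
  (\<open>ft_star\<close>); its fixed points are the real-valued series.\<close>

definition star :: "'a l1 \<Rightarrow> 'a l1" where
  "star u = Abs_l1 (\<lambda>i. cnj (coef u (- i)))"

lemma bij_uminus: "bij (uminus :: 'a \<Rightarrow> 'a)"
  by (rule bij_betwI[of _ _ _ uminus]) auto

lemma coef_star: "coef (star u) i = cnj (coef u (- i))"
proof -
  have "(\<lambda>i. cnj (coef u (- i))) asummable_on UNIV"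
    using summable_on_reindex_bij_betw[OF bij_uminus, of "\<lambda>i. norm (coef u i)"] by simp
  then show ?thesis
    by (simp add: star_def coef_Abs)
qed

lemma norm_star: "norm (star u) = norm u"
  using infsum_reindex_bij_betw[OF bij_uminus, of "\<lambda>i. norm (coef u i)"]
  by (simp add: norm_l1_def coef_star)

lemma bounded_linear_star: "bounded_linear star"
  by (rule bounded_linear_intro[of _ 1]) (auto intro!: l1_eqI simp: coef_star norm_star)

lemma star_mult:
  assumes "\<And>i. norm (m i) \<le> C" "\<And>i. m (- i) = cnj (m i)"
  shows "star (mult m u) = mult m (star u)"
  by (rule l1_eqI) (simp add: coef_star coef_mult[OF assms(1)] assms(2))

lemma star_conv: "star (conv u v) = conv (star u) (star v)"
proof (rule l1_eqI)
  fix i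
  have "coef (star (conv u v)) i = (\<Sum>\<^sub>\<infinity>j. cnj (conv_kernel u v (- i) j))"
    by (simp add: coef_star coef_conv)
  also have "\<dots> = (\<Sum>\<^sub>\<infinity>j. cnj (conv_kernel u v (- i) (- j)))"
    by (rule infsum_reindex_bij_betw[OF bij_uminus, symmetric])
  also have "\<dots> = (\<Sum>\<^sub>\<infinity>j. conv_kernel (star u) (star v) i j)"
    using w_minus[of "i - j" for j] w_minus by (intro infsum_cong) (simp add: conv_kernel_def coef_star)
  finally show "coef (star (conv u v)) i = coef (conv (star u) (star v)) i"
    by (simp add: coef_conv)
qed

lemma star_unit: "star unit = unit"
  by (rule l1_eqI) (simp add: coef_star coef_unit)

lemma star_cpow: "star (cpow u n) = cpow (star u) n"
  by (induction n) (simp_all add: star_unit star_conv)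

definition is_character :: "('a \<Rightarrow> complex) \<Rightarrow> bool" where
  "is_character \<eta> \<longleftrightarrow> (\<forall>i j. \<eta> (i + j) = \<eta> i * \<eta> j) \<and> (\<forall>i. norm (\<eta> i) = 1)"

text \<open>The Gelfand transform at a unitary character. On \<open>int ^ 'd\<close> the characters
  used are the points of the torus, and this is evaluation of the Fourier series there; the division
  undoes the stored weight.\<close>

definition ev :: "('a \<Rightarrow> complex) \<Rightarrow> 'a l1 \<Rightarrow> complex" where
  "ev \<eta> u = (\<Sum>\<^sub>\<infinity>i. coef u i / of_real (w i) * \<eta> i)"

lemma norm_ev_term:
  assumes "norm (\<eta> i) = 1"
  shows "norm (coef u i / of_real (w i) * \<eta> i) \<le> norm (coef u i)"
  using w_ge_1[of i] by (simp add: norm_mult norm_divide assms divide_le_eq mult_le_cancel_left1 zero_less_mult_iff)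

lemma ev_summable:
  assumes "\<And>i. norm (\<eta> i) = 1"
  shows "(\<lambda>i. coef u i / of_real (w i) * \<eta> i) asummable_on UNIV"
  by (rule Infinite_Sum.abs_summable_on_comparison_test'[OF coef_summable norm_ev_term[OF assms]])

lemma norm_ev: "(\<And>i. norm (\<eta> i) = 1) \<Longrightarrow> norm (ev \<eta> u) \<le> norm u"
  unfolding ev_def norm_l1_def
  by (rule order_trans[OF norm_infsum_bound[OF ev_summable] infsum_mono[OF ev_summable coef_summable norm_ev_term]])
     auto

lemma bounded_linear_ev:
  assumes "\<And>i. norm (\<eta> i) = 1"
  shows "bounded_linear (ev \<eta>)"
proof (rule bounded_linear_intro[of _ 1])
  note sum = abs_summable_summable[OF ev_summable[OF assms]]
  show "ev \<eta> (u + v) = ev \<eta> u + ev \<eta> v" for u v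
    unfolding ev_def infsum_add[OF sum sum, symmetric] by (simp add: add_divide_distrib distrib_right)
  show "ev \<eta> (r *\<^sub>R u) = r *\<^sub>R ev \<eta> u" for r u
    unfolding ev_def infsum_scaleR_right[symmetric] by (simp add: scaleR_conv_of_real mult.assoc)
qed (simp add: norm_ev[OF assms])

text \<open>The weight ratios of \<open>conv_kernel\<close> cancel against the division by
  \<open>w i\<close>, and a character splits over \<open>i = (i - j) + j\<close>. What remains is
  Fubini for an absolutely summable double family.\<close>

lemma ev_conv:
  assumes "is_character \<eta>"
  shows "ev \<eta> (conv u v) = ev \<eta> u * ev \<eta> v"
proof -
  have \<eta>: "norm (\<eta> i) = 1" "\<eta> (i + j) = \<eta> i * \<eta> j" for i j
    using assms by (auto simp: is_character_def)
  define a where "a u i = coef u i / of_real (w i) * \<eta> i" for u i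
  have ev_a: "ev \<eta> u = (\<Sum>\<^sub>\<infinity>i. a u i)" for u
    by (simp only: ev_def a_def)
  have summand: "conv_kernel u v i j / of_real (w i) * \<eta> i = a u (i - j) * a v j" for i j
  proof -
    have "\<eta> i = \<eta> (i - j) * \<eta> j"
      using \<eta>(2)[of "i - j" j] by simp
    then show ?thesis
      using w_pos[of i] by (simp add: conv_kernel_def a_def)
  qed
  have bound: "norm (a u (i - j) * a v j) \<le> norm (coef u (i - j)) * norm (coef v j)" for i j
    unfolding norm_mult[of "a u (i - j)"] unfolding a_def
    by (intro mult_mono norm_ev_term \<eta>(1) norm_ge_zero)
  have "(\<lambda>(i, j). a u (i - j) * a v j) asummable_on UNIV \<times> UNIV"
    by (rule abs_summable_kernel(1)[OF coef_summable coef_summable bound]) auto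
  then have sum: "(\<lambda>(i, j). a u (i - j) * a v j) summable_on UNIV \<times> UNIV"
    by (rule abs_summable_summable)
  have "ev \<eta> (conv u v) = (\<Sum>\<^sub>\<infinity>i. \<Sum>\<^sub>\<infinity>j. a u (i - j) * a v j)"
    unfolding ev_def coef_conv
    by (simp add: summand[symmetric] divide_inverse infsum_cmult_left'[symmetric])
  also have "\<dots> = (\<Sum>\<^sub>\<infinity>j. \<Sum>\<^sub>\<infinity>i. a u (i - j) * a v j)"
    by (rule infsum_swap_banach[OF sum])
  also have "\<dots> = (\<Sum>\<^sub>\<infinity>j. (\<Sum>\<^sub>\<infinity>i. a u (i - j)) * a v j)"
    by (simp add: infsum_cmult_left')
  also have "(\<lambda>j. \<Sum>\<^sub>\<infinity>i. a u (i - j)) = (\<lambda>j. ev \<eta> u)"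
  proof
    fix j :: 'a
    have "bij_betw (\<lambda>i. i - j) UNIV UNIV"
      by (rule bij_betwI[of _ _ _ "\<lambda>i. i + j"]) auto
    from infsum_reindex_bij_betw[OF this, of "a u"] show "(\<Sum>\<^sub>\<infinity>i. a u (i - j)) = ev \<eta> u"
      by (simp only: ev_a)
  qed
  finally show ?thesis
    by (simp only: infsum_cmult_right' ev_a)
qed

lemma ev_unit:
  assumes "is_character \<eta>"
  shows "ev \<eta> unit = 1"
proof -
  have "\<eta> 0 = 1"
    using assms by (simp add: is_character_def) (metis add_0 mult_cancel_right1 norm_zero zero_neq_one)
  moreover have "ev \<eta> unit = (\<Sum>\<^sub>\<infinity>i\<in>{0}. coef unit i / of_real (w i) * \<eta> i)"
    unfolding ev_def by (rule infsum_cong_neutral) (auto simp: coef_unit)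
  ultimately show ?thesis
    by (simp add: coef_unit w_0)
qed

lemma ev_cpow: "is_character \<eta> \<Longrightarrow> ev \<eta> (cpow u n) = ev \<eta> u ^ n"
  by (induction n) (simp_all add: ev_unit ev_conv)

end

section \<open>Fourier series on the torus\<close>

abbreviation cell :: "(real ^ 'd) set" where "cell \<equiv> cbox 0 (\<chi> i. 2 * pi)"

definition ivec :: "int ^ 'd \<Rightarrow> real ^ 'd" where "ivec \<nu> = (\<chi> i. of_int (\<nu> $ i))"

lemma ivec_nth [simp]: "ivec \<nu> $ i = of_int (\<nu> $ i)"
  by (simp add: ivec_def)

lemma ivec_add: "ivec (\<mu> + \<nu>) = ivec \<mu> + ivec \<nu>"
  and ivec_minus: "ivec (- \<nu>) = - ivec \<nu>"
  and ivec_0 [simp]: "ivec 0 = 0"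
  by (simp_all add: vec_eq_iff)

definition fchar :: "int ^ 'd \<Rightarrow> real ^ 'd \<Rightarrow> complex" where
  "fchar \<nu> \<psi> = cis (ivec \<nu> \<bullet> \<psi>)"

lemma norm_fchar [simp]: "norm (fchar \<nu> \<psi>) = 1"
  by (simp add: fchar_def)

lemma fchar_add: "fchar (\<mu> + \<nu>) \<psi> = fchar \<mu> \<psi> * fchar \<nu> \<psi>"
  by (simp add: fchar_def ivec_add inner_add_left cis_mult)

lemma fchar_minus: "fchar (- \<nu>) \<psi> = cnj (fchar \<nu> \<psi>)"
  by (simp add: fchar_def ivec_minus cis_cnj)

lemma fchar_shift: "fchar \<nu> (\<psi> + \<phi>) = fchar \<nu> \<psi> * fchar \<nu> \<phi>"
  by (simp add: fchar_def inner_add_right cis_mult)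

lemma fchar_axis: "fchar \<nu> (axis j s) = cis (of_int (\<nu> $ j) * s)"
  by (simp add: fchar_def inner_axis)

lemma fchar_0 [simp]: "fchar 0 \<psi> = 1"
  by (simp add: fchar_def)

lemma continuous_on_fchar [continuous_intros]:
  "continuous_on S f \<Longrightarrow> continuous_on S (\<lambda>x. fchar \<nu> (f x))"
  unfolding fchar_def by (intro continuous_intros)

lemma fchar_periodic: "fchar \<nu> (\<psi> + axis i (2 * pi)) = fchar \<nu> \<psi>"
  using cis_multiple_2pi[of "of_int (\<nu> $ i)"] by (simp add: fchar_shift fchar_axis mult.commute)

lemma torus_periodic_fchar: "torus_periodic (fchar \<nu>)"
  unfolding torus_periodic_def by (simp add: fchar_periodic)

lemma torus_periodic_axis_int:
  assumes "torus_periodic f"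
  shows "f (\<psi> + axis i (2 * pi * of_int k)) = f \<psi>"
proof (induction k rule: int_induct[where k=0])
  case base
  show ?case
    by (simp add: axis_eq_0_iff[THEN iffD2])
next
  case (step1 k)
  have "\<psi> + axis i (2 * pi * of_int (k + 1)) = (\<psi> + axis i (2 * pi * of_int k)) + axis i (2 * pi)"
    by (simp add: vec_eq_iff axis_def algebra_simps)
  then show ?case
    using assms step1(2) unfolding torus_periodic_def by metis
next
  case (step2 k)
  have "f (\<psi> + axis i (2 * pi * of_int k)) = f (\<psi> + axis i (2 * pi * of_int (k - 1)) + axis i (2 * pi))"
    by (rule arg_cong[where f=f]) (simp add: vec_eq_iff axis_def algebra_simps)
  also have "\<dots> = f (\<psi> + axis i (2 * pi * of_int (k - 1)))"
    using assms by (simp add: torus_periodic_def)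
  finally show ?case
    using step2 by simp
qed

lemma torus_periodic_ivec:
  fixes f :: "real ^ 'd \<Rightarrow> 'b"
  assumes "torus_periodic f"
  shows "f (\<psi> + (2 * pi) *\<^sub>R ivec \<nu>) = f \<psi>"
proof -
  have "f (\<psi> + (\<Sum>i\<in>A. axis i (2 * pi * of_int (\<nu> $ i)))) = f \<psi>" if "finite A" for A
    using that
  proof (induction A)
    case (insert i A)
    then show ?case
      using torus_periodic_axis_int[OF assms, of "\<psi> + (\<Sum>i\<in>A. axis i (2 * pi * of_int (\<nu> $ i)))" i "\<nu> $ i"]
      by (simp add: add_ac)
  qed simp
  moreover have "(2 * pi) *\<^sub>R ivec \<nu> = (\<Sum>i\<in>UNIV. axis i (2 * pi * of_int (\<nu> $ i)))"
    by (simp add: vec_eq_iff axis_def)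
  ultimately show ?thesis
    by simp
qed

lemma floor_2pi:
  fixes x :: real
  shows "2 * pi * of_int \<lfloor>x / (2 * pi)\<rfloor> \<le> x" "x \<le> 2 * pi + 2 * pi * of_int \<lfloor>x / (2 * pi)\<rfloor>"
proof -
  have pi2_gt_zero: "0 < 2 * pi"
    by simp
  have "of_int \<lfloor>x / (2 * pi)\<rfloor> \<le> x / (2 * pi)" "x / (2 * pi) \<le> 1 + of_int \<lfloor>x / (2 * pi)\<rfloor>"
    by linarith+
  then show "2 * pi * of_int \<lfloor>x / (2 * pi)\<rfloor> \<le> x" "x \<le> 2 * pi + 2 * pi * of_int \<lfloor>x / (2 * pi)\<rfloor>"
    unfolding pos_le_divide_eq[OF pi2_gt_zero] pos_divide_le_eq[OF pi2_gt_zero] by (simp_all only: algebra_simps)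
qed

lemma reduce_to_cell:
  fixes \<psi> :: "real ^ 'd"
  obtains \<nu> where "\<psi> + (2 * pi) *\<^sub>R ivec \<nu> \<in> cell"
proof
  define \<nu> where "\<nu> = (\<chi> i. - \<lfloor>\<psi> $ i / (2 * pi)\<rfloor>)"
  show "\<psi> + (2 * pi) *\<^sub>R ivec \<nu> \<in> cell"
    using floor_2pi[of "\<psi> $ i" for i] by (auto simp: mem_box_cart \<nu>_def algebra_simps)
qed

section \<open>Averages over the torus\<close>

definition tavg :: "(real ^ 'd \<Rightarrow> complex) \<Rightarrow> complex" where
  "tavg f = integral cell f / of_real ((2 * pi) ^ CARD('d))"

lemma integrable_cell: "continuous_on UNIV f \<Longrightarrow> f integrable_on cell"
  for f :: "real ^ 'd \<Rightarrow> 'b::banach"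
  by (rule integrable_continuous) (auto intro: continuous_on_subset)

lemma tavg_of_real:
  assumes "continuous_on UNIV f"
  shows "tavg (\<lambda>\<psi>. of_real (f \<psi>)) = of_real (torus_average f)"
  using integral_linear[OF integrable_cell[OF assms] bounded_linear_of_real]
  by (simp add: tavg_def torus_average_def o_def)

lemma tavg_add: "continuous_on UNIV f \<Longrightarrow> continuous_on UNIV g \<Longrightarrow> tavg (\<lambda>\<psi>. f \<psi> + g \<psi>) = tavg f + tavg g"
  by (simp add: tavg_def integral_add[OF integrable_cell integrable_cell] add_divide_distrib)

lemma tavg_diff: "continuous_on UNIV f \<Longrightarrow> continuous_on UNIV g \<Longrightarrow> tavg (\<lambda>\<psi>. f \<psi> - g \<psi>) = tavg f - tavg g"
  by (simp add: tavg_def integral_diff[OF integrable_cell integrable_cell] diff_divide_distrib)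

lemma tavg_cmult: "tavg (\<lambda>\<psi>. c * f \<psi>) = c * tavg f"
  by (simp add: tavg_def integral_mult_right)

lemma content_cell: "measure lborel (cell :: (real ^ 'd) set) = (2 * pi) ^ CARD('d)"
proof -
  have "0 \<in> (cell :: (real ^ 'd) set)"
    by (simp add: mem_box_cart)
  then have "(cell :: (real ^ 'd) set) \<noteq> {}"
    by blast
  then show ?thesis
    by (simp add: content_cbox_cart)
qed

lemma norm_tavg_le:
  fixes f :: "real ^ 'd \<Rightarrow> complex"
  assumes "continuous_on UNIV f" "\<And>\<psi>. norm (f \<psi>) \<le> B"
  shows "norm (tavg f) \<le> B"
proof -
  have B: "0 \<le> B"
    using assms(2) norm_ge_zero order_trans by blast
  have "norm (integral cell f) \<le> B * (2 * pi) ^ CARD('d)"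
    unfolding content_cell[symmetric]
    by (rule has_integral_bound[OF B integrable_integral[OF integrable_cell[OF assms(1)]]]) (use assms in auto)
  then show ?thesis
    by (simp add: tavg_def norm_divide norm_mult norm_power power_mult_distrib pos_divide_le_eq)
qed

lemma tavg_const: "tavg (\<lambda>\<psi>. c) = c"
  by (simp add: tavg_def content_cell scaleR_conv_of_real)

text \<open>Only the \<open>j\<close>-th side of the cell moves: split [s, s + 2 pi] at 2 pi and
  carry the overhanging piece [2 pi, s + 2 pi] back to [0, s] by periodicity.\<close>

lemma tavg_shift_pos:
  fixes f :: "real ^ 'd \<Rightarrow> complex"
  assumes cont: "continuous_on UNIV f" and per: "torus_periodic f" and s: "0 \<le> s" "s \<le> 2 * pi"
  shows "tavg (\<lambda>\<psi>. f (\<psi> + axis j s)) = tavg f"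
proof -
  define Q where "Q a b = cbox (\<chi> i. if i = j then a else 0) (\<chi> i. if i = j then b else 2 * pi)" for a b :: real
  have Q_eq: "Q a b = {x. a \<le> x $ j \<and> x $ j \<le> b \<and> (\<forall>i. i \<noteq> j \<longrightarrow> 0 \<le> x $ i \<and> x $ i \<le> 2 * pi)}" for a b
  proof (rule set_eqI)
    fix x :: "real ^ 'd"
    have split: "(\<forall>i. P i) \<longleftrightarrow> P j \<and> (\<forall>i. i \<noteq> j \<longrightarrow> P i)" for P
      by metis
    have "x \<in> Q a b \<longleftrightarrow> (\<forall>i. (if i = j then a else 0) \<le> x $ i \<and> x $ i \<le> (if i = j then b else 2 * pi))"
      by (simp add: Q_def mem_box_cart)
    then show "x \<in> Q a b \<longleftrightarrow> x \<in> {x. a \<le> x $ j \<and> x $ j \<le> b \<and> (\<forall>i. i \<noteq> j \<longrightarrow> 0 \<le> x $ i \<and> x $ i \<le> 2 * pi)}"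
      by (subst (asm) split) simp
  qed
  define I where "I a b = integral (Q a b) f" for a b
  have combine: "I a b = I a c + I c b" if "a \<le> c" "c \<le> b" for a b c
  proof -
    have "f integrable_on Q a b"
      unfolding Q_def by (rule integrable_continuous) (auto intro: continuous_on_subset[OF cont])
    then have "I a b = integral (Q a b \<inter> {x. x \<bullet> axis j 1 \<le> c}) f + integral (Q a b \<inter> {x. x \<bullet> axis j 1 \<ge> c}) f"
      unfolding I_def Q_def by (rule integral_split) (simp add: axis_in_Basis_iff)
    moreover have "Q a b \<inter> {x. x \<bullet> axis j 1 \<le> c} = Q a c" "Q a b \<inter> {x. x \<bullet> axis j 1 \<ge> c} = Q c b"
      unfolding Q_eq using that by (auto simp: inner_axis)
    ultimately show ?thesis
      by (simp add: I_def)
  qed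
  have shift: "integral (Q a b) (\<lambda>\<psi>. f (\<psi> + axis j r)) = I (a + r) (b + r)" for a b r
  proof -
    have "(\<chi> i. if i = j then a else 0) = (\<chi> i. if i = j then a + r else 0) - axis j r"
      "(\<chi> i. if i = j then b else 2 * pi) = (\<chi> i. if i = j then b + r else 2 * pi) - axis j r"
      by (auto simp: vec_eq_iff axis_def)
    then show ?thesis
      unfolding I_def Q_def by (simp only: integral_shift_cbox)
  qed
  have cell: "cell = Q 0 (2 * pi)"
    unfolding Q_def by (rule arg_cong2[where f=cbox]) (auto simp: vec_eq_iff)
  have "I (2 * pi) (s + 2 * pi) = I 0 s"
    using shift[of 0 s "2 * pi"] per by (simp add: torus_periodic_def I_def)
  moreover have "integral cell (\<lambda>\<psi>. f (\<psi> + axis j s)) = I s (s + 2 * pi)"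
    using shift[of 0 "2 * pi" s] by (simp add: cell add.commute)
  moreover have "I s (s + 2 * pi) = I s (2 * pi) + I (2 * pi) (s + 2 * pi)" "I 0 (2 * pi) = I 0 s + I s (2 * pi)"
    using s by (auto intro!: combine)
  ultimately have "integral cell (\<lambda>\<psi>. f (\<psi> + axis j s)) = integral cell f"
    by (simp add: cell I_def)
  then show ?thesis
    by (simp add: tavg_def)
qed

lemma tavg_shift:
  assumes "continuous_on UNIV f" and "torus_periodic f"
  shows "tavg (\<lambda>\<psi>. f (\<psi> + axis j s)) = tavg f"
proof -
  define k where "k = \<lfloor>s / (2 * pi)\<rfloor>"
  define r where "r = s - 2 * pi * k"
  have "0 \<le> r" "r \<le> 2 * pi"
    using floor_2pi[of s] by (auto simp: r_def k_def)
  moreover have "f (\<psi> + axis j s) = f (\<psi> + axis j r)" for \<psi>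
  proof -
    have "\<psi> + axis j s = \<psi> + axis j r + axis j (2 * pi * of_int k)"
      by (simp add: vec_eq_iff axis_def r_def)
    then show ?thesis
      by (simp only: torus_periodic_axis_int[OF assms(2)])
  qed
  ultimately show ?thesis
    using tavg_shift_pos[OF assms] by simp
qed

text \<open>Translation invariance replaces integration: shifting a coordinate \<open>j\<close> with
  \<open>\<nu> $ j \<noteq> 0\<close> by \<open>pi / \<nu> $ j\<close> multiplies the character by
  -1, so its average equals its own negative.\<close>

lemma tavg_fchar: "tavg (fchar \<nu>) = (if \<nu> = 0 then 1 else 0)"
proof (cases "\<nu> = 0")
  case True
  then have "fchar \<nu> = (\<lambda>_. 1)"
    by (simp add: fun_eq_iff)
  then show ?thesis
    using True by (simp add: tavg_const)
next
  case False
  then obtain j where j: "\<nu> $ j \<noteq> 0"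
    by (auto simp: vec_eq_iff)
  have "tavg (fchar \<nu>) = tavg (\<lambda>\<psi>. fchar \<nu> (\<psi> + axis j (pi / \<nu> $ j)))"
    by (rule tavg_shift[symmetric]) (auto intro!: continuous_intros torus_periodic_fchar)
  also have "\<dots> = tavg (\<lambda>\<psi>. (- 1) * fchar \<nu> \<psi>)"
    using j by (simp add: fchar_shift fchar_axis)
  finally show ?thesis
    using False unfolding tavg_cmult by simp
qed

lemma tavg_infsum:
  fixes f :: "'i \<Rightarrow> real ^ 'd \<Rightarrow> complex"
  assumes cont: "\<And>i. continuous_on UNIV (f i)" and M: "\<And>i \<psi>. norm (f i \<psi>) \<le> M i" "M summable_on UNIV"
  shows "continuous_on UNIV (\<lambda>\<psi>. \<Sum>\<^sub>\<infinity>i. f i \<psi>)"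
    and "((\<lambda>i. tavg (f i)) has_sum tavg (\<lambda>\<psi>. \<Sum>\<^sub>\<infinity>i. f i \<psi>)) UNIV"
proof -
  have lim: "uniform_limit UNIV (\<lambda>F \<psi>. \<Sum>i\<in>F. f i \<psi>) (\<lambda>\<psi>. \<Sum>\<^sub>\<infinity>i. f i \<psi>) (finite_subsets_at_top UNIV)"
    by (rule Weierstrass_m_test_general) (use M in auto)
  have cont_sum: "continuous_on UNIV (\<lambda>\<psi>. \<Sum>i\<in>F. f i \<psi>)" for F
    by (intro continuous_intros cont)
  show cont_inf: "continuous_on UNIV (\<lambda>\<psi>. \<Sum>\<^sub>\<infinity>i. f i \<psi>)"
    by (rule uniform_limit_theorem[OF _ lim]) (auto simp: cont_sum)
  have tavg_sum: "tavg (\<lambda>\<psi>. \<Sum>i\<in>F. f i \<psi>) = (\<Sum>i\<in>F. tavg (f i))" if "finite F" for F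
    using that
  proof (induction F)
    case (insert i F)
    then show ?case
      by (simp add: tavg_add[OF cont cont_sum])
  qed (simp add: tavg_const)
  show "((\<lambda>i. tavg (f i)) has_sum tavg (\<lambda>\<psi>. \<Sum>\<^sub>\<infinity>i. f i \<psi>)) UNIV"
    unfolding has_sum_def
  proof (rule tendstoI)
    fix e :: real assume "e > 0"
    with lim have "\<forall>\<^sub>F F in finite_subsets_at_top UNIV. \<forall>\<psi>\<in>UNIV. dist (\<Sum>i\<in>F. f i \<psi>) (\<Sum>\<^sub>\<infinity>i. f i \<psi>) < e / 2"
      by (auto dest!: uniform_limitD[where e="e/2"])
    then show "\<forall>\<^sub>F F in finite_subsets_at_top UNIV.
        dist (\<Sum>i\<in>F. tavg (f i)) (tavg (\<lambda>\<psi>. \<Sum>\<^sub>\<infinity>i. f i \<psi>)) < e"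
    proof (rule eventually_rev_mp[OF _ eventually_finite_subsets_at_top_weakI], intro impI)
      fix F :: "'i set"
      assume "finite F" and F: "\<forall>\<psi>\<in>UNIV. dist (\<Sum>i\<in>F. f i \<psi>) (\<Sum>\<^sub>\<infinity>i. f i \<psi>) < e / 2"
      have "norm (tavg (\<lambda>\<psi>. (\<Sum>i\<in>F. f i \<psi>) - (\<Sum>\<^sub>\<infinity>i. f i \<psi>))) \<le> e / 2"
      proof (rule norm_tavg_le)
        show "continuous_on UNIV (\<lambda>\<psi>. (\<Sum>i\<in>F. f i \<psi>) - (\<Sum>\<^sub>\<infinity>i. f i \<psi>))"
          by (rule continuous_on_diff[OF cont_sum cont_inf])
        show "norm ((\<Sum>i\<in>F. f i \<psi>) - (\<Sum>\<^sub>\<infinity>i. f i \<psi>)) \<le> e / 2" for \<psi>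
          using F[rule_format, of \<psi>] by (simp add: dist_norm)
      qed
      also have "e / 2 < e"
        using \<open>e > 0\<close> by simp
      finally show "dist (\<Sum>i\<in>F. tavg (f i)) (tavg (\<lambda>\<psi>. \<Sum>\<^sub>\<infinity>i. f i \<psi>)) < e"
        by (simp only: tavg_diff[OF cont_sum cont_inf] tavg_sum[OF \<open>finite F\<close>] dist_norm)
    qed
  qed
qed

section \<open>Trigonometric polynomials, their density, and uniqueness of Fourier
  coefficients\<close>

inductive trig :: "(real ^ 'd \<Rightarrow> complex) \<Rightarrow> bool" where
  trig_fchar: "trig (\<lambda>\<psi>. c * fchar \<nu> \<psi>)"
| trig_add: "trig p \<Longrightarrow> trig q \<Longrightarrow> trig (\<lambda>\<psi>. p \<psi> + q \<psi>)"

lemma trig_const: "trig (\<lambda>\<psi>. c)"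
  using trig_fchar[of c 0] by simp

lemma trig_cmult: "trig p \<Longrightarrow> trig (\<lambda>\<psi>. c * p \<psi>)"
proof (induction rule: trig.induct)
  case (trig_fchar a \<nu>)
  then show ?case
    using trig.trig_fchar[of "c * a" \<nu>] by (simp add: mult.assoc)
next
  case (trig_add p q)
  then show ?case
    using trig.trig_add by (simp add: distrib_left)
qed

lemma trig_mult:
  assumes p: "trig p" and q: "trig q"
  shows "trig (\<lambda>\<psi>. p \<psi> * q \<psi>)"
  using p
proof (induction rule: trig.induct)
  case (trig_fchar c \<nu>)
  have "trig (\<lambda>\<psi>. fchar \<nu> \<psi> * q \<psi>)"
    using q
  proof (induction rule: trig.induct)
    case (trig_fchar a \<mu>)
    then show ?case
      using trig.trig_fchar[of a "\<nu> + \<mu>"] by (simp add: fchar_add mult.left_commute)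
  next
    case (trig_add p q)
    then show ?case
      using trig.trig_add by (simp add: distrib_left)
  qed
  then show ?case
    using trig_cmult[of _ c] by (simp add: mult.assoc)
next
  case (trig_add p q)
  then show ?case
    using trig.trig_add by (simp add: distrib_right)
qed

lemma trig_sum: "finite A \<Longrightarrow> (\<And>i. i \<in> A \<Longrightarrow> trig (p i)) \<Longrightarrow> trig (\<lambda>\<psi>. \<Sum>i\<in>A. p i \<psi>)"
  by (induction A rule: finite_induct) (auto intro: trig_const trig_add)

lemma continuous_on_trig: "trig p \<Longrightarrow> continuous_on S p"
  by (induction rule: trig.induct) (auto intro!: continuous_intros)

lemma trig_cos: "trig (\<lambda>\<psi>. of_real (cos (\<psi> $ i)))"
  and trig_sin: "trig (\<lambda>\<psi>. of_real (sin (\<psi> $ i)))"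
proof -
  have e: "fchar (axis i 1) \<psi> = cis (\<psi> $ i)" for \<psi>
  proof -
    have "ivec (axis i 1) = axis i 1"
      by (simp add: vec_eq_iff axis_def)
    then show ?thesis
      by (simp add: fchar_def inner_axis')
  qed
  have "of_real (cos x) = (1 / 2) * cis x + (1 / 2) * cnj (cis x)"
    "of_real (sin x) = (- \<i> / 2) * cis x + (\<i> / 2) * cnj (cis x)" for x
    by (simp_all add: complex_eq_iff)
  then show "trig (\<lambda>\<psi>. of_real (cos (\<psi> $ i)))" "trig (\<lambda>\<psi>. of_real (sin (\<psi> $ i)))"
    by (simp_all only: e[symmetric] fchar_minus[symmetric]) (intro trig_add trig_fchar)+
qed

text \<open>Embeds the torus as a compact subset of complex space, where Stone-Weierstrass for real
  polynomials is available.\<close>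

definition cisv :: "real ^ 'd \<Rightarrow> complex ^ 'd" where "cisv \<psi> = (\<chi> i. cis (\<psi> $ i))"

lemma trig_real_polynomial:
  fixes p :: "complex ^ 'd \<Rightarrow> real"
  assumes "real_polynomial_function p"
  shows "trig (\<lambda>\<psi>. of_real (p (cisv \<psi>)))"
  using assms
proof (induction rule: real_polynomial_function.induct)
  case (linear f)
  then interpret f: bounded_linear f .
  have "cisv \<psi> = (\<Sum>i\<in>UNIV. cos (\<psi> $ i) *\<^sub>R axis i 1 + sin (\<psi> $ i) *\<^sub>R axis i \<i>)" for \<psi> :: "real ^ 'd"
    by (simp add: vec_eq_iff cisv_def axis_def if_distrib if_distribR sum.If_cases complex_eq_iff cong: if_cong)
  then have "of_real (f (cisv \<psi>)) = (\<Sum>i\<in>UNIV. of_real (f (axis i 1)) * of_real (cos (\<psi> $ i))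
      + of_real (f (axis i \<i>)) * complex_of_real (sin (\<psi> $ i)))" for \<psi>
    by (simp add: f.sum f.add f.scaleR mult.commute)
  then show ?case
    by (simp only:) (intro trig_sum trig_add trig_cmult trig_cos trig_sin finite)
qed (auto intro: trig_const trig_add trig_mult)

lemma cisv_eqD:
  fixes f :: "real ^ 'd \<Rightarrow> 'b"
  assumes "torus_periodic f" "cisv \<phi> = cisv \<psi>"
  shows "f \<phi> = f \<psi>"
proof -
  have "\<exists>k::int. \<phi> $ i = \<psi> $ i + 2 * pi * k" for i
  proof -
    have "cis (\<phi> $ i) = cis (\<psi> $ i)"
      using assms(2) by (simp add: cisv_def vec_eq_iff)
    then have "sin (\<phi> $ i) = sin (\<psi> $ i) \<and> cos (\<phi> $ i) = cos (\<psi> $ i)"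
      by (simp add: complex_eq_iff)
    then show ?thesis
      by (simp add: sin_cos_eq_iff)
  qed
  then obtain k :: "'d \<Rightarrow> int" where k: "\<phi> $ i = \<psi> $ i + 2 * pi * k i" for i
    by metis
  have "\<phi> = \<psi> + (2 * pi) *\<^sub>R ivec (\<chi> i. k i)"
    by (simp add: vec_eq_iff k)
  then show ?thesis
    by (simp only: torus_periodic_ivec[OF assms(1)])
qed

text \<open>Stone-Weierstrass on the image of \<open>cisv\<close>. The function \<open>G\<close>
  descends to a continuous function there because a continuous map from a compact space onto a
  Hausdorff one is a quotient map, and \<open>G\<close> is constant on its fibres.\<close>

lemma trig_dense:
  fixes G :: "real ^ 'd \<Rightarrow> real"
  assumes cont: "continuous_on UNIV G" and per: "torus_periodic G" and e: "e > 0"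
  obtains p where "trig p" "\<And>\<psi>. norm (of_real (G \<psi>) - p \<psi>) < e"
proof -
  define S where "S = cisv ` (cell :: (real ^ 'd) set)"
  define g where "g z = G (inv_into cell cisv z)" for z
  have g: "g (cisv \<psi>) = G \<psi>" if "\<psi> \<in> cell" for \<psi>
    unfolding g_def by (rule cisv_eqD[OF per]) (simp add: f_inv_into_f that)
  have cont_cisv: "continuous_on A cisv" for A :: "(real ^ 'd) set"
    unfolding cisv_def by (intro continuous_on_vec_lambda continuous_intros)
  have compact: "compact S"
    unfolding S_def by (rule compact_continuous_image[OF cont_cisv compact_cbox])
  have "quotient_map (top_of_set cell) (top_of_set S) cisv"
    by (rule T1_Spaces.continuous_imp_quotient_map)
       (auto simp: cont_cisv S_def compact_space_subtopology Hausdorff_space_subtopology)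
  moreover have "continuous_map (top_of_set cell) euclideanreal (g \<circ> cisv)"
    using continuous_on_cong[of cell cell "g \<circ> cisv" G] continuous_on_subset[OF cont] by (simp add: g)
  ultimately have "continuous_map (top_of_set S) euclideanreal g"
    using continuous_compose_quotient_map_eq by blast
  then have "continuous_on S g"
    by simp
  then obtain q where q: "real_polynomial_function q" "\<And>z. z \<in> S \<Longrightarrow> \<bar>g z - q z\<bar> < e"
    using Stone_Weierstrass_real_polynomial_function[OF compact _ e] by blast
  show ?thesis
  proof
    show "trig (\<lambda>\<psi>. of_real (q (cisv \<psi>)))"
      by (rule trig_real_polynomial) fact
    fix \<psi> :: "real ^ 'd"
    obtain \<nu> where \<nu>: "\<psi> + (2 * pi) *\<^sub>R ivec \<nu> \<in> cell"
      by (rule reduce_to_cell)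
    have "torus_periodic (cisv :: real ^ 'd \<Rightarrow> _)"
      by (auto simp: torus_periodic_def cisv_def vec_eq_iff axis_def complex_eq_iff)
    then have "cisv (\<psi> + (2 * pi) *\<^sub>R ivec \<nu>) = cisv \<psi>"
      by (rule torus_periodic_ivec)
    then have "\<bar>G (\<psi> + (2 * pi) *\<^sub>R ivec \<nu>) - q (cisv \<psi>)\<bar> < e"
      using q(2)[of "cisv \<psi>"] g[OF \<nu>] \<nu> by (metis S_def image_eqI)
    then have "\<bar>G \<psi> - q (cisv \<psi>)\<bar> < e"
      by (simp only: torus_periodic_ivec[OF per])
    then show "norm (of_real (G \<psi>) - complex_of_real (q (cisv \<psi>))) < e"
      by (metis norm_of_real of_real_diff)
  qed
qed

definition fcoef :: "(real ^ 'd \<Rightarrow> complex) \<Rightarrow> int ^ 'd \<Rightarrow> complex" where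
  "fcoef f \<nu> = tavg (\<lambda>\<psi>. f \<psi> * fchar (- \<nu>) \<psi>)"

text \<open>\<open>G\<close> is orthogonal to every trigonometric polynomial \<open>p\<close>, so
  the average of \<open>G * G\<close> equals that of \<open>G * (G - p)\<close>, which density makes
  arbitrarily small. A continuous nonnegative function with integral 0 vanishes.\<close>

lemma real_fcoef_zero:
  fixes G :: "real ^ 'd \<Rightarrow> real"
  assumes cont: "continuous_on UNIV G" and per: "torus_periodic G"
    and zero: "\<And>\<nu>. tavg (\<lambda>\<psi>. of_real (G \<psi>) * fchar \<nu> \<psi>) = 0"
  shows "G \<psi> = 0"
proof -
  have contc: "continuous_on UNIV (\<lambda>\<psi>. complex_of_real (G \<psi>))"
    by (intro continuous_intros cont)
  have orth: "tavg (\<lambda>\<psi>. of_real (G \<psi>) * p \<psi>) = 0" if "trig p" for p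
    using that
  proof (induction rule: trig.induct)
    case (trig_fchar c \<nu>)
    then show ?case
      using tavg_cmult[of c "\<lambda>\<psi>. of_real (G \<psi>) * fchar \<nu> \<psi>"] zero[of \<nu>] by (simp add: mult.left_commute)
  next
    case (trig_add p q)
    then have "tavg (\<lambda>\<psi>. of_real (G \<psi>) * p \<psi> + of_real (G \<psi>) * q \<psi>) = 0"
      by (subst tavg_add[OF continuous_on_mult[OF contc continuous_on_trig] continuous_on_mult[OF contc continuous_on_trig]])
         auto
    then show ?case
      by (simp add: distrib_left)
  qed
  have bdd: "\<exists>B. \<forall>\<psi>. \<bar>G \<psi>\<bar> \<le> B"
  proof -
    have "bounded (G ` cell)"
      by (intro compact_imp_bounded compact_continuous_image continuous_on_subset[OF cont]) auto
    then obtain B where "\<And>\<psi>. \<psi> \<in> cell \<Longrightarrow> \<bar>G \<psi>\<bar> \<le> B"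
      by (auto simp: bounded_iff)
    then show ?thesis
      by (metis reduce_to_cell torus_periodic_ivec[OF per])
  qed
  then obtain B where B: "\<And>\<psi>. \<bar>G \<psi>\<bar> \<le> B"
    by blast
  have B_nonneg: "0 \<le> B"
    using B[of 0] by linarith
  have "norm (tavg (\<lambda>\<psi>. of_real (G \<psi> * G \<psi>))) \<le> 0 + e" if "e > 0" for e
  proof -
    obtain p where p: "trig p" "\<And>\<psi>. norm (of_real (G \<psi>) - p \<psi>) < e / (B + 1)"
      using trig_dense[OF cont per, of "e / (B + 1)"] \<open>e > 0\<close> B_nonneg by (auto simp: divide_pos_pos)
    have "tavg (\<lambda>\<psi>. of_real (G \<psi> * G \<psi>)) = tavg (\<lambda>\<psi>. of_real (G \<psi> * G \<psi>)) - tavg (\<lambda>\<psi>. of_real (G \<psi>) * p \<psi>)"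
      by (simp add: orth[OF p(1)])
    also have "\<dots> = tavg (\<lambda>\<psi>. of_real (G \<psi>) * (of_real (G \<psi>) - p \<psi>))"
      by (subst tavg_diff[OF _ continuous_on_mult[OF contc continuous_on_trig[OF p(1)]], symmetric])
         (auto intro!: continuous_intros cont simp: right_diff_distrib)
    also have "norm \<dots> \<le> B * (e / (B + 1))"
    proof (rule norm_tavg_le)
      show "continuous_on UNIV (\<lambda>\<psi>. of_real (G \<psi>) * (of_real (G \<psi>) - p \<psi>))"
        by (intro continuous_intros cont continuous_on_trig p)
      show "norm (of_real (G \<psi>) * (of_real (G \<psi>) - p \<psi>)) \<le> B * (e / (B + 1))" for \<psi>
        unfolding norm_mult using B p(2)[of \<psi>] B_nonneg by (intro mult_mono) (auto simp: less_imp_le)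
    qed
    also have "\<dots> \<le> 0 + e"
      using \<open>e > 0\<close> B_nonneg by (simp add: field_simps)
    finally show ?thesis .
  qed
  then have "norm (tavg (\<lambda>\<psi>. of_real (G \<psi> * G \<psi>))) \<le> 0"
    by (rule field_le_epsilon)
  then have "torus_average (\<lambda>\<psi>. G \<psi> * G \<psi>) = 0"
    using tavg_of_real[of "\<lambda>\<psi>. G \<psi> * G \<psi>"] cont by (simp add: continuous_intros)
  then have "integral cell (\<lambda>\<psi>. G \<psi> * G \<psi>) = 0"
    by (simp add: torus_average_def)
  moreover have "(\<lambda>\<psi>. G \<psi> * G \<psi>) integrable_on cell"
    by (intro integrable_cell continuous_intros cont)
  ultimately have int: "((\<lambda>\<psi>. G \<psi> * G \<psi>) has_integral 0) cell"
    by (metis integrable_integral)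
  have cont_sq: "continuous_on cell (\<lambda>\<psi>. G \<psi> * G \<psi>)"
    by (intro continuous_intros continuous_on_subset[OF cont] subset_UNIV)
  have ne: "box 0 (\<chi> i. 2 * pi) \<noteq> ({} :: (real ^ 'd) set)"
    unfolding interval_ne_empty_cart by simp
  have zero_cell: "G \<phi> * G \<phi> = 0" if "\<phi> \<in> cell" for \<phi>
    by (rule has_integral_0_cbox_imp_0[OF cont_sq _ int ne that]) (rule zero_le_square)
  obtain \<nu> where "\<psi> + (2 * pi) *\<^sub>R ivec \<nu> \<in> cell"
    by (rule reduce_to_cell)
  from zero_cell[OF this] show ?thesis
    by (simp add: torus_periodic_ivec[OF per])
qed

lemma tavg_cnj: "continuous_on UNIV f \<Longrightarrow> tavg (\<lambda>\<psi>. cnj (f \<psi>)) = cnj (tavg f)"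
  using integral_linear[OF integrable_cell bounded_linear_cnj, of f] by (simp add: tavg_def o_def)

text \<open>Density was proved for real functions, so real and imaginary parts are treated
  separately; their coefficients combine those of \<open>F\<close> and of its conjugate.\<close>

lemma fcoef_zero:
  fixes F :: "real ^ 'd \<Rightarrow> complex"
  assumes cont: "continuous_on UNIV F" and per: "torus_periodic F" and zero: "\<And>\<nu>. fcoef F \<nu> = 0"
  shows "F \<psi> = 0"
proof -
  have F: "tavg (\<lambda>\<psi>. F \<psi> * fchar \<nu> \<psi>) = 0" for \<nu>
    using zero[of "- \<nu>"] by (simp add: fcoef_def)
  have cF: "tavg (\<lambda>\<psi>. cnj (F \<psi>) * fchar \<nu> \<psi>) = 0" for \<nu>
    using tavg_cnj[of "\<lambda>\<psi>. F \<psi> * fchar (- \<nu>) \<psi>"] F[of "- \<nu>"] cont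
    by (simp add: fchar_minus continuous_intros)
  have re: "of_real (Re z) * w = (1 / 2) * (z * w) + (1 / 2) * (cnj z * w)"
    and im: "of_real (Im z) * w = (- \<i> / 2) * (z * w) + (\<i> / 2) * (cnj z * w)" for z w
    by (simp_all add: complex_eq_iff field_simps)
  have "tavg (\<lambda>\<psi>. a * (F \<psi> * fchar \<nu> \<psi>) + b * (cnj (F \<psi>) * fchar \<nu> \<psi>)) = 0" for a b \<nu>
    using cont by (subst tavg_add) (auto intro!: continuous_intros simp: tavg_cmult F cF)
  then have "tavg (\<lambda>\<psi>. of_real (Re (F \<psi>)) * fchar \<nu> \<psi>) = 0" "tavg (\<lambda>\<psi>. of_real (Im (F \<psi>)) * fchar \<nu> \<psi>) = 0" for \<nu>
    by (simp_all only: re im)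
  then have "Re (F \<psi>) = 0" "Im (F \<psi>) = 0"
    using real_fcoef_zero[of "\<lambda>\<psi>. Re (F \<psi>)" \<psi>] real_fcoef_zero[of "\<lambda>\<psi>. Im (F \<psi>)" \<psi>] cont per
    by (auto simp: torus_periodic_def intro!: continuous_intros)
  then show ?thesis
    by (simp add: complex_eq_iff)
qed

text \<open>The series converges to a continuous function which, by orthogonality of the characters,
  has the coefficients of \<open>F\<close>; uniqueness identifies the two.\<close>

lemma fourier_series:
  fixes F :: "real ^ 'd \<Rightarrow> complex"
  assumes cont: "continuous_on UNIV F" and per: "torus_periodic F"
    and sum: "(\<lambda>\<nu>. norm (fcoef F \<nu>)) summable_on UNIV"
  shows "F \<psi> = (\<Sum>\<^sub>\<infinity>\<nu>. fcoef F \<nu> * fchar \<nu> \<psi>)"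
proof -
  define S where "S \<psi> = (\<Sum>\<^sub>\<infinity>\<nu>. fcoef F \<nu> * fchar \<nu> \<psi>)" for \<psi>
  have contS: "continuous_on UNIV S"
    unfolding S_def by (rule tavg_infsum(1)[OF _ _ sum]) (auto intro!: continuous_intros simp: norm_mult)
  have "fcoef S \<mu> = fcoef F \<mu>" for \<mu>
  proof -
    have "((\<lambda>\<nu>. tavg (\<lambda>\<psi>. fcoef F \<nu> * fchar \<nu> \<psi> * fchar (- \<mu>) \<psi>)) has_sum
        tavg (\<lambda>\<psi>. \<Sum>\<^sub>\<infinity>\<nu>. fcoef F \<nu> * fchar \<nu> \<psi> * fchar (- \<mu>) \<psi>)) UNIV"
      by (rule tavg_infsum(2)[OF _ _ sum]) (auto intro!: continuous_intros simp: norm_mult)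
    moreover have "tavg (\<lambda>\<psi>. fcoef F \<nu> * fchar \<nu> \<psi> * fchar (- \<mu>) \<psi>) = (if \<nu> = \<mu> then fcoef F \<mu> else 0)" for \<nu>
      using tavg_cmult[of "fcoef F \<nu>" "fchar (\<nu> + (- \<mu>))"] tavg_fchar[of "\<nu> + (- \<mu>)"]
      by (simp add: mult.assoc fchar_add[symmetric])
    moreover have "(\<Sum>\<^sub>\<infinity>\<nu>. if \<nu> = \<mu> then fcoef F \<mu> else 0) = (\<Sum>\<^sub>\<infinity>\<nu>\<in>{\<mu>}. if \<nu> = \<mu> then fcoef F \<mu> else 0)"
      by (rule infsum_cong_neutral) auto
    ultimately show ?thesis
      by (simp add: fcoef_def S_def infsum_cmult_left' has_sum_iff)
  qed
  then have "fcoef (\<lambda>\<psi>. F \<psi> - S \<psi>) \<nu> = 0" for \<nu>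
    using tavg_diff[of "\<lambda>\<psi>. F \<psi> * fchar (- \<nu>) \<psi>" "\<lambda>\<psi>. S \<psi> * fchar (- \<nu>) \<psi>"] cont contS
    by (simp add: fcoef_def left_diff_distrib continuous_intros)
  moreover have "torus_periodic (\<lambda>\<psi>. F \<psi> - S \<psi>)"
    using per unfolding torus_periodic_def S_def by (simp only: fchar_periodic simp_thms)
  ultimately have "F \<psi> - S \<psi> = 0"
    using fcoef_zero[OF continuous_on_diff[OF cont contS]] by blast
  then show ?thesis
    by (simp add: S_def)
qed

section \<open>Exponential decay of Fourier coefficients from Taylor bounds\<close>

text \<open>Zeros of a nontrivial complex power series are isolated, whereas a real interval around
  0 accumulates there.\<close>

lemma powser_zero_on_reals:
  fixes a :: "nat \<Rightarrow> complex"
  assumes "\<delta> > 0" and zero: "\<And>s. \<bar>s\<bar> < \<delta> \<Longrightarrow> (\<lambda>n. a n * of_real s ^ n) sums 0"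
  shows "a n = 0"
proof (rule ccontr)
  assume n: "a n \<noteq> 0"
  have "a 0 = 0"
    using zero[of 0] \<open>\<delta> > 0\<close> by simp
  then have "n > 0"
    using n by (cases n) auto
  define f where "f z = (\<Sum>n. a n * z ^ n)" for z
  have sums: "(\<lambda>n. a n * (z - 0) ^ n) sums f z" if "norm (z - 0) < \<delta> / 2" for z
  proof -
    have "summable (\<lambda>n. a n * of_real (\<delta> / 2) ^ n)"
      using zero[of "\<delta> / 2"] \<open>\<delta> > 0\<close> by (simp add: sums_iff)
    then have "summable (\<lambda>n. a n * z ^ n)"
      by (rule powser_inside) (use that \<open>\<delta> > 0\<close> in simp)
    then show ?thesis
      by (simp add: f_def summable_sums)
  qed
  obtain s where s: "0 < s" "\<And>z. z \<in> cball 0 s - {0} \<Longrightarrow> f z \<noteq> 0"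
    using powser_0_nonzero[of "\<delta> / 2" 0 a f n, OF _ sums] \<open>\<delta> > 0\<close> \<open>n > 0\<close> n \<open>a 0 = 0\<close>
    by (auto simp: f_def)
  define t where "t = min s (\<delta> / 2)"
  have "0 < t" "t \<le> s" "t < \<delta>"
    using s(1) \<open>\<delta> > 0\<close> by (auto simp: t_def)
  then show False
    using s(2)[of "of_real t"] zero[of t] by (simp add: f_def sums_iff)
qed

lemma fcoef_shift:
  assumes "continuous_on UNIV F" "torus_periodic F"
  shows "fcoef (\<lambda>\<psi>. F (\<psi> + axis j s)) \<nu> = cis (of_int (\<nu> $ j) * s) * fcoef F \<nu>"
proof -
  define G where "G \<psi> = F \<psi> * fchar (- \<nu>) \<psi>" for \<psi>
  have "F (\<psi> + axis j s) * fchar (- \<nu>) \<psi> = cis (of_int (\<nu> $ j) * s) * G (\<psi> + axis j s)" for \<psi>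
    by (simp add: G_def fchar_shift fchar_axis cis_mult)
  then have "fcoef (\<lambda>\<psi>. F (\<psi> + axis j s)) \<nu> = cis (of_int (\<nu> $ j) * s) * tavg (\<lambda>\<psi>. G (\<psi> + axis j s))"
    by (simp add: fcoef_def tavg_cmult)
  also have "tavg (\<lambda>\<psi>. G (\<psi> + axis j s)) = tavg G"
    using assms torus_periodic_fchar[of "- \<nu>"] unfolding G_def
    by (intro tavg_shift) (auto intro!: continuous_intros simp: torus_periodic_def)
  finally show ?thesis
    by (simp only: fcoef_def G_def[abs_def])
qed

text \<open>Shifting the argument by \<open>s\<close> in direction \<open>j\<close> multiplies the coefficient by \<open>cis (\<nu>\<^sub>j s)\<close>;
  comparing Taylor coefficients in \<open>s\<close> bounds \<open>\<bar>\<nu>\<^sub>j\<bar>\<^sup>n / n!\<close> times the coefficient.\<close>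

lemma fcoef_decay:
  fixes F :: "real ^ 'd \<Rightarrow> complex"
  assumes cont: "continuous_on UNIV F" and per: "torus_periodic F"
    and B: "\<And>n. continuous_on UNIV (B n)" "\<And>n \<psi>. norm (B n \<psi>) \<le> M * N ^ n"
    and N: "N > 0" and taylor: "\<And>s \<psi>. \<bar>s\<bar> < 1 / N \<Longrightarrow> (\<lambda>n. B n \<psi> * of_real s ^ n) sums F (\<psi> + axis j s)"
  shows "norm (fcoef F \<nu>) \<le> 2 * M * exp (- \<bar>of_int (\<nu> $ j)\<bar> / (2 * N))"
proof -
  define k where "k = real_of_int (\<nu> $ j)"
  \<comment> \<open>The shifted function has one Fourier coefficient but two power series in
    \<open>s\<close>, from \<open>B n\<close> and from the exponential series of
    \<open>cis (k * s)\<close>; \<open>a n\<close> is the difference of their coefficients.\<close>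
  define a where "a n = fcoef (B n) \<nu> - fcoef F \<nu> * ((\<i> * k) ^ n / fact n)" for n
  have "a n = 0" for n
  proof (rule powser_zero_on_reals)
    show "0 < 1 / N"
      using N by simp
    fix s assume s: "\<bar>s\<bar> < 1 / N"
    have Ns: "norm (N * \<bar>s\<bar>) < 1"
      using s N by (simp add: field_simps)
    have "summable (\<lambda>n. M * (N * \<bar>s\<bar>) ^ n)"
      by (intro summable_mult summable_geometric Ns)
    moreover have M: "0 \<le> M"
      using order_trans[OF norm_ge_zero B(2)[of 0 0]] by simp
    ultimately have sumM: "(\<lambda>n. M * (N * \<bar>s\<bar>) ^ n) summable_on UNIV"
      using N by (intro summable_nonneg_imp_summable_on) auto
    define f where "f n \<psi> = B n \<psi> * of_real s ^ n * fchar (- \<nu>) \<psi>" for n \<psi>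
    have f_le: "norm (f n \<psi>) \<le> M * (N * \<bar>s\<bar>) ^ n" for n \<psi>
      using mult_right_mono[OF B(2)[of n \<psi>], of "\<bar>s\<bar> ^ n"]
      by (simp add: f_def norm_mult norm_power power_mult_distrib)
    have "((\<lambda>n. tavg (f n)) has_sum tavg (\<lambda>\<psi>. \<Sum>\<^sub>\<infinity>n. f n \<psi>)) UNIV"
      by (rule tavg_infsum(2)[OF _ f_le sumM]) (auto simp: f_def intro!: continuous_intros B)
    moreover have "(\<Sum>\<^sub>\<infinity>n. f n \<psi>) = F (\<psi> + axis j s) * fchar (- \<nu>) \<psi>" for \<psi>
    proof (rule infsumI[OF norm_summable_imp_has_sum])
      have "summable (\<lambda>n. M * (N * \<bar>s\<bar>) ^ n)" by fact
      then show "summable (\<lambda>n. norm (f n \<psi>))"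
        by (rule summable_comparison_test') (simp add: f_le)
      show "(\<lambda>n. f n \<psi>) sums (F (\<psi> + axis j s) * fchar (- \<nu>) \<psi>)"
        unfolding f_def by (intro sums_mult2 taylor s)
    qed
    moreover have "tavg (f n) = fcoef (B n) \<nu> * of_real s ^ n" for n
      using tavg_cmult[of "of_real s ^ n" "\<lambda>\<psi>. B n \<psi> * fchar (- \<nu>) \<psi>"] by (simp add: f_def[abs_def] fcoef_def mult_ac)
    ultimately have "(\<lambda>n. fcoef (B n) \<nu> * of_real s ^ n) sums fcoef (\<lambda>\<psi>. F (\<psi> + axis j s)) \<nu>"
      by (simp add: fcoef_def has_sum_imp_sums)
    then have B_sums: "(\<lambda>n. fcoef (B n) \<nu> * of_real s ^ n) sums (cis (k * s) * fcoef F \<nu>)"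
      by (simp add: fcoef_shift[OF cont per] k_def)
    have "(\<lambda>n. (\<i> * of_real (k * s)) ^ n /\<^sub>R fact n) sums exp (\<i> * of_real (k * s))"
      by (rule exp_converges)
    then have "(\<lambda>n. fcoef F \<nu> * ((\<i> * of_real (k * s)) ^ n /\<^sub>R fact n)) sums (fcoef F \<nu> * cis (k * s))"
      unfolding cis_conv_exp by (rule sums_mult)
    with B_sums have "(\<lambda>n. fcoef (B n) \<nu> * of_real s ^ n - fcoef F \<nu> * ((\<i> * of_real (k * s)) ^ n /\<^sub>R fact n))
        sums (cis (k * s) * fcoef F \<nu> - fcoef F \<nu> * cis (k * s))"
      by (rule sums_diff)
    then show "(\<lambda>n. a n * of_real s ^ n) sums 0"
      by (simp add: a_def left_diff_distrib power_mult_distrib scaleR_conv_of_real field_simps)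
  qed
  then have fB: "fcoef (B n) \<nu> = fcoef F \<nu> * ((\<i> * k) ^ n / fact n)" for n
    by (simp add: a_def)
  have "norm (fcoef (B n) \<nu>) \<le> M * N ^ n" for n
    unfolding fcoef_def
  proof (rule norm_tavg_le)
    show "continuous_on UNIV (\<lambda>\<psi>. B n \<psi> * fchar (- \<nu>) \<psi>)"
      by (intro continuous_intros B(1))
    show "norm (B n \<psi> * fchar (- \<nu>) \<psi>) \<le> M * N ^ n" for \<psi>
      using B(2)[of n \<psi>] by (simp add: norm_mult)
  qed
  then have "norm (fcoef F \<nu>) * (\<bar>k\<bar> ^ n / fact n) \<le> M * N ^ n" for n
    by (simp add: fB norm_mult norm_power norm_divide)
  note fF_le = this
  \<comment> \<open>Dividing by \<open>(2 * N) ^ n\<close> makes the right side geometric. Summing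
    over all \<open>n\<close> gives the exponential on the left and \<open>2 * M\<close> on the
    right, which explains both constants of the claim.\<close>
  have term_le: "norm (fcoef F \<nu>) * ((\<bar>k\<bar> / (2 * N)) ^ n / fact n) \<le> M * (1 / 2) ^ n" for n
  proof -
    have "norm (fcoef F \<nu>) * (\<bar>k\<bar> ^ n / fact n) * (1 / (2 * N)) ^ n \<le> M * N ^ n * (1 / (2 * N)) ^ n"
      using N by (intro mult_right_mono fF_le) auto
    moreover have "N ^ n * (1 / (2 * N)) ^ n = (1 / 2) ^ n"
      unfolding power_mult_distrib[symmetric] using N by simp
    moreover have "\<bar>k\<bar> ^ n * (1 / (2 * N)) ^ n = (\<bar>k\<bar> / (2 * N)) ^ n"
      unfolding power_mult_distrib[symmetric] by simp
    ultimately show ?thesis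
      by (metis (no_types, lifting) mult.assoc mult.commute times_divide_eq_left)
  qed
  have exp: "(\<lambda>n. (\<bar>k\<bar> / (2 * N)) ^ n / fact n) sums exp (\<bar>k\<bar> / (2 * N))"
    using exp_converges[of "\<bar>k\<bar> / (2 * N)"] unfolding real_scaleR_def divide_inverse by (simp only: mult.commute)
  have geo: "(\<lambda>n. (1 / 2 :: real) ^ n) sums 2"
    using geometric_sums[of "1 / 2 :: real"] by simp
  have "norm (fcoef F \<nu>) * exp (\<bar>k\<bar> / (2 * N)) \<le> M * 2"
    by (rule sums_le[OF term_le sums_mult[OF exp] sums_mult[OF geo]])
  then have "norm (fcoef F \<nu>) * exp (\<bar>k\<bar> / (2 * N)) * exp (- \<bar>k\<bar> / (2 * N)) \<le> M * 2 * exp (- \<bar>k\<bar> / (2 * N))"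
    by (rule mult_right_mono) simp
  then show ?thesis
    by (simp add: k_def mult.assoc exp_add[symmetric] mult.commute[of M])
qed

section \<open>Fourier coefficients of analytic functions\<close>

lemma Basis_real_vec: "(Basis :: (real \<times> (real ^ 'd)) set) = insert (1, 0) (range (\<lambda>i. (0, axis i 1)))"
  by (auto simp: Basis_prod_def Basis_vec_def)

lemma prod_Basis_real_vec:
  "(\<Prod>b\<in>(Basis :: (real \<times> (real ^ 'd)) set). f b) = f (1, 0) * (\<Prod>i\<in>UNIV. f (0, axis i 1))"
proof -
  have "inj (\<lambda>i. (0 :: real, axis i 1 :: real ^ 'd))"
    by (auto simp: inj_on_def axis_eq_axis)
  moreover have "(1 :: real, 0 :: real ^ 'd) \<notin> range (\<lambda>i. (0, axis i 1))"
    by auto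
  ultimately show ?thesis
    unfolding Basis_real_vec by (simp add: prod.reindex)
qed

text \<open>Splits a multi-index into an exponent for \<open>x\<close> and exponents for the angles.
  The test \<open>fst b = 1\<close> recognizes the basis vector of the first factor; the
  \<open>THE\<close> recovers the coordinate from a basis vector of the second.\<close>

lemma bij_multi_index:
  "bij_betw (\<lambda>(k, m). \<lambda>b\<in>Basis. if fst b = 1 then k else m (THE i. snd b = axis i 1))
     (UNIV \<times> (UNIV :: ('d \<Rightarrow> nat) set)) ((Basis :: (real \<times> (real ^ 'd)) set) \<rightarrow>\<^sub>E (UNIV :: nat set))"
proof (rule bij_betwI[where g="\<lambda>m. (m (1, 0), \<lambda>i. m (0, axis i 1))"])
  have the: "(THE i'. axis i 1 = (axis i' 1 :: real ^ 'd)) = i" for i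
    by (rule the_equality) (auto simp: axis_eq_axis)
  fix m :: "real \<times> (real ^ 'd) \<Rightarrow> nat"
  assume m: "m \<in> Basis \<rightarrow>\<^sub>E UNIV"
  have "(\<lambda>b\<in>Basis. if fst b = 1 then m (1, 0) else m (0, axis (THE i. snd b = axis i 1) 1)) = m"
  proof
    fix b :: "real \<times> (real ^ 'd)"
    consider "b \<notin> Basis" | "b = (1, 0)" "b \<in> Basis" | i where "b = (0, axis i 1)" "b \<in> Basis"
      unfolding Basis_real_vec by blast
    then show "(\<lambda>b\<in>Basis. if fst b = 1 then m (1, 0) else m (0, axis (THE i. snd b = axis i 1) 1)) b = m b"
    proof cases
      case 1
      then show ?thesis
        using PiE_arb[OF m] by simp
    qed (simp_all add: the)
  qed
  then show "(\<lambda>(k, m). \<lambda>b\<in>Basis. if fst b = 1 then k else m (THE i. snd b = axis i 1)) (m (1, 0), \<lambda>i. m (0, axis i 1)) = m"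
    by (simp only: prod.case)
next
  have the: "(THE i'. axis i 1 = (axis i' 1 :: real ^ 'd)) = i" for i
    by (rule the_equality) (auto simp: axis_eq_axis)
  fix p :: "nat \<times> ('d \<Rightarrow> nat)"
  show "((\<lambda>m. (m (1, 0), \<lambda>i. m (0, axis i 1))) ((\<lambda>(k, m). \<lambda>b\<in>(Basis :: (real \<times> (real ^ 'd)) set).
      if fst b = 1 then k else m (THE i. snd b = axis i 1)) p)) = p"
    by (cases p) (simp add: Basis_real_vec the)
qed auto

text \<open>The ball is traded for a closed cube so that the expansion may be evaluated at a corner;
  absolute convergence there dominates all later rearrangements.\<close>

lemma local_expansion:
  fixes h :: "real \<times> (real ^ 'd) \<Rightarrow> real"
  assumes "real_analytic_on h UNIV"
  obtains \<rho> and c :: "nat \<Rightarrow> ('d \<Rightarrow> nat) \<Rightarrow> real" where "\<rho> > 0"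
    "\<And>x y. \<bar>x\<bar> \<le> \<rho> \<Longrightarrow> (\<And>i. \<bar>y $ i\<bar> \<le> \<rho>) \<Longrightarrow>
      ((\<lambda>(k, m). c k m * (x ^ k * (\<Prod>i\<in>UNIV. (y $ i) ^ m i))) has_sum h (x\<^sub>0 + x, \<psi>\<^sub>0 + y)) (UNIV \<times> UNIV)"
proof -
  obtain r c where r: "r > 0" and c: "\<And>z. z \<in> ball (x\<^sub>0, \<psi>\<^sub>0) r \<Longrightarrow>
      ((\<lambda>m. c m * (\<Prod>b\<in>Basis. ((z - (x\<^sub>0, \<psi>\<^sub>0)) \<bullet> b) ^ m b)) has_sum h z) (Basis \<rightarrow>\<^sub>E UNIV)"
    using assms unfolding real_analytic_on_def by blast
  \<comment> \<open>On the cube the norm is at most the sum of the absolute coordinates, hence at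
    most \<open>D * \<rho>\<close>, which is half of \<open>r\<close>.\<close>
  define D where "D = 1 + real CARD('d)"
  define \<rho> where "\<rho> = r / (2 * D)"
  have "D > 0"
    by (simp add: D_def)
  then have \<rho>: "\<rho> > 0" "D * \<rho> < r"
    using r by (simp_all add: \<rho>_def)
  define idx :: "nat \<times> ('d \<Rightarrow> nat) \<Rightarrow> real \<times> (real ^ 'd) \<Rightarrow> nat"
    where "idx = (\<lambda>(k, m). \<lambda>b\<in>Basis. if fst b = 1 then k else m (THE i. snd b = axis i 1))"
  have the: "(THE i'. axis i 1 = (axis i' 1 :: real ^ 'd)) = i" for i
    by (rule the_equality) (auto simp: axis_eq_axis)
  have idx: "idx (k, m) (1, 0) = k" "idx (k, m) (0, axis i 1) = m i" for k m i
    by (auto simp: idx_def the Basis_real_vec)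
  show ?thesis
  proof (rule that[of \<rho> "\<lambda>k m. c (idx (k, m))"])
    fix x and y :: "real ^ 'd"
    assume x: "\<bar>x\<bar> \<le> \<rho>" and y: "\<And>i. \<bar>y $ i\<bar> \<le> \<rho>"
    have "norm y \<le> (\<Sum>i\<in>UNIV. \<bar>y $ i\<bar>)"
      by (rule norm_le_l1_cart)
    also have "\<dots> \<le> CARD('d) * \<rho>"
      using sum_mono[of UNIV "\<lambda>i. \<bar>y $ i\<bar>" "\<lambda>i. \<rho>"] y by simp
    finally have "norm (x, y) < r"
      using norm_Pair_le[of x y] x \<rho>(2) by (simp add: D_def algebra_simps)
    then have "(x\<^sub>0 + x, \<psi>\<^sub>0 + y) \<in> ball (x\<^sub>0, \<psi>\<^sub>0) r"
      by (simp add: dist_norm norm_minus_commute norm_Pair)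
    from c[OF this] have "((\<lambda>p. c (idx p) * (\<Prod>b\<in>Basis. ((x, y) \<bullet> b) ^ idx p b)) has_sum h (x\<^sub>0 + x, \<psi>\<^sub>0 + y)) (UNIV \<times> UNIV)"
      using has_sum_reindex_bij_betw[OF bij_multi_index,
          of "\<lambda>m. c m * (\<Prod>b\<in>Basis. ((x, y) \<bullet> b) ^ m b)"]
      by (simp only: idx_def[symmetric]) (simp add: o_def)
    then show "((\<lambda>(k, m). c (idx (k, m)) * (x ^ k * (\<Prod>i\<in>UNIV. (y $ i) ^ m i))) has_sum h (x\<^sub>0 + x, \<psi>\<^sub>0 + y)) (UNIV \<times> UNIV)"
      by (rule has_sum_cong[THEN iffD1, rotated])
         (auto simp: prod_Basis_real_vec idx inner_axis)
  qed (use \<rho> in auto)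
qed

text \<open>The coefficient of \<open>s ^ n\<close> in the monomial with exponents \<open>m\<close>
  taken at \<open>y + axis j s\<close>, by the binomial theorem (see
  \<open>sum_mono_shift\<close>).\<close>

definition mono_shift :: "'d \<Rightarrow> nat \<Rightarrow> ('d::finite \<Rightarrow> nat) \<Rightarrow> real ^ 'd \<Rightarrow> real" where
  "mono_shift j n m y = of_nat (m j choose n) * (y $ j) ^ (m j - n) * (\<Prod>i\<in>- {j}. (y $ i) ^ m i)"

text \<open>The sum collapses to \<open>(s + \<bar>y $ j\<bar>) ^ m j\<close> times the factors of
  the other coordinates. Halving the radius leaves room for the shift.\<close>

lemma abs_mono_shift_le:
  assumes "0 < \<rho>" "\<And>i. \<bar>y $ i\<bar> \<le> \<rho> / 2" "0 \<le> s" "s \<le> \<rho> / 2"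
  shows "(\<Sum>n\<le>m j. \<bar>mono_shift j n m y\<bar> * s ^ n) \<le> \<rho> ^ (\<Sum>i\<in>UNIV. m i)"
proof -
  define R where "R = (\<Prod>i\<in>- {j}. \<bar>y $ i\<bar> ^ m i)"
  have R: "0 \<le> R" "R \<le> (\<Prod>i\<in>- {j}. \<rho> ^ m i)"
  proof -
    show "R \<le> (\<Prod>i\<in>- {j}. \<rho> ^ m i)"
      unfolding R_def
    proof (rule prod_mono)
      fix i
      have "\<bar>y $ i\<bar> \<le> \<rho>"
        using assms(1) assms(2)[of i] by linarith
      then show "0 \<le> \<bar>y $ i\<bar> ^ m i \<and> \<bar>y $ i\<bar> ^ m i \<le> \<rho> ^ m i"
        by (auto intro: power_mono)
    qed
  qed (simp add: R_def prod_nonneg)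
  have "(\<Sum>n\<le>m j. \<bar>mono_shift j n m y\<bar> * s ^ n) = (\<Sum>n\<le>m j. of_nat (m j choose n) * s ^ n * \<bar>y $ j\<bar> ^ (m j - n)) * R"
    unfolding sum_distrib_right
    by (intro sum.cong) (simp_all add: mono_shift_def R_def abs_mult abs_prod power_abs mult_ac)
  also have "\<dots> = (s + \<bar>y $ j\<bar>) ^ m j * R"
    by (simp add: binomial_ring)
  also have "\<dots> \<le> \<rho> ^ m j * (\<Prod>i\<in>- {j}. \<rho> ^ m i)"
  proof (rule mult_mono)
    have "s + \<bar>y $ j\<bar> \<le> \<rho>"
      using assms(2)[of j] assms(4) by linarith
    then show "(s + \<bar>y $ j\<bar>) ^ m j \<le> \<rho> ^ m j"
      using assms(3) by (intro power_mono) auto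
  qed (use R assms in auto)
  also have "\<dots> = (\<Prod>i\<in>UNIV. \<rho> ^ m i)"
    by (subst prod.remove[of UNIV j]) (auto simp: Compl_eq_Diff_UNIV)
  also have "\<dots> = \<rho> ^ (\<Sum>i\<in>UNIV. m i)"
    by (simp add: power_sum)
  finally show ?thesis .
qed

lemma sum_mono_shift:
  "(\<Sum>n\<le>m j. mono_shift j n m y * s ^ n) = (\<Prod>i\<in>UNIV. ((y + axis j s) $ i) ^ m i)"
proof -
  have "(\<Sum>n\<le>m j. mono_shift j n m y * s ^ n) =
      (\<Sum>n\<le>m j. of_nat (m j choose n) * s ^ n * (y $ j) ^ (m j - n)) * (\<Prod>i\<in>- {j}. (y $ i) ^ m i)"
    unfolding sum_distrib_right by (intro sum.cong) (simp_all add: mono_shift_def mult_ac)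
  also have "(\<Prod>i\<in>- {j}. (y $ i) ^ m i) = (\<Prod>i\<in>- {j}. ((y + axis j s) $ i) ^ m i)"
    by (intro prod.cong) (auto simp: axis_def)
  also have "(\<Sum>n\<le>m j. of_nat (m j choose n) * s ^ n * (y $ j) ^ (m j - n)) = (s + y $ j) ^ m j"
    by (simp add: binomial_ring)
  also have "(s + y $ j) ^ m j * (\<Prod>i\<in>- {j}. ((y + axis j s) $ i) ^ m i) = (\<Prod>i\<in>UNIV. ((y + axis j s) $ i) ^ m i)"
    by (subst prod.remove[of UNIV j]) (auto simp: Compl_eq_Diff_UNIV add.commute)
  finally show ?thesis .
qed

lemma mono_shift_beyond: "n > m j \<Longrightarrow> mono_shift j n m y = 0"
  by (simp add: mono_shift_def)

text \<open>Rearranges a power series in \<open>y\<close> into one in the shift \<open>s\<close>,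
  dominated throughout by the series at the corner of the cube. The growth
  \<open>(2 / \<rho>) ^ n\<close> comes from keeping a single term of
  \<open>abs_mono_shift_le\<close> at \<open>s = \<rho> / 2\<close>.\<close>

lemma taylor_shift:
  fixes e :: "('d::finite \<Rightarrow> nat) \<Rightarrow> real" and j :: 'd
  assumes \<rho>: "0 < \<rho>" and e: "(\<lambda>m. \<bar>e m\<bar> * \<rho> ^ (\<Sum>i\<in>UNIV. m i)) summable_on UNIV"
    and M: "(\<Sum>\<^sub>\<infinity>m. \<bar>e m\<bar> * \<rho> ^ (\<Sum>i\<in>UNIV. m i)) \<le> M"
  defines "T n y \<equiv> (\<Sum>\<^sub>\<infinity>m. e m * mono_shift j n m y)"
  shows "continuous_on {y. \<forall>i. \<bar>y $ i\<bar> \<le> \<rho> / 2} (T n)"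
    and "(\<And>i. \<bar>y $ i\<bar> \<le> \<rho> / 2) \<Longrightarrow> \<bar>T n y\<bar> \<le> M * (2 / \<rho>) ^ n"
    and "(\<And>i. \<bar>y $ i\<bar> \<le> \<rho> / 2) \<Longrightarrow> \<bar>s\<bar> \<le> \<rho> / 2 \<Longrightarrow>
      (\<lambda>n. T n y * s ^ n) sums (\<Sum>\<^sub>\<infinity>m. e m * (\<Prod>i\<in>UNIV. ((y + axis j s) $ i) ^ m i))"
proof -
  let ?E = "\<lambda>m. \<bar>e m\<bar> * \<rho> ^ (\<Sum>i\<in>UNIV. m i)"
  have bound: "\<bar>e m * mono_shift j n m y\<bar> \<le> ?E m * (2 / \<rho>) ^ n" if y: "\<And>i. \<bar>y $ i\<bar> \<le> \<rho> / 2" for m n y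
  proof (cases "n \<le> m j")
    case True
    then have "\<bar>mono_shift j n m y\<bar> * (\<rho> / 2) ^ n \<le> (\<Sum>n\<le>m j. \<bar>mono_shift j n m y\<bar> * (\<rho> / 2) ^ n)"
      using \<rho> by (intro member_le_sum) auto
    also have "\<dots> \<le> \<rho> ^ (\<Sum>i\<in>UNIV. m i)"
      using abs_mono_shift_le[OF \<rho> y, of "\<rho> / 2"] \<rho> by simp
    finally have "\<bar>mono_shift j n m y\<bar> * (\<rho> / 2) ^ n * (2 / \<rho>) ^ n \<le> \<rho> ^ (\<Sum>i\<in>UNIV. m i) * (2 / \<rho>) ^ n"
      using \<rho> by (intro mult_right_mono) auto
    then have "\<bar>mono_shift j n m y\<bar> \<le> \<rho> ^ (\<Sum>i\<in>UNIV. m i) * (2 / \<rho>) ^ n"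
      using \<rho> by (simp add: mult.assoc power_mult_distrib[symmetric])
    then show ?thesis
      unfolding abs_mult mult.assoc by (rule mult_left_mono) simp
  qed (use \<rho> in \<open>simp add: mono_shift_beyond\<close>)
  have E: "(\<lambda>m. ?E m * (2 / \<rho>) ^ n) summable_on UNIV" for n
    by (rule summable_on_cmult_left) (rule e)
  show "continuous_on {y. \<forall>i. \<bar>y $ i\<bar> \<le> \<rho> / 2} (T n)"
  proof (rule uniform_limit_theorem)
    show "uniform_limit {y. \<forall>i. \<bar>y $ i\<bar> \<le> \<rho> / 2} (\<lambda>X y. \<Sum>m\<in>X. e m * mono_shift j n m y) (T n) (finite_subsets_at_top UNIV)"
      unfolding T_def by (rule Weierstrass_m_test_general[OF _ E]) (simp only: real_norm_def, rule bound, simp)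
    show "\<forall>\<^sub>F X in finite_subsets_at_top UNIV.
        continuous_on {y. \<forall>i. \<bar>y $ i\<bar> \<le> \<rho> / 2} (\<lambda>y. \<Sum>m\<in>X. e m * mono_shift j n m y)"
      unfolding mono_shift_def by (intro always_eventually allI continuous_intros)
  qed simp
  {
    fix y :: "real ^ 'd"
    assume y: "\<And>i. \<bar>y $ i\<bar> \<le> \<rho> / 2"
    have abs_term: "(\<lambda>m. \<bar>e m * mono_shift j n m y\<bar>) summable_on UNIV" for n
      by (rule summable_on_comparison_test[OF E[of n] bound[OF y]]) auto
    have "\<bar>T n y\<bar> \<le> (\<Sum>\<^sub>\<infinity>m. \<bar>e m * mono_shift j n m y\<bar>)"
      unfolding T_def using norm_infsum_bound[of "\<lambda>m. e m * mono_shift j n m y" UNIV] abs_term by simp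
    also have "\<dots> \<le> (\<Sum>\<^sub>\<infinity>m. ?E m * (2 / \<rho>) ^ n)"
      by (rule infsum_mono[OF abs_term E bound[OF y]])
    also have "\<dots> \<le> M * (2 / \<rho>) ^ n"
      unfolding infsum_cmult_left' using M \<rho> by (intro mult_right_mono) auto
    finally show "\<bar>T n y\<bar> \<le> M * (2 / \<rho>) ^ n" .
    assume s: "\<bar>s\<bar> \<le> \<rho> / 2"
    define f where "f m n = e m * mono_shift j n m y * s ^ n" for m n
    have row: "((\<lambda>n. f m n) has_sum e m * (\<Prod>i\<in>UNIV. ((y + axis j s) $ i) ^ m i)) UNIV"
      and row_abs: "((\<lambda>n. \<bar>f m n\<bar>) has_sum \<bar>e m\<bar> * (\<Sum>n\<le>m j. \<bar>mono_shift j n m y\<bar> * \<bar>s\<bar> ^ n)) UNIV" for m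
    proof -
      have zero: "f m n = 0" if "n \<in> UNIV - {..m j}" for n
        using that by (simp add: f_def mono_shift_beyond)
      have sums: "(\<Sum>n\<le>m j. f m n) = e m * (\<Prod>i\<in>UNIV. ((y + axis j s) $ i) ^ m i)"
        "(\<Sum>n\<le>m j. \<bar>f m n\<bar>) = \<bar>e m\<bar> * (\<Sum>n\<le>m j. \<bar>mono_shift j n m y\<bar> * \<bar>s\<bar> ^ n)"
        unfolding sum_mono_shift[symmetric]
        by (simp_all add: f_def abs_mult power_abs sum_distrib_left mult.assoc)
      show "((\<lambda>n. f m n) has_sum e m * (\<Prod>i\<in>UNIV. ((y + axis j s) $ i) ^ m i)) UNIV"
        "((\<lambda>n. \<bar>f m n\<bar>) has_sum \<bar>e m\<bar> * (\<Sum>n\<le>m j. \<bar>mono_shift j n m y\<bar> * \<bar>s\<bar> ^ n)) UNIV"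
        unfolding sums[symmetric]
        by (rule has_sum_finite_neutralI[of "{..m j}"]; simp add: zero)+
    qed
    have g_le: "\<bar>e m\<bar> * (\<Sum>n\<le>m j. \<bar>mono_shift j n m y\<bar> * \<bar>s\<bar> ^ n) \<le> ?E m" for m
      using abs_mono_shift_le[OF \<rho> y, of "\<bar>s\<bar>"] s by (intro mult_left_mono) auto
    have "(\<lambda>(m, n). \<bar>f m n\<bar>) summable_on UNIV \<times> UNIV"
    proof (rule summable_on_SigmaI)
      show "((\<lambda>n. case (m, n) of (m, n) \<Rightarrow> \<bar>f m n\<bar>) has_sum \<bar>e m\<bar> * (\<Sum>n\<le>m j. \<bar>mono_shift j n m y\<bar> * \<bar>s\<bar> ^ n)) UNIV" for m
        using row_abs by simp
      have "0 \<le> \<bar>e m\<bar> * (\<Sum>n\<le>m j. \<bar>mono_shift j n m y\<bar> * \<bar>s\<bar> ^ n)" for m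
        by (intro mult_nonneg_nonneg sum_nonneg) auto
      then show "(\<lambda>m. \<bar>e m\<bar> * (\<Sum>n\<le>m j. \<bar>mono_shift j n m y\<bar> * \<bar>s\<bar> ^ n)) summable_on UNIV"
        using g_le by (intro summable_on_comparison_test[OF e]) auto
    qed auto
    then have "(\<lambda>p. \<bar>case p of (m, n) \<Rightarrow> f m n\<bar>) summable_on UNIV \<times> UNIV"
      by (simp add: case_prod_unfold)
    then have sum: "(\<lambda>(m, n). f m n) summable_on UNIV \<times> UNIV"
      using abs_summable_summable[of "\<lambda>(m, n). f m n" "UNIV \<times> UNIV"] by simp
    then obtain S where S: "((\<lambda>(m, n). f m n) has_sum S) (UNIV \<times> UNIV)"
      by (auto simp: summable_on_def)
    have "((\<lambda>m. e m * (\<Prod>i\<in>UNIV. ((y + axis j s) $ i) ^ m i)) has_sum S) UNIV"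
      by (rule has_sum_SigmaD[OF S]) (use row in simp)
    then have S_eq: "S = (\<Sum>\<^sub>\<infinity>m. e m * (\<Prod>i\<in>UNIV. ((y + axis j s) $ i) ^ m i))"
      by (simp add: infsumI)
    have swapped: "((\<lambda>(n, m). f m n) has_sum S) (UNIV \<times> UNIV)"
      using S by (subst has_sum_swap) simp
    have column: "((\<lambda>m. f m n) has_sum T n y * s ^ n) UNIV" for n
    proof -
      have "(\<lambda>m. e m * mono_shift j n m y) summable_on UNIV"
        by (rule abs_summable_summable) (simp only: real_norm_def abs_term)
      from has_sum_cmult_left[OF has_sum_infsum[OF this]] show ?thesis
        unfolding f_def T_def .
    qed
    have "((\<lambda>n. T n y * s ^ n) has_sum S) UNIV"
      by (rule has_sum_SigmaD[OF swapped]) (simp only: prod.case column)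
    then show "(\<lambda>n. T n y * s ^ n) sums (\<Sum>\<^sub>\<infinity>m. e m * (\<Prod>i\<in>UNIV. ((y + axis j s) $ i) ^ m i))"
      unfolding S_eq[symmetric] by (rule has_sum_imp_sums)
  }
qed

section \<open>Taylor coefficients as functions on the torus\<close>

text \<open>Chosen from the function alone, so that expansions around different base points yield
  one globally defined coefficient function; \<open>tcoef_eq\<close> shows that the choice is
  forced.\<close>

definition tcoef :: "(real \<Rightarrow> real) \<Rightarrow> nat \<Rightarrow> real" where
  "tcoef f = (SOME a. \<exists>r>0. \<forall>x. \<bar>x\<bar> < r \<longrightarrow> (\<lambda>k. a k * x ^ k) sums f x)"

lemma tcoef_eq:
  assumes "r > 0" "\<And>x. \<bar>x\<bar> < r \<Longrightarrow> (\<lambda>k. a k * x ^ k) sums f x"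
  shows "tcoef f k = a k"
proof -
  have "\<exists>r>0. \<forall>x. \<bar>x\<bar> < r \<longrightarrow> (\<lambda>k. tcoef f k * x ^ k) sums f x"
    unfolding tcoef_def
  proof (rule someI_ex[where P="\<lambda>a. \<exists>r>0. \<forall>x. \<bar>x\<bar> < r \<longrightarrow> (\<lambda>k. a k * x ^ k) sums f x"], intro exI conjI allI impI)
    show "0 < r"
      by fact
    show "(\<lambda>k. a k * x ^ k) sums f x" if "\<bar>x\<bar> < r" for x
      using that by (rule assms(2))
  qed
  then obtain r' where r': "r' > 0" "\<And>x. \<bar>x\<bar> < r' \<Longrightarrow> (\<lambda>k. tcoef f k * x ^ k) sums f x"
    by blast
  have "complex_of_real (tcoef f k - a k) = 0"
  proof (rule powser_zero_on_reals)
    show "0 < min r r'"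
      using assms(1) r'(1) by simp
    fix x assume x: "\<bar>x\<bar> < min r r'"
    then have "(\<lambda>k. tcoef f k * x ^ k - a k * x ^ k) sums (f x - f x)"
      by (intro sums_diff assms r') auto
    then have "(\<lambda>k. complex_of_real (tcoef f k * x ^ k - a k * x ^ k)) sums of_real (f x - f x)"
      by (rule sums_of_real)
    then show "(\<lambda>k. complex_of_real (tcoef f k - a k) * of_real x ^ k) sums 0"
      by (simp add: left_diff_distrib)
  qed
  then show ?thesis
    by (simp only: of_real_eq_0_iff right_minus_eq)
qed

definition xcoef :: "(real \<times> (real ^ 'd) \<Rightarrow> real) \<Rightarrow> real \<Rightarrow> nat \<Rightarrow> real ^ 'd \<Rightarrow> real" where
  "xcoef h c k \<psi> = tcoef (\<lambda>x. h (c + x, \<psi>)) k"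

definition scoef :: "(real \<times> (real ^ 'd) \<Rightarrow> real) \<Rightarrow> real \<Rightarrow> 'd \<Rightarrow> nat \<Rightarrow> nat \<Rightarrow> real ^ 'd \<Rightarrow> real" where
  "scoef h c j k n \<psi> = tcoef (\<lambda>s. xcoef h c k (\<psi> + axis j s)) n"

text \<open>One constant serves as prefactor, growth rate and reciprocal radius. This makes the
  predicate monotone in \<open>N\<close> (for \<open>N \<ge> 1\<close>), so that finitely many local
  bounds merge into one.\<close>

definition taylor_bound :: "(real \<times> (real ^ 'd) \<Rightarrow> real) \<Rightarrow> real \<Rightarrow> real \<Rightarrow> real ^ 'd \<Rightarrow> bool" where
  "taylor_bound h c N \<psi> \<longleftrightarrow>
     (\<forall>k. \<bar>xcoef h c k \<psi>\<bar> \<le> N * N ^ k) \<and>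
     (\<forall>x. \<bar>x\<bar> < 1 / N \<longrightarrow> (\<lambda>k. xcoef h c k \<psi> * x ^ k) sums h (c + x, \<psi>)) \<and>
     (\<forall>j k n. \<bar>scoef h c j k n \<psi>\<bar> \<le> N * N ^ k * N ^ n) \<and>
     (\<forall>j k s. \<bar>s\<bar> < 1 / N \<longrightarrow> (\<lambda>n. scoef h c j k n \<psi> * s ^ n) sums xcoef h c k (\<psi> + axis j s))"

lemma taylor_bound_mono:
  assumes "taylor_bound h c N \<psi>" "1 \<le> N" "N \<le> N'"
  shows "taylor_bound h c N' \<psi>"
proof -
  have "1 / N' \<le> 1 / N"
    using assms by (simp add: frac_le)
  moreover have "N * N ^ k \<le> N' * N' ^ k" "N * N ^ k * N ^ n \<le> N' * N' ^ k * N' ^ n" for k n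
    using assms by (auto intro!: mult_mono power_mono)
  ultimately show ?thesis
    using assms(1) unfolding taylor_bound_def by (meson less_le_trans order_trans)
qed

text \<open>Everything is read off one double power series around \<open>\<psi>\<^sub>0\<close>:
  summing over the angular exponents gives \<open>xcoef\<close>, and re-expanding that sum along
  direction \<open>j\<close> gives \<open>scoef\<close>.\<close>

lemma local_taylor:
  fixes h :: "real \<times> (real ^ 'd) \<Rightarrow> real"
  assumes "real_analytic_on h UNIV"
  obtains \<delta> N where "\<delta> > 0" "N \<ge> 1" "\<And>\<psi>. \<psi> \<in> ball \<psi>\<^sub>0 \<delta> \<Longrightarrow> taylor_bound h c N \<psi>"
    "\<And>j k n. continuous_on (ball \<psi>\<^sub>0 \<delta>) (scoef h c j k n)"
proof -
  obtain \<rho> and e :: "nat \<Rightarrow> ('d \<Rightarrow> nat) \<Rightarrow> real" where \<rho>: "\<rho> > 0" and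
    e: "\<And>x y. \<bar>x\<bar> \<le> \<rho> \<Longrightarrow> (\<And>i. \<bar>y $ i\<bar> \<le> \<rho>) \<Longrightarrow>
      ((\<lambda>(k, m). e k m * (x ^ k * (\<Prod>i\<in>UNIV. (y $ i) ^ m i))) has_sum h (c + x, \<psi>\<^sub>0 + y)) (UNIV \<times> UNIV)"
    using local_expansion[OF assms, of c \<psi>\<^sub>0] by blast
  define E where "E k m = \<bar>e k m\<bar> * \<rho> ^ (\<Sum>i\<in>UNIV. m i)" for k m
  have E_nonneg: "0 \<le> E k m" for k m
    using \<rho> by (simp add: E_def)
  \<comment> \<open>Evaluation at the corner of the cube, where every coordinate equals
    \<open>\<rho>\<close>, yields the majorant for all other points.\<close>
  have "(\<lambda>(k, m). e k m * (\<rho> ^ k * (\<Prod>i\<in>UNIV. ((\<chi> i. \<rho>) $ i) ^ m i))) summable_on UNIV \<times> UNIV"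
    using e[of \<rho> "\<chi> i. \<rho>"] \<rho> by (auto intro: has_sum_imp_summable)
  then have "(\<lambda>p. norm (case p of (k, m) \<Rightarrow> e k m * (\<rho> ^ k * (\<Prod>i\<in>UNIV. ((\<chi> i. \<rho>) $ i) ^ m i)))) summable_on UNIV \<times> UNIV"
    by (rule summable_on_iff_abs_summable_on_real[THEN iffD1])
  then have sumE: "(\<lambda>(k, m). E k m * \<rho> ^ k) summable_on UNIV \<times> UNIV"
    using \<rho> by (simp add: case_prod_unfold E_def abs_mult abs_prod power_abs power_sum mult_ac)
  define M where "M = (\<Sum>\<^sub>\<infinity>(k, m)\<in>UNIV \<times> UNIV. E k m * \<rho> ^ k)"
  have sumEk: "E k summable_on UNIV" for k
  proof -
    have "(\<lambda>m. E k m * \<rho> ^ k) summable_on UNIV"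
      by (rule summable_on_SigmaD1[OF sumE]) simp
    then have "(\<lambda>m. E k m * \<rho> ^ k * (1 / \<rho>) ^ k) summable_on UNIV"
      by (rule summable_on_cmult_left)
    then show ?thesis
      using \<rho> by (simp add: mult.assoc power_mult_distrib[symmetric])
  qed
  have Ek_le: "infsum (E k) UNIV \<le> M * (1 / \<rho>) ^ k" for k
  proof -
    have "((\<lambda>k. infsum (E k) UNIV * \<rho> ^ k) has_sum M) UNIV"
    proof (rule has_sum_SigmaD)
      show "((\<lambda>(k, m). E k m * \<rho> ^ k) has_sum M) (UNIV \<times> UNIV)"
        unfolding M_def by (rule has_sum_infsum[OF sumE])
      show "((\<lambda>m. case (k, m) of (k, m) \<Rightarrow> E k m * \<rho> ^ k) has_sum infsum (E k) UNIV * \<rho> ^ k) UNIV" for k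
        using sumEk by (simp add: has_sum_cmult_left)
    qed
    moreover have "0 \<le> infsum (E k) UNIV * \<rho> ^ k" for k
      using \<rho> by (intro mult_nonneg_nonneg infsum_nonneg E_nonneg) auto
    ultimately have "infsum (E k) UNIV * \<rho> ^ k \<le> M"
      using finite_sum_le_has_sum[where B="{k}"] by fastforce
    then have "infsum (E k) UNIV * \<rho> ^ k * (1 / \<rho>) ^ k \<le> M * (1 / \<rho>) ^ k"
      using \<rho> by (intro mult_right_mono) auto
    then show ?thesis
      using \<rho> by (simp add: mult.assoc power_mult_distrib[symmetric])
  qed
  define P where "P k y = (\<Sum>\<^sub>\<infinity>m. e k m * (\<Prod>i\<in>UNIV. (y $ i) ^ m i))" for k and y :: "real ^ 'd"
  have P_abs: "(\<lambda>m. norm (e k m * (\<Prod>i\<in>UNIV. (y $ i) ^ m i))) summable_on UNIV"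
    and P_le: "\<bar>P k y\<bar> \<le> M * (1 / \<rho>) ^ k" if "\<And>i. \<bar>y $ i\<bar> \<le> \<rho>" for k y
  proof -
    have le: "norm (e k m * (\<Prod>i\<in>UNIV. (y $ i) ^ m i)) \<le> E k m" for m
    proof -
      have "(\<Prod>i\<in>UNIV. \<bar>y $ i\<bar> ^ m i) \<le> (\<Prod>i\<in>UNIV. \<rho> ^ m i)"
        using that by (intro prod_mono) (auto intro: power_mono)
      then have "\<bar>e k m\<bar> * (\<Prod>i\<in>UNIV. \<bar>y $ i\<bar> ^ m i) \<le> \<bar>e k m\<bar> * (\<Prod>i\<in>UNIV. \<rho> ^ m i)"
        by (rule mult_left_mono) simp
      then show ?thesis
        by (simp add: E_def abs_mult abs_prod power_abs power_sum)
    qed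
    show abs: "(\<lambda>m. norm (e k m * (\<Prod>i\<in>UNIV. (y $ i) ^ m i))) summable_on UNIV"
      by (rule Infinite_Sum.abs_summable_on_comparison_test'[OF sumEk le])
    have "norm (P k y) \<le> infsum (E k) UNIV"
      unfolding P_def by (rule order_trans[OF norm_infsum_bound[OF abs] infsum_mono[OF abs sumEk le]])
    then show "\<bar>P k y\<bar> \<le> M * (1 / \<rho>) ^ k"
      using Ek_le[of k] by simp
  qed
  have P_sums: "(\<lambda>k. P k y * x ^ k) sums h (c + x, \<psi>\<^sub>0 + y)" if y: "\<And>i. \<bar>y $ i\<bar> \<le> \<rho>" and x: "\<bar>x\<bar> \<le> \<rho>" for x y
  proof -
    have "((\<lambda>m. (e k m * (\<Prod>i\<in>UNIV. (y $ i) ^ m i)) * x ^ k) has_sum P k y * x ^ k) UNIV" for k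
      unfolding P_def by (rule has_sum_cmult_left[OF has_sum_infsum[OF abs_summable_summable[OF P_abs[OF y]]]])
    then have "((\<lambda>k. P k y * x ^ k) has_sum h (c + x, \<psi>\<^sub>0 + y)) UNIV"
      by (intro has_sum_SigmaD[OF e[OF x y]]) (simp only: prod.case mult_ac)
    then show ?thesis
      by (rule has_sum_imp_sums)
  qed
  have xcoef: "xcoef h c k (\<psi>\<^sub>0 + y) = P k y" if "\<And>i. \<bar>y $ i\<bar> \<le> \<rho>" for k y
    unfolding xcoef_def by (rule tcoef_eq[OF \<rho>]) (intro P_sums that, simp)
  define T where "T j k n y = (\<Sum>\<^sub>\<infinity>m. e k m * mono_shift j n m y)" for j k n and y :: "real ^ 'd"
  note shift = taylor_shift[OF \<rho> sumEk[unfolded E_def] Ek_le[unfolded E_def], folded T_def P_def]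
  have T_sums: "(\<lambda>n. T j k n y * s ^ n) sums xcoef h c k (\<psi>\<^sub>0 + y + axis j s)"
    if y: "\<And>i. \<bar>y $ i\<bar> \<le> \<rho> / 2" and s: "\<bar>s\<bar> \<le> \<rho> / 2" for j k s y
  proof -
    have "\<bar>(y + axis j s) $ i\<bar> \<le> \<rho>" for i
      using y[of i] s \<rho> by (auto simp: axis_def)
    from xcoef[OF this] show ?thesis
      using shift(3)[OF y s] by (simp add: add.assoc)
  qed
  have scoef: "scoef h c j k n (\<psi>\<^sub>0 + y) = T j k n y" if "\<And>i. \<bar>y $ i\<bar> \<le> \<rho> / 2" for j k n y
    unfolding scoef_def
    by (rule tcoef_eq[where r="\<rho> / 2"]) (use \<rho> in simp, intro T_sums that, simp)
  have in_ball: "\<bar>(\<psi> - \<psi>\<^sub>0) $ i\<bar> \<le> \<rho> / 2" if "\<psi> \<in> ball \<psi>\<^sub>0 (\<rho> / 2)" for \<psi> i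
    using component_le_norm_cart[of "\<psi> - \<psi>\<^sub>0" i] that by (simp add: dist_norm norm_minus_commute)
  \<comment> \<open>\<open>M\<close> bounds the prefactors; \<open>2 / \<rho>\<close> bounds both
    growth rates and makes \<open>1 / N\<close> at most \<open>\<rho> / 2\<close>, within reach of
    both series.\<close>
  define N where "N = Max {1, M, 2 / \<rho>}"
  have N: "1 \<le> N" "M \<le> N" "2 / \<rho> \<le> N"
    by (auto simp: N_def)
  have N_\<rho>: "1 / \<rho> \<le> N" "1 / N \<le> \<rho> / 2"
  proof -
    have "1 / \<rho> \<le> 2 / \<rho>"
      using \<rho> by (simp add: divide_right_mono)
    then show "1 / \<rho> \<le> N"
      using N(3) by linarith
    show "1 / N \<le> \<rho> / 2"
      using N(1,3) \<rho> by (simp add: divide_le_eq pos_le_divide_eq mult.commute)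
  qed
  have M: "0 \<le> M"
    unfolding M_def using \<rho> by (intro infsum_nonneg) (auto simp: E_nonneg)
  have bounds: "M * (1 / \<rho>) ^ k \<le> N * N ^ k" "M * (1 / \<rho>) ^ k * (2 / \<rho>) ^ n \<le> N * N ^ k * N ^ n" for k n
    using N N_\<rho>(1) M \<rho> by (auto intro!: mult_mono power_mono)
  show ?thesis
  proof (rule that[of "\<rho> / 2" N])
    fix \<psi> assume "\<psi> \<in> ball \<psi>\<^sub>0 (\<rho> / 2)"
    note y2 = in_ball[OF this]
    then have y: "\<bar>(\<psi> - \<psi>\<^sub>0) $ i\<bar> \<le> \<rho>" for i
      using \<rho> y2[of i] by linarith
    have \<psi>: "\<psi>\<^sub>0 + (\<psi> - \<psi>\<^sub>0) = \<psi>"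
      by simp
    note xc = xcoef[OF y, unfolded \<psi>] and sc = scoef[OF y2, unfolded \<psi>]
    show "taylor_bound h c N \<psi>"
      unfolding taylor_bound_def
    proof (intro conjI allI impI)
      show "\<bar>xcoef h c k \<psi>\<bar> \<le> N * N ^ k" for k
        unfolding xc by (rule order_trans[OF P_le[OF y] bounds(1)])
      show "(\<lambda>k. xcoef h c k \<psi> * x ^ k) sums h (c + x, \<psi>)" if "\<bar>x\<bar> < 1 / N" for x
        unfolding xc using P_sums[OF y, of x, unfolded \<psi>] that N_\<rho>(2) \<rho> by linarith
      show "\<bar>scoef h c j k n \<psi>\<bar> \<le> N * N ^ k * N ^ n" for j k n
        unfolding sc by (rule order_trans[OF shift(2)[OF y2] bounds(2)])
      show "(\<lambda>n. scoef h c j k n \<psi> * s ^ n) sums xcoef h c k (\<psi> + axis j s)" if "\<bar>s\<bar> < 1 / N" for j k s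
        unfolding sc using T_sums[OF y2, of s j k, unfolded \<psi>] that N_\<rho>(2) by linarith
    qed
  next
    fix j k n
    have "continuous_on (ball \<psi>\<^sub>0 (\<rho> / 2)) (\<lambda>\<psi>. T j k n (\<psi> - \<psi>\<^sub>0))"
      using in_ball
      by (intro continuous_on_compose2[OF shift(1)] continuous_intros) blast
    moreover have "scoef h c j k n \<psi> = T j k n (\<psi> - \<psi>\<^sub>0)" if "\<psi> \<in> ball \<psi>\<^sub>0 (\<rho> / 2)" for \<psi>
      using scoef[OF in_ball[OF that]] by simp
    ultimately show "continuous_on (ball \<psi>\<^sub>0 (\<rho> / 2)) (scoef h c j k n)"
      by (rule continuous_on_eq[OF _ sym])
  qed (use \<rho> N in auto)
qed

lemma torus_periodic_xcoef:
  assumes "\<And>x. torus_periodic (\<lambda>\<psi>. h (x, \<psi>))"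
  shows "torus_periodic (xcoef h c k)"
  using assms unfolding torus_periodic_def xcoef_def by presburger

text \<open>Periodicity of a predicate, taken as a boolean function, lets a bound on the cell be
  carried to the whole space by \<open>torus_periodic_ivec\<close>.\<close>

lemma torus_periodic_taylor_bound:
  assumes "\<And>x. torus_periodic (\<lambda>\<psi>. h (x, \<psi>))"
  shows "torus_periodic (taylor_bound h c N)"
proof -
  have h: "h (x, \<psi> + axis i (2 * pi)) = h (x, \<psi>)" for x \<psi> i
    using assms by (auto simp: torus_periodic_def)
  have x: "xcoef h c k (\<psi> + axis i (2 * pi)) = xcoef h c k \<psi>" for k \<psi> i
    by (simp only: xcoef_def h)
  have x': "xcoef h c k (\<psi> + axis i (2 * pi) + v) = xcoef h c k (\<psi> + v)" for k \<psi> i v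
    using x[of k "\<psi> + v" i] by (simp only: add_ac)
  have s: "scoef h c j k n (\<psi> + axis i (2 * pi)) = scoef h c j k n \<psi>" for j k n \<psi> i
    by (simp only: scoef_def x')
  show ?thesis
    unfolding torus_periodic_def taylor_bound_def by (simp only: h x x' s simp_thms)
qed

text \<open>Compactness of the cell leaves finitely many local bounds, and the sum of their
  constants dominates each of them.\<close>

lemma global_taylor:
  fixes h :: "real \<times> (real ^ 'd) \<Rightarrow> real"
  assumes h: "real_analytic_on h UNIV" and per: "\<And>x. torus_periodic (\<lambda>\<psi>. h (x, \<psi>))"
  obtains N where "N \<ge> 1" "\<And>\<psi>. taylor_bound h c N \<psi>"
proof -
  have "\<forall>\<psi>\<^sub>0. \<exists>\<delta> N. \<delta> > 0 \<and> N \<ge> 1 \<and> (\<forall>\<psi> \<in> ball \<psi>\<^sub>0 \<delta>. taylor_bound h c N \<psi>)"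
    by (metis local_taylor[OF h])
  then obtain \<delta> N where N: "\<And>\<phi>. \<delta> \<phi> > 0" "\<And>\<phi>. N \<phi> \<ge> 1" "\<And>\<phi> \<psi>. \<psi> \<in> ball \<phi> (\<delta> \<phi>) \<Longrightarrow> taylor_bound h c (N \<phi>) \<psi>"
    by metis
  have "compact (cell :: (real ^ 'd) set)"
    by (rule compact_cbox)
  then obtain C where C: "C \<subseteq> cell" "finite C" "cell \<subseteq> (\<Union>\<phi>\<in>C. ball \<phi> (\<delta> \<phi>))"
    by (rule compactE_image[where C=cell and f="\<lambda>\<phi>. ball \<phi> (\<delta> \<phi>)"]) (use N(1) in auto)
  show ?thesis
  proof (rule that[of "1 + (\<Sum>\<phi>\<in>C. N \<phi>)"])
    have nonneg: "0 \<le> N \<phi>" for \<phi>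
      using N(2)[of \<phi>] by linarith
    then show "1 \<le> 1 + (\<Sum>\<phi>\<in>C. N \<phi>)"
      by (simp add: sum_nonneg)
    fix \<psi> :: "real ^ 'd"
    obtain \<nu> where \<nu>: "\<psi> + (2 * pi) *\<^sub>R ivec \<nu> \<in> cell"
      by (rule reduce_to_cell)
    then obtain \<phi> where \<phi>: "\<phi> \<in> C" "\<psi> + (2 * pi) *\<^sub>R ivec \<nu> \<in> ball \<phi> (\<delta> \<phi>)"
      using C(3) by blast
    have "N \<phi> \<le> (\<Sum>\<phi>\<in>C. N \<phi>)"
      using C(2) \<phi>(1) nonneg by (intro member_le_sum) auto
    then have "taylor_bound h c (1 + (\<Sum>\<phi>\<in>C. N \<phi>)) (\<psi> + (2 * pi) *\<^sub>R ivec \<nu>)"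
      by (intro taylor_bound_mono[OF N(3)[OF \<phi>(2)] N(2)]) simp
    then show "taylor_bound h c (1 + (\<Sum>\<phi>\<in>C. N \<phi>)) \<psi>"
      by (simp only: torus_periodic_ivec[OF torus_periodic_taylor_bound[OF per]])
  qed
qed

lemma continuous_on_scoef:
  fixes h :: "real \<times> (real ^ 'd) \<Rightarrow> real"
  assumes h: "real_analytic_on h UNIV"
  shows "continuous_on UNIV (scoef h c j k n)"
  unfolding continuous_on_eq_continuous_at[OF open_UNIV]
proof
  fix \<psi>\<^sub>0 :: "real ^ 'd"
  obtain \<delta> where "\<delta> > 0" "continuous_on (ball \<psi>\<^sub>0 \<delta>) (scoef h c j k n)"
    by (metis local_taylor[OF h])
  then show "isCont (scoef h c j k n) \<psi>\<^sub>0"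
    by (simp add: continuous_on_eq_continuous_at)
qed

lemma fourier_taylor:
  fixes h :: "real \<times> (real ^ 'd) \<Rightarrow> real"
  assumes h: "real_analytic_on h UNIV" and per: "\<And>x. torus_periodic (\<lambda>\<psi>. h (x, \<psi>))"
  obtains N where "N \<ge> 1"
    "\<And>x \<psi>. \<bar>x\<bar> < 1 / N \<Longrightarrow> (\<lambda>k. xcoef h c k \<psi> * x ^ k) sums h (c + x, \<psi>)"
    "\<And>k \<psi>. \<bar>xcoef h c k \<psi>\<bar> \<le> N * N ^ k"
    "\<And>k. continuous_on UNIV (xcoef h c k)"
    "\<And>k \<nu> j. norm (fcoef (\<lambda>\<psi>. of_real (xcoef h c k \<psi>)) \<nu>) \<le> 2 * (N * N ^ k) * exp (- \<bar>of_int (\<nu> $ j)\<bar> / (2 * N))"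
proof -
  obtain N where N: "N \<ge> 1" "\<And>\<psi>. taylor_bound h c N \<psi>"
    by (rule global_taylor[OF h per, where c=c]) (rule that)
  note bound = N(2)[unfolded taylor_bound_def]
  have cont: "continuous_on UNIV (xcoef h c k)" for k
  proof -
    fix j :: 'd
    \<comment> \<open>At \<open>s = 0\<close> the shift series reduces to its constant term, so
      continuity is inherited from \<open>scoef\<close>.\<close>
    have "xcoef h c k \<psi> = scoef h c j k 0 \<psi>" for \<psi>
    proof -
      have "(\<lambda>n. scoef h c j k n \<psi> * 0 ^ n) sums xcoef h c k (\<psi> + axis j 0)"
        by (rule bound[THEN conjunct2, THEN conjunct2, THEN conjunct2, rule_format]) (use N(1) in simp)
      moreover have "axis j 0 = (0 :: real ^ 'd)"
        by (simp add: axis_eq_0_iff)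
      ultimately show ?thesis
        by simp
    qed
    then have "xcoef h c k = scoef h c j k 0"
      by (rule ext)
    then show ?thesis
      by (simp only: continuous_on_scoef[OF h])
  qed
  show ?thesis
  proof (rule that[OF N(1) _ _ cont])
    fix k \<nu> j
    show "norm (fcoef (\<lambda>\<psi>. of_real (xcoef h c k \<psi>)) \<nu>) \<le> 2 * (N * N ^ k) * exp (- \<bar>of_int (\<nu> $ j)\<bar> / (2 * N))"
    proof (rule fcoef_decay[where B="\<lambda>n \<psi>. of_real (scoef h c j k n \<psi>)"])
      show "continuous_on UNIV (\<lambda>\<psi>. complex_of_real (xcoef h c k \<psi>))"
        by (intro continuous_intros cont)
      show "continuous_on UNIV (\<lambda>\<psi>. complex_of_real (scoef h c j k n \<psi>))" for n
        by (intro continuous_intros continuous_on_scoef h)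
      show "torus_periodic (\<lambda>\<psi>. complex_of_real (xcoef h c k \<psi>))"
        using torus_periodic_xcoef[OF per, of c k] by (simp add: torus_periodic_def)
      show "norm (complex_of_real (scoef h c j k n \<psi>)) \<le> N * N ^ k * N ^ n" for n \<psi>
        using bound[of \<psi>] by simp
      show "(\<lambda>n. complex_of_real (scoef h c j k n \<psi>) * of_real s ^ n) sums of_real (xcoef h c k (\<psi> + axis j s))"
        if "\<bar>s\<bar> < 1 / N" for s \<psi>
        unfolding of_real_power[symmetric] of_real_mult[symmetric] by (intro sums_of_real) (use bound[of \<psi>] that in blast)
    qed (use N(1) in auto)
  qed (use bound in auto)
qed

section \<open>Exponential weights\<close>

text \<open>The l1 size makes exponentials of it factor over the coordinates, which serves both the
  summability of the weights and the bound in \<open>real_analytic_ft\<close>.\<close>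

definition lsize :: "int ^ 'd \<Rightarrow> real" where "lsize \<nu> = (\<Sum>i\<in>UNIV. \<bar>of_int (\<nu> $ i)\<bar>)"

lemma lsize_nonneg: "0 \<le> lsize \<nu>"
  by (simp add: lsize_def sum_nonneg)

lemma lsize_0: "lsize 0 = 0" and lsize_minus: "lsize (- \<nu>) = lsize \<nu>"
  by (simp_all add: lsize_def)

lemma lsize_add: "lsize (\<mu> + \<nu>) \<le> lsize \<mu> + lsize \<nu>"
  unfolding lsize_def sum.distrib[symmetric] by (intro sum_mono) (simp add: abs_triangle_ineq)

lemma lsize_Basis:
  fixes \<nu> :: "int ^ 'd"
  shows "lsize \<nu> = (\<Sum>b\<in>Basis. \<bar>ivec \<nu> \<bullet> b\<bar>)"
proof -
  have inj: "inj (\<lambda>i. axis i 1 :: real ^ 'd)"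
    by (auto simp: inj_on_def axis_eq_axis)
  have Basis: "(Basis :: (real ^ 'd) set) = range (\<lambda>i. axis i 1)"
    by (auto simp: Basis_vec_def)
  show ?thesis
    unfolding Basis sum.reindex[OF inj] by (simp add: lsize_def inner_axis)
qed

definition wt :: "real \<Rightarrow> int ^ 'd \<Rightarrow> real" where "wt \<xi> \<nu> = exp (\<xi> * lsize \<nu>)"

lemma l1_weight_wt: "0 \<le> \<xi> \<Longrightarrow> l1_weight (wt \<xi>)"
proof
  fix \<mu> \<nu> :: "int ^ 'd"
  assume "0 \<le> \<xi>"
  then have "\<xi> * lsize (\<mu> + \<nu>) \<le> \<xi> * (lsize \<mu> + lsize \<nu>)"
    by (intro mult_left_mono lsize_add)
  then show "wt \<xi> (\<mu> + \<nu>) \<le> wt \<xi> \<mu> * wt \<xi> \<nu>"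
    by (simp add: wt_def exp_add[symmetric] distrib_left)
qed (auto simp: wt_def lsize_0 lsize_minus)

lemma abs_summable_prod_PiE:
  fixes f :: "'a \<Rightarrow> 'b \<Rightarrow> 'c :: {real_normed_field,banach,second_countable_topology}"
  assumes "finite A" "\<And>x. x \<in> A \<Longrightarrow> countable (B x)" "\<And>x. x \<in> A \<Longrightarrow> f x asummable_on B x"
  shows "(\<lambda>g. \<Prod>x\<in>A. f x (g x)) asummable_on PiE A B"
  using abs_summable_on_prod_PiE[of A B f] assms by (simp only: abs_summable_equivalent)

lemma summable_exp_int:
  fixes \<xi> :: real
  assumes "\<xi> > 0"
  shows "(\<lambda>k::int. exp (- (\<xi> * \<bar>of_int k\<bar>))) summable_on UNIV"
proof -
  let ?f = "\<lambda>k::int. exp (- (\<xi> * \<bar>of_int k\<bar>))"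
  have "summable (\<lambda>n. exp (- \<xi>) ^ n)"
    by (rule summable_geometric) (use assms in simp)
  then have "(\<lambda>n. exp (- \<xi>) ^ n) summable_on UNIV"
    by (rule summable_nonneg_imp_summable_on) simp
  then have nat: "(\<lambda>n. exp (- (\<xi> * real n))) summable_on UNIV"
    by (simp add: exp_of_nat_mult[symmetric] mult.commute)
  have "?f summable_on range int"
    using nat by (subst summable_on_reindex) (auto simp: o_def)
  moreover have "?f summable_on range (\<lambda>n. - int n)"
    using nat by (subst summable_on_reindex) (auto simp: o_def inj_on_def)
  ultimately have "?f summable_on (range int \<union> range (\<lambda>n. - int n))"
    by (rule summable_on_union)
  moreover have "range int \<union> range (\<lambda>n. - int n) = UNIV"
  proof -
    have "k \<in> range int \<union> range (\<lambda>n. - int n)" for k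
      by (cases k rule: int_cases2) auto
    then show ?thesis by blast
  qed
  ultimately show ?thesis
    by simp
qed

lemma summable_exp_lsize:
  assumes "\<xi> > 0"
  shows "(\<lambda>\<nu> :: int ^ 'd. exp (- (\<xi> * lsize \<nu>))) summable_on UNIV"
proof -
  let ?f = "\<lambda>(i::'d) (k::int). exp (- (\<xi> * \<bar>of_int k\<bar>))"
  have "(\<lambda>g. \<Prod>i\<in>UNIV. ?f i (g i)) asummable_on PiE UNIV (\<lambda>_. UNIV)"
    by (rule abs_summable_prod_PiE) (use summable_exp_int[OF assms] in simp_all)
  then have "(\<lambda>g :: 'd \<Rightarrow> int. exp (- (\<xi> * (\<Sum>i\<in>UNIV. \<bar>of_int (g i)\<bar>)))) summable_on UNIV"
    by (simp add: PiE_UNIV_domain exp_sum[symmetric] sum_negf sum_distrib_left)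
  moreover have "bij_betw vec_nth (UNIV :: (int ^ 'd) set) UNIV"
    by (rule bij_betwI[where g=vec_lambda]) auto
  ultimately show ?thesis
    unfolding lsize_def
    using summable_on_reindex_bij_betw[of vec_nth UNIV UNIV "\<lambda>g :: 'd \<Rightarrow> int. exp (- (\<xi> * (\<Sum>i\<in>UNIV. \<bar>of_int (g i)\<bar>)))"]
    by simp
qed

text \<open>Decay is first known along single coordinates; taking the largest one converts it into
  decay in \<open>lsize\<close>, at the price of the factor \<open>CARD('d)\<close> in the
  rate.\<close>

lemma max_component_ge:
  fixes \<nu> :: "int ^ 'd"
  obtains j where "lsize \<nu> \<le> CARD('d) * \<bar>of_int (\<nu> $ j)\<bar>"
proof -
  have "Max (range (\<lambda>i. \<bar>\<nu> $ i\<bar>)) \<in> range (\<lambda>i. \<bar>\<nu> $ i\<bar>)"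
    by (rule Max_in) auto
  then obtain j where "Max (range (\<lambda>i. \<bar>\<nu> $ i\<bar>)) = \<bar>\<nu> $ j\<bar>"
    by blast
  then have "\<bar>\<nu> $ i\<bar> \<le> \<bar>\<nu> $ j\<bar>" for i
    using Max_ge[of "range (\<lambda>i. \<bar>\<nu> $ i\<bar>)" "\<bar>\<nu> $ i\<bar>"] by simp
  then have "lsize \<nu> \<le> (\<Sum>i\<in>(UNIV :: 'd set). \<bar>of_int (\<nu> $ j)\<bar>)"
    unfolding lsize_def by (intro sum_mono) (metis of_int_abs of_int_le_iff)
  then show ?thesis
    by (intro that[of j]) simp
qed

lemma abs_inner_ivec_le: "\<bar>\<omega> \<bullet> ivec \<nu>\<bar> \<le> norm \<omega> * lsize \<nu>"
proof -
  have "\<bar>\<omega> \<bullet> ivec \<nu>\<bar> \<le> norm \<omega> * norm (ivec \<nu>)"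
    by (rule Cauchy_Schwarz_ineq2)
  also have "\<dots> \<le> norm \<omega> * lsize \<nu>"
    using norm_le_l1_cart[of "ivec \<nu>"] by (intro mult_left_mono) (auto simp: lsize_def)
  finally show ?thesis .
qed

abbreviation "fc \<psi> \<equiv> (\<lambda>\<nu>. fchar \<nu> \<psi>)"

text \<open>The parameter \<open>ty\<close> fixes the dimension: \<open>\<xi>\<close> alone does not
  mention the index type on which the weight lives.\<close>

locale torus_weight =
  fixes \<xi> :: real and ty :: "'d::finite itself"
  assumes \<xi>: "\<xi> > 0"
begin

sublocale l1_weight "wt \<xi> :: int ^ 'd \<Rightarrow> real"
  by (rule l1_weight_wt) (use \<xi> in simp)

lemma is_character_fchar: "is_character (fc \<psi> :: int ^ 'd \<Rightarrow> complex)"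
  by (simp add: is_character_def fchar_add)

definition ft :: "(int ^ 'd) l1 \<Rightarrow> real ^ 'd \<Rightarrow> complex" where "ft u \<psi> = ev (fc \<psi>) u"

lemma norm_ft: "norm (ft u \<psi>) \<le> norm u"
  unfolding ft_def by (rule norm_ev) simp

lemma torus_periodic_ft: "torus_periodic (ft u)"
  by (simp add: torus_periodic_def ft_def fchar_periodic)

lemma continuous_ft: "continuous_on UNIV (ft u)"
  unfolding ft_def[abs_def] ev_def
  by (rule tavg_infsum(1)[OF _ norm_ev_term coef_summable]) (auto intro!: continuous_intros simp: wt_def)

lemma ft_star: "ft (star u) \<psi> = cnj (ft u \<psi>)"
proof -
  have "ft (star u) \<psi> = (\<Sum>\<^sub>\<infinity>\<nu>. cnj (coef u (- \<nu>) / of_real (wt \<xi> (- \<nu>)) * fchar (- \<nu>) \<psi>))"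
    by (simp add: ft_def ev_def coef_star w_minus fchar_minus)
  also have "\<dots> = cnj (\<Sum>\<^sub>\<infinity>\<nu>. coef u (- \<nu>) / of_real (wt \<xi> (- \<nu>)) * fchar (- \<nu>) \<psi>)"
    by (rule infsum_cnj)
  also have "\<dots> = cnj (ft u \<psi>)"
    unfolding ft_def ev_def
    by (rule arg_cong[where f=cnj], rule infsum_reindex_bij_betw[OF bij_uminus])
  finally show ?thesis .
qed

lemma ft_real: "star u = u \<Longrightarrow> ft u \<psi> = of_real (Re (ft u \<psi>))"
  using ft_star[of u \<psi>] by (simp add: complex_eq_iff)

text \<open>Expand each character at \<open>a + z\<close> into the product over coordinates of
  exponential series. For \<open>norm z < \<xi>\<close> their absolute values sum to at most
  \<open>exp (\<xi> * lsize \<nu>)\<close>, which the weight pays for, so the sums over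
  \<open>\<nu>\<close> and over multi-indices may be interchanged. The radius \<open>\<xi>\<close>
  works at every point.\<close>

lemma real_analytic_ft: "real_analytic_on (\<lambda>\<psi>. Re (ft u \<psi>)) UNIV"
  unfolding real_analytic_on_def
proof (intro ballI exI conjI)
  fix a :: "real ^ 'd"
  show "0 < \<xi>" by (rule \<xi>)
  fix y assume "y \<in> ball a \<xi>"
  define z where "z = y - a"
  have z: "norm z < \<xi>"
    using \<open>y \<in> ball a \<xi>\<close> by (simp add: z_def dist_norm norm_minus_commute)
  define q where "q \<nu> = coef u \<nu> / of_real (wt \<xi> \<nu>) * fchar \<nu> a" for \<nu>
  define p where "p \<nu> b n = (\<i> * of_real (ivec \<nu> \<bullet> b)) ^ n / fact n" for \<nu> :: "int ^ 'd" and b n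
  define f where "f \<nu> b n = p \<nu> b n * of_real (z \<bullet> b) ^ n" for \<nu> b n
  let ?I = "(Basis :: (real ^ 'd) set) \<rightarrow>\<^sub>E (UNIV :: nat set)"
  have f_eq: "f \<nu> b n = (\<i> * of_real (ivec \<nu> \<bullet> b * (z \<bullet> b))) ^ n /\<^sub>R fact n" for \<nu> b n
    by (simp add: f_def p_def power_mult_distrib scaleR_conv_of_real divide_inverse mult_ac)
  have norm_f: "norm (f \<nu> b n) = \<bar>ivec \<nu> \<bullet> b * (z \<bullet> b)\<bar> ^ n /\<^sub>R fact n" for \<nu> b n
    by (simp add: f_eq norm_mult norm_power abs_mult)
  have f_abs: "f \<nu> b asummable_on UNIV" for \<nu> b
    unfolding norm_f by (rule summable_nonneg_imp_summable_on[OF sums_summable[OF exp_converges]]) simp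
  have f_sum: "infsum (f \<nu> b) UNIV = exp (\<i> * of_real (ivec \<nu> \<bullet> b * (z \<bullet> b)))" for \<nu> b
  proof (rule infsumI, rule norm_summable_imp_has_sum)
    show "summable (\<lambda>n. norm (f \<nu> b n))"
      unfolding norm_f by (rule sums_summable[OF exp_converges])
    show "f \<nu> b sums exp (\<i> * of_real (ivec \<nu> \<bullet> b * (z \<bullet> b)))"
      unfolding f_eq[abs_def] by (rule exp_converges)
  qed
  have f_norm_sum: "(\<Sum>\<^sub>\<infinity>n. norm (f \<nu> b n)) = exp \<bar>ivec \<nu> \<bullet> b * (z \<bullet> b)\<bar>" for \<nu> b
    unfolding norm_f
    by (rule infsumI, rule sums_nonneg_imp_has_sum[OF exp_converges]) simp
  have prod_abs: "(\<lambda>m. \<Prod>b\<in>Basis. f \<nu> b (m b)) asummable_on ?I" for \<nu>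
    by (rule abs_summable_prod_PiE) (use f_abs in auto)
  have prod_sum: "(\<Sum>\<^sub>\<infinity>m\<in>?I. \<Prod>b\<in>Basis. f \<nu> b (m b)) = fchar \<nu> z" for \<nu>
  proof -
    have "(\<Sum>\<^sub>\<infinity>m\<in>?I. \<Prod>b\<in>Basis. f \<nu> b (m b)) = (\<Prod>b\<in>Basis. exp (\<i> * of_real (ivec \<nu> \<bullet> b * (z \<bullet> b))))"
      by (subst infsum_prod_PiE_abs) (auto simp: f_abs f_sum)
    also have "\<dots> = cis (\<Sum>b\<in>Basis. ivec \<nu> \<bullet> b * (z \<bullet> b))"
      by (simp add: exp_sum[symmetric] cis_conv_exp sum_distrib_left)
    also have "\<dots> = fchar \<nu> z"
      unfolding fchar_def by (subst euclidean_inner) simp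
    finally show ?thesis .
  qed
  have norm_prod: "(\<Sum>\<^sub>\<infinity>m\<in>?I. norm (\<Prod>b\<in>Basis. f \<nu> b (m b))) \<le> wt \<xi> \<nu>" for \<nu>
  proof -
    have "(\<Sum>\<^sub>\<infinity>m\<in>?I. norm (\<Prod>b\<in>Basis. f \<nu> b (m b))) = (\<Prod>b\<in>Basis. exp \<bar>ivec \<nu> \<bullet> b * (z \<bullet> b)\<bar>)"
      unfolding prod_norm[symmetric] by (subst infsum_prod_PiE_abs) (auto simp: f_abs f_norm_sum)
    also have "\<dots> = exp (\<Sum>b\<in>Basis. \<bar>ivec \<nu> \<bullet> b * (z \<bullet> b)\<bar>)"
      by (simp add: exp_sum)
    also have "\<dots> \<le> exp (\<xi> * lsize \<nu>)"
    proof -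
      have "\<bar>ivec \<nu> \<bullet> b * (z \<bullet> b)\<bar> \<le> \<xi> * \<bar>ivec \<nu> \<bullet> b\<bar>" if "b \<in> Basis" for b
        using mult_right_mono[of "\<bar>z \<bullet> b\<bar>" \<xi> "\<bar>ivec \<nu> \<bullet> b\<bar>"] Basis_le_norm[OF that, of z] z
        by (simp add: abs_mult mult.commute)
      then show ?thesis
        unfolding lsize_Basis sum_distrib_left by (simp add: sum_mono)
    qed
    finally show ?thesis
      by (simp add: wt_def)
  qed
  have q_w: "norm (q \<nu>) * wt \<xi> \<nu> = norm (coef u \<nu>)" for \<nu>
    using w_pos[of \<nu>] by (simp add: q_def norm_mult norm_divide)
  define g where "g = (\<lambda>(\<nu>, m). q \<nu> * (\<Prod>b\<in>Basis. f \<nu> b (m b)))"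
  have g_abs: "g asummable_on UNIV \<times> ?I"
  proof (rule Infinite_Sum.abs_summable_on_Sigma_iff[THEN iffD2], intro conjI ballI)
    show "(\<lambda>m. g (\<nu>, m)) asummable_on ?I" for \<nu>
      using summable_on_cmult_right[OF prod_abs[of \<nu>], of "norm (q \<nu>)"] by (simp add: g_def norm_mult)
    show "(\<lambda>\<nu>. \<Sum>\<^sub>\<infinity>m\<in>?I. norm (g (\<nu>, m))) asummable_on UNIV"
    proof (rule Infinite_Sum.abs_summable_on_comparison_test'[OF coef_summable[of u]])
      fix \<nu>
      have "(\<Sum>\<^sub>\<infinity>m\<in>?I. norm (g (\<nu>, m))) = norm (q \<nu>) * (\<Sum>\<^sub>\<infinity>m\<in>?I. norm (\<Prod>b\<in>Basis. f \<nu> b (m b)))"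
        by (simp add: g_def norm_mult infsum_cmult_right')
      also have "\<dots> \<le> norm (q \<nu>) * wt \<xi> \<nu>"
        by (rule mult_left_mono[OF norm_prod]) simp
      finally show "norm (\<Sum>\<^sub>\<infinity>m\<in>?I. norm (g (\<nu>, m))) \<le> norm (coef u \<nu>)"
        unfolding q_w by (simp add: infsum_nonneg)
    qed
  qed
  have "ft u y = (\<Sum>\<^sub>\<infinity>\<nu>. q \<nu> * fchar \<nu> z)"
    using fchar_shift[of _ a z] by (simp add: ft_def ev_def q_def z_def mult.assoc)
  also have "\<dots> = (\<Sum>\<^sub>\<infinity>\<nu>. \<Sum>\<^sub>\<infinity>m\<in>?I. g (\<nu>, m))"
    by (simp add: g_def infsum_cmult_right' prod_sum)
  also have "\<dots> = infsum g (UNIV \<times> ?I)"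
    by (rule infsum_Sigma_banach[OF abs_summable_summable[OF g_abs]])
  finally have g_sum: "(g has_sum ft u y) (UNIV \<times> ?I)"
    using abs_summable_summable[OF g_abs] by (simp add: has_sum_iff)
  have swapped: "((\<lambda>(m, \<nu>). g (\<nu>, m)) has_sum ft u y) (?I \<times> UNIV)"
    using g_sum by (subst has_sum_swap) (simp add: case_prod_unfold)
  define C where "C m = (\<Sum>\<^sub>\<infinity>\<nu>. q \<nu> * (\<Prod>b\<in>Basis. p \<nu> b (m b)))" for m
  have "((\<lambda>m. \<Sum>\<^sub>\<infinity>\<nu>. g (\<nu>, m)) has_sum ft u y) ?I"
  proof (rule has_sum_SigmaD[OF swapped])
    fix m assume "m \<in> ?I"
    have "(\<lambda>(m, \<nu>). g (\<nu>, m)) summable_on ?I \<times> UNIV"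
      using swapped by (rule has_sum_imp_summable)
    from summable_on_SigmaD1[OF this \<open>m \<in> ?I\<close>]
    show "((\<lambda>\<nu>. case (m, \<nu>) of (m, \<nu>) \<Rightarrow> g (\<nu>, m)) has_sum (\<Sum>\<^sub>\<infinity>\<nu>. g (\<nu>, m))) UNIV"
      by (simp only: prod.case has_sum_infsum)
  qed
  moreover have "(\<Sum>\<^sub>\<infinity>\<nu>. g (\<nu>, m)) = C m * of_real (\<Prod>b\<in>Basis. (z \<bullet> b) ^ m b)" for m
    unfolding C_def infsum_cmult_left'[symmetric] by (simp add: g_def f_def prod.distrib mult.assoc)
  ultimately have "((\<lambda>m. C m * of_real (\<Prod>b\<in>Basis. (z \<bullet> b) ^ m b)) has_sum ft u y) ?I"
    by simp
  from has_sum_Re[OF this] have "((\<lambda>m. Re (C m) * (\<Prod>b\<in>Basis. (z \<bullet> b) ^ m b)) has_sum Re (ft u y)) ?I"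
    by (simp only: times_complex.sel Re_complex_of_real Im_complex_of_real mult_zero_right diff_zero)
  \<comment> \<open>The coefficients, schematic since the start of the proof, are fixed here. They
    are written out because \<open>C\<close>, \<open>p\<close> and \<open>q\<close> were introduced
    after \<open>y\<close>, on which the coefficients must not depend.\<close>
  then show "((\<lambda>m. Re (\<Sum>\<^sub>\<infinity>\<nu>. coef u \<nu> / of_real (wt \<xi> \<nu>) * fchar \<nu> a *
      (\<Prod>b\<in>Basis. (\<i> * of_real (ivec \<nu> \<bullet> b)) ^ m b / fact (m b))) *
      (\<Prod>b\<in>Basis. ((y - a) \<bullet> b) ^ m b)) has_sum Re (ft u y)) ?I"
    by (simp only: C_def p_def q_def z_def)
qed

end

section \<open>Termwise differentiation and sums over small frequencies\<close>

lemma power_le_fact_exp: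
  fixes x :: real
  assumes "0 \<le> x"
  shows "x ^ k \<le> fact k * exp x"
proof -
  have "x ^ k /\<^sub>R fact k \<le> exp x"
    using sum_le_suminf[OF sums_summable[OF exp_converges[of x]], of "{k}"] assms sums_unique[OF exp_converges[of x]]
    by simp
  then show ?thesis
    by (simp add: field_simps)
qed

lemma has_sum_diff:
  fixes f g :: "'a \<Rightarrow> 'b::real_normed_vector"
  assumes "(f has_sum a) A" "(g has_sum b) A"
  shows "((\<lambda>x. f x - g x) has_sum (a - b)) A"
  using has_sum_add[OF assms(1) has_sum_bounded_linear[OF bounded_linear_minus[OF bounded_linear_ident] assms(2)]]
  by simp

text \<open>For real \<open>x\<close> the error of \<open>1 + \<i> * x\<close> as an approximation
  to \<open>exp (\<i> * x)\<close> is at most \<open>x\<^sup>2\<close>, so a finite second moment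
  bounds the remainder of the whole series by \<open>M * h\<^sup>2\<close>.\<close>

lemma trig_series_DERIV:
  fixes c :: "'i \<Rightarrow> complex" and s :: "'i \<Rightarrow> real"
  assumes c: "\<And>k. k \<le> 2 \<Longrightarrow> (\<lambda>i. norm (c i) * \<bar>s i\<bar> ^ k) summable_on UNIV"
  shows "((\<lambda>t. Re (\<Sum>\<^sub>\<infinity>i. c i * cis (s i * t))) has_real_derivative
      Re (\<Sum>\<^sub>\<infinity>i. \<i> * s i * c i * cis (s i * t))) (at t)"
proof -
  define f where "f t = (\<Sum>\<^sub>\<infinity>i. c i * cis (s i * t))" for t
  define d where "d = (\<Sum>\<^sub>\<infinity>i. \<i> * s i * c i * cis (s i * t))"
  define M where "M = (\<Sum>\<^sub>\<infinity>i. norm (c i) * \<bar>s i\<bar> ^ 2)"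
  have sum_f: "(\<lambda>i. c i * cis (s i * t)) summable_on UNIV" for t
    by (rule abs_summable_summable) (use c[of 0] in \<open>simp add: norm_mult\<close>)
  have sum_d: "(\<lambda>i. \<i> * s i * c i * cis (s i * t)) summable_on UNIV"
    by (rule abs_summable_summable) (use c[of 1] in \<open>simp add: norm_mult mult.commute\<close>)
  have main: "norm (f (t + h) - f t - h * d) \<le> M * h\<^sup>2" for h
  proof -
    let ?r = "\<lambda>i. c i * cis (s i * (t + h)) - c i * cis (s i * t) - h * (\<i> * s i * c i * cis (s i * t))"
    have r: "norm (?r i) \<le> norm (c i) * \<bar>s i\<bar> ^ 2 * h\<^sup>2" for i
    proof -
      have "?r i = c i * cis (s i * t) * (exp (\<i> * of_real (s i * h)) - (\<Sum>k\<le>1. (\<i> * of_real (s i * h)) ^ k / fact k))"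
        unfolding cis_conv_exp[symmetric] by (simp add: cis_mult[symmetric] distrib_left algebra_simps)
      also have "norm \<dots> \<le> norm (c i) * \<bar>s i * h\<bar> ^ 2"
        using Taylor_exp[of "\<i> * of_real (s i * h)" 1]
        by (simp add: norm_mult mult_left_mono numeral_2_eq_2)
      finally show ?thesis
        by (simp add: abs_mult power_mult_distrib)
    qed
    have sum_b: "(\<lambda>i. norm (c i) * \<bar>s i\<bar> ^ 2 * h\<^sup>2) summable_on UNIV"
      by (rule summable_on_cmult_left) (rule c, simp)
    have "(?r has_sum f (t + h) - f t - h * d) UNIV"
      unfolding f_def d_def by (intro has_sum_diff has_sum_cmult_right has_sum_infsum sum_f sum_d)
    then have "norm (f (t + h) - f t - h * d) \<le> (\<Sum>\<^sub>\<infinity>i. norm (c i) * \<bar>s i\<bar> ^ 2 * h\<^sup>2)"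
      by (rule norm_infsum_le[OF _ has_sum_infsum[OF sum_b]]) (rule r)
    then show ?thesis
      by (simp add: M_def infsum_cmult_left')
  qed
  have "(\<lambda>h. (Re (f (t + h)) - Re (f t)) / h - Re d) \<midarrow>0\<rightarrow> 0"
  proof (rule Lim_null_comparison)
    show "\<forall>\<^sub>F h in at 0. norm ((Re (f (t + h)) - Re (f t)) / h - Re d) \<le> M * \<bar>h\<bar>"
      unfolding eventually_at_filter
    proof (intro always_eventually allI impI)
      fix h :: real assume "h \<noteq> 0"
      have "\<bar>Re (f (t + h)) - Re (f t) - h * Re d\<bar> \<le> M * h\<^sup>2"
        using order_trans[OF abs_Re_le_cmod main[of h]] by simp
      then have "\<bar>Re (f (t + h)) - Re (f t) - h * Re d\<bar> / \<bar>h\<bar> \<le> M * h\<^sup>2 / \<bar>h\<bar>"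
        by (rule divide_right_mono) simp
      moreover have "(Re (f (t + h)) - Re (f t)) / h - Re d = (Re (f (t + h)) - Re (f t) - h * Re d) / h"
        using \<open>h \<noteq> 0\<close> by (simp add: field_simps)
      moreover have "M * h\<^sup>2 / \<bar>h\<bar> = M * \<bar>h\<bar>"
        using \<open>h \<noteq> 0\<close> by (simp add: power2_eq_square field_simps abs_if)
      ultimately show "norm ((Re (f (t + h)) - Re (f t)) / h - Re d) \<le> M * \<bar>h\<bar>"
        by simp
    qed
    have "(\<lambda>h. M * \<bar>h\<bar>) \<midarrow>0\<rightarrow> M * \<bar>0\<bar>"
      by (intro tendsto_intros)
    then show "(\<lambda>h. M * \<bar>h\<bar>) \<midarrow>0\<rightarrow> 0"
      by simp
  qed
  then show ?thesis
    unfolding DERIV_def f_def[symmetric] d_def[symmetric] by (simp add: LIM_zero_iff)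
qed

text \<open>The common shape of the multiplier bounds: one alternative is uniform, the other small
  in \<open>\<epsilon>\<close>. Frequency 0 is singled out because division by 0 yields 0 and would
  make the minimum vanish there.\<close>

definition cutoff :: "real \<Rightarrow> real \<Rightarrow> real \<Rightarrow> real \<Rightarrow> real" where
  "cutoff A B \<epsilon> s = (if s = 0 then A else min A (B * \<bar>\<epsilon>\<bar> / \<bar>s\<bar>))"

lemma cutoff_bounds: "0 \<le> A \<Longrightarrow> 0 \<le> B \<Longrightarrow> 0 \<le> cutoff A B \<epsilon> s" "cutoff A B \<epsilon> s \<le> A"
  by (auto simp: cutoff_def)

lemma cutoff_summable:
  assumes "0 \<le> A" "0 \<le> B"
  shows "(\<lambda>i. norm (coef u i) * cutoff A B \<epsilon> (s i)) summable_on UNIV"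
proof -
  have "(\<lambda>i. norm (coef u i) * A) summable_on UNIV"
    by (rule summable_on_cmult_left) simp
  then show ?thesis
    by (rule summable_on_comparison_test) (use assms in \<open>auto intro!: mult_left_mono mult_nonneg_nonneg cutoff_bounds\<close>)
qed

text \<open>Only finitely many frequencies \<open>s i\<close> carry most of the norm of \<open>u\<close>, and those are bounded away
  from \<open>0\<close>; this replaces any arithmetic condition on the frequency vector.\<close>

lemma cutoff_sum_tendsto_0:
  fixes u :: "'i l1"
  assumes AB: "0 \<le> A" "0 \<le> B" and s: "\<And>i. s i = 0 \<Longrightarrow> coef u i = 0"
  shows "((\<lambda>\<epsilon>. \<Sum>\<^sub>\<infinity>i. norm (coef u i) * cutoff A B \<epsilon> (s i)) \<longlongrightarrow> 0) (at 0)"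
proof (rule tendstoI)
  fix \<eta> :: real assume "\<eta> > 0"
  \<comment> \<open>Half of \<open>\<eta>\<close> is reserved for the tail outside \<open>F\<close>,
    where only the bound \<open>A\<close> is used, and half for the finite part, which is
    proportional to \<open>\<bar>\<epsilon>\<bar>\<close>. The added 1 keeps the denominators
    positive.\<close>
  define \<eta>' where "\<eta>' = \<eta> / (2 * (A + 1))"
  have \<eta>': "\<eta>' > 0" "A * \<eta>' \<le> \<eta> / 2"
    using \<open>\<eta> > 0\<close> AB by (auto simp: \<eta>'_def field_simps)
  obtain F where F: "finite F" "dist (\<Sum>i\<in>F. norm (coef u i)) (norm u) \<le> \<eta>'"
    using has_sum_finite_approximation[OF has_sum_infsum[OF coef_summable[of u]] \<eta>'(1)]
    by (auto simp: norm_l1_def)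
  define K where "K = (\<Sum>i\<in>F. norm (coef u i) * (B / \<bar>s i\<bar>))"
  have K: "0 \<le> K"
    using AB by (auto simp: K_def intro!: sum_nonneg)
  define \<delta> where "\<delta> = \<eta> / (2 * (K + 1))"
  have \<delta>: "\<delta> > 0"
    using \<open>\<eta> > 0\<close> K by (simp add: \<delta>_def)
  have "(\<Sum>\<^sub>\<infinity>i. norm (coef u i) * cutoff A B \<epsilon> (s i)) < \<eta>" if \<epsilon>: "\<bar>\<epsilon>\<bar> < \<delta>" for \<epsilon>
  proof -
    \<comment> \<open>Where \<open>s i = 0\<close> both sides are 0, because \<open>coef u i\<close>
      vanishes there.\<close>
    have inside: "norm (coef u i) * cutoff A B \<epsilon> (s i) \<le> \<bar>\<epsilon>\<bar> * (norm (coef u i) * (B / \<bar>s i\<bar>))" for i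
    proof (cases "s i = 0")
      case False
      then have "cutoff A B \<epsilon> (s i) \<le> \<bar>\<epsilon>\<bar> * (B / \<bar>s i\<bar>)"
        by (simp add: cutoff_def mult.commute)
      from mult_left_mono[OF this, of "norm (coef u i)"] show ?thesis
        by (simp add: mult.left_commute)
    qed (simp add: s)
    have "(\<Sum>\<^sub>\<infinity>i. norm (coef u i) * cutoff A B \<epsilon> (s i)) \<le> \<bar>\<epsilon>\<bar> * K + \<eta>' * A"
    proof (rule infsum_le_finite_sums[OF cutoff_summable[OF AB]])
      fix G :: "'i set" assume "finite G"
      then have "(\<Sum>i\<in>G. norm (coef u i) * cutoff A B \<epsilon> (s i)) \<le> (\<Sum>i\<in>F \<union> (G - F). norm (coef u i) * cutoff A B \<epsilon> (s i))"
        using F(1) AB by (intro sum_mono2) (auto intro!: mult_nonneg_nonneg cutoff_bounds)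
      also have "\<dots> = (\<Sum>i\<in>F. norm (coef u i) * cutoff A B \<epsilon> (s i)) + (\<Sum>i\<in>G - F. norm (coef u i) * cutoff A B \<epsilon> (s i))"
        using F(1) \<open>finite G\<close> by (intro sum.union_disjoint) auto
      also have "\<dots> \<le> \<bar>\<epsilon>\<bar> * K + (\<Sum>i\<in>G - F. norm (coef u i)) * A"
        unfolding K_def sum_distrib_left sum_distrib_right
        by (intro add_mono sum_mono inside mult_left_mono cutoff_bounds) auto
      also have "(\<Sum>i\<in>G - F. norm (coef u i)) \<le> \<eta>'"
      proof -
        have "(\<Sum>i\<in>F \<union> (G - F). norm (coef u i)) \<le> norm u"
          using F(1) \<open>finite G\<close> by (intro l1_sum_le_norm) auto
        moreover have "(\<Sum>i\<in>F \<union> (G - F). norm (coef u i)) = (\<Sum>i\<in>F. norm (coef u i)) + (\<Sum>i\<in>G - F. norm (coef u i))"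
          using F(1) \<open>finite G\<close> by (intro sum.union_disjoint) auto
        ultimately show ?thesis
          using F(2) by (simp add: dist_real_def)
      qed
      finally show "(\<Sum>i\<in>G. norm (coef u i) * cutoff A B \<epsilon> (s i)) \<le> \<bar>\<epsilon>\<bar> * K + \<eta>' * A"
        using AB by (simp add: mult_right_mono)
    qed
    also have "\<bar>\<epsilon>\<bar> * K \<le> \<bar>\<epsilon>\<bar> * (K + 1)"
      by (simp add: mult_left_mono)
    also have "\<bar>\<epsilon>\<bar> * (K + 1) < \<delta> * (K + 1)"
      using \<epsilon> K by (intro mult_strict_right_mono) auto
    also have "\<delta> * (K + 1) = \<eta> / 2"
      using K by (simp add: \<delta>_def field_simps)
    finally show ?thesis
      using \<eta>'(2) by (simp add: mult.commute)
  qed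
  moreover have "0 \<le> (\<Sum>\<^sub>\<infinity>i. norm (coef u i) * cutoff A B \<epsilon> (s i))" for \<epsilon>
    using AB by (intro infsum_nonneg mult_nonneg_nonneg cutoff_bounds) auto
  ultimately show "\<forall>\<^sub>F \<epsilon> in at 0. dist (\<Sum>\<^sub>\<infinity>i. norm (coef u i) * cutoff A B \<epsilon> (s i)) 0 < \<eta>"
    unfolding eventually_at using \<delta> by (intro exI[of _ \<delta>]) (auto simp: dist_real_def)
qed

context torus_weight
begin

text \<open>Each derivative costs a power of the frequency, at most
  \<open>norm \<omega> * lsize \<nu>\<close>; by \<open>x ^ k \<le> fact k * exp x\<close> the
  exponential weight absorbs it.\<close>

lemma weighted_coef_summable:
  fixes u :: "(int ^ 'd) l1"
  shows "(\<lambda>\<nu>. norm (coef u \<nu> / of_real (wt \<xi> \<nu>)) * \<bar>\<omega> \<bullet> ivec \<nu>\<bar> ^ k) summable_on UNIV"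
proof -
  have "(\<lambda>\<nu>. norm (coef u \<nu>) * (fact k * (norm \<omega> / \<xi>) ^ k)) summable_on UNIV"
    by (rule summable_on_cmult_left) simp
  then show ?thesis
  proof (rule summable_on_comparison_test)
    fix \<nu> :: "int ^ 'd"
    have "\<bar>\<omega> \<bullet> ivec \<nu>\<bar> ^ k \<le> (norm \<omega> * lsize \<nu>) ^ k"
      by (rule power_mono[OF abs_inner_ivec_le]) simp
    also have "\<dots> = (norm \<omega> / \<xi>) ^ k * (\<xi> * lsize \<nu>) ^ k"
      unfolding power_mult_distrib[symmetric] using \<xi> by simp
    also have "\<dots> \<le> (norm \<omega> / \<xi>) ^ k * (fact k * wt \<xi> \<nu>)"
      unfolding wt_def using \<xi> by (intro mult_left_mono power_le_fact_exp) (auto simp: lsize_nonneg)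
    finally have "norm (coef u \<nu>) / wt \<xi> \<nu> * \<bar>\<omega> \<bullet> ivec \<nu>\<bar> ^ k
        \<le> norm (coef u \<nu>) / wt \<xi> \<nu> * ((norm \<omega> / \<xi>) ^ k * (fact k * wt \<xi> \<nu>))"
      using w_pos[of \<nu>] by (intro mult_left_mono) auto
    also have "\<dots> = norm (coef u \<nu>) * (fact k * (norm \<omega> / \<xi>) ^ k)"
      using w_pos[of \<nu>] by simp
    finally show "norm (coef u \<nu> / of_real (wt \<xi> \<nu>)) * \<bar>\<omega> \<bullet> ivec \<nu>\<bar> ^ k
        \<le> norm (coef u \<nu>) * (fact k * (norm \<omega> / \<xi>) ^ k)"
      using w_pos[of \<nu>] by (simp add: norm_divide)
  qed auto
qed

text \<open>Along the trajectory mode \<open>\<nu>\<close> oscillates with frequency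
  \<open>\<omega> \<bullet> ivec \<nu>\<close>, so the equation becomes one linear identity per
  mode. The nonlinear term enters through the coefficients of \<open>v\<close>, whose real part
  represents it on the trajectory.\<close>

lemma solves_ode_ft:
  fixes u v :: "(int ^ 'd) l1"
  assumes coefs: "\<And>\<nu>. (\<i> * (\<omega> \<bullet> ivec \<nu>) - \<epsilon> * (\<omega> \<bullet> ivec \<nu>)\<^sup>2) * coef u \<nu> = - complex_of_real \<epsilon> * coef v \<nu>"
    and v: "\<And>t. Re (ft v (t *\<^sub>R \<omega>)) = h (c + Re (ft u (t *\<^sub>R \<omega>)), t *\<^sub>R \<omega>)"
  shows "solves_ode \<epsilon> h \<omega> (\<lambda>t. c + Re (ft u (t *\<^sub>R \<omega>)))"
proof -
  define s where "s \<nu> = \<omega> \<bullet> ivec \<nu>" for \<nu> :: "int ^ 'd"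
  define a where "a \<nu> = coef u \<nu> / of_real (wt \<xi> \<nu>)" for \<nu>
  define a' where "a' \<nu> = \<i> * s \<nu> * a \<nu>" for \<nu>
  define x' where "x' t = (\<Sum>\<^sub>\<infinity>\<nu>. a' \<nu> * cis (s \<nu> * t))" for t
  define x'' where "x'' t = (\<Sum>\<^sub>\<infinity>\<nu>. \<i> * s \<nu> * a' \<nu> * cis (s \<nu> * t))" for t
  have ft_cis: "ft y (t *\<^sub>R \<omega>) = (\<Sum>\<^sub>\<infinity>\<nu>. coef y \<nu> / of_real (wt \<xi> \<nu>) * cis (s \<nu> * t))" for y t
    by (simp add: ft_def ev_def fchar_def s_def inner_commute mult.commute)
  have sum: "(\<lambda>\<nu>. norm (a \<nu>) * \<bar>s \<nu>\<bar> ^ k) summable_on UNIV" for k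
    unfolding a_def s_def by (rule weighted_coef_summable)
  have norm_a': "norm (a' \<nu>) = norm (a \<nu>) * \<bar>s \<nu>\<bar>" for \<nu>
    by (simp add: a'_def norm_mult)
  have sum': "(\<lambda>\<nu>. norm (a' \<nu>) * \<bar>s \<nu>\<bar> ^ k) summable_on UNIV" for k
    using sum[of "Suc k"] by (simp add: norm_a' mult.assoc)
  have d0: "((\<lambda>t. Re (\<Sum>\<^sub>\<infinity>\<nu>. a \<nu> * cis (s \<nu> * t))) has_real_derivative Re (x' t)) (at t)" for t
    unfolding x'_def a'_def by (rule trig_series_DERIV[OF sum])
  have d1: "((\<lambda>t. c + Re (ft u (t *\<^sub>R \<omega>))) has_real_derivative Re (x' t)) (at t)" for t
    unfolding ft_cis a_def[symmetric] using DERIV_add[OF DERIV_const[of c] d0[of t]] by simp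
  have d2: "((\<lambda>t. Re (x' t)) has_real_derivative Re (x'' t)) (at t)" for t
    unfolding x'_def x''_def by (rule trig_series_DERIV[OF sum'])
  have "\<epsilon> * Re (x'' t) + Re (x' t) + \<epsilon> * h (c + Re (ft u (t *\<^sub>R \<omega>)), t *\<^sub>R \<omega>) = 0" for t
  proof -
    have sum_x': "(\<lambda>\<nu>. a' \<nu> * cis (s \<nu> * t)) summable_on UNIV"
      by (rule abs_summable_summable) (use sum'[of 0] in \<open>simp add: norm_mult\<close>)
    have sum_x'': "(\<lambda>\<nu>. \<i> * s \<nu> * a' \<nu> * cis (s \<nu> * t)) summable_on UNIV"
      by (rule abs_summable_summable) (use sum'[of 1] in \<open>simp add: norm_mult mult.commute\<close>)
    have sum_v: "(\<lambda>\<nu>. coef v \<nu> / of_real (wt \<xi> \<nu>) * cis (s \<nu> * t)) summable_on UNIV"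
      by (rule abs_summable_summable[OF ev_summable]) simp
    have "((\<lambda>\<nu>. \<epsilon> * (\<i> * s \<nu> * a' \<nu> * cis (s \<nu> * t)) + a' \<nu> * cis (s \<nu> * t)
        + \<epsilon> * (coef v \<nu> / of_real (wt \<xi> \<nu>) * cis (s \<nu> * t))) has_sum
        \<epsilon> * x'' t + x' t + \<epsilon> * ft v (t *\<^sub>R \<omega>)) UNIV"
      unfolding x'_def x''_def ft_cis
      by (intro has_sum_add has_sum_cmult_right has_sum_infsum sum_x' sum_x'' sum_v)
    moreover have "\<epsilon> * (\<i> * s \<nu> * a' \<nu> * cis (s \<nu> * t)) + a' \<nu> * cis (s \<nu> * t)
        + \<epsilon> * (coef v \<nu> / of_real (wt \<xi> \<nu>) * cis (s \<nu> * t)) = 0" for \<nu>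
    proof -
      have "\<epsilon> * (\<i> * s \<nu> * a' \<nu> * cis (s \<nu> * t)) + a' \<nu> * cis (s \<nu> * t)
        + \<epsilon> * (coef v \<nu> / of_real (wt \<xi> \<nu>) * cis (s \<nu> * t)) =
        ((\<i> * s \<nu> - \<epsilon> * (s \<nu>)\<^sup>2) * coef u \<nu> + \<epsilon> * coef v \<nu>) * (cis (s \<nu> * t) / of_real (wt \<xi> \<nu>))"
        by (simp add: a'_def a_def power2_eq_square add_divide_distrib diff_divide_distrib algebra_simps)
      then show ?thesis
        using coefs[of \<nu>] by (simp add: s_def)
    qed
    ultimately have "\<epsilon> * x'' t + x' t + \<epsilon> * ft v (t *\<^sub>R \<omega>) = 0"
      by (simp add: has_sum_0 has_sum_unique)
    then have "Re (\<epsilon> * x'' t + x' t + \<epsilon> * ft v (t *\<^sub>R \<omega>)) = 0"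
      by simp
    then show ?thesis
      by (simp add: v)
  qed
  then show ?thesis
    unfolding solves_ode_def
    by (intro exI[of _ "\<lambda>t. Re (x' t)"] exI[of _ "\<lambda>t. Re (x'' t)"] allI conjI d1 d2)
qed

end

section \<open>Response solutions\<close>

context torus_weight
begin

text \<open>This is \<open>Q\<close>, with \<open>H k\<close> representing \<open>a\<^sub>k\<close>;
  the offset 2 removes the constant and linear terms, which are treated separately.\<close>

definition nonlin :: "(nat \<Rightarrow> (int ^ 'd) l1) \<Rightarrow> (int ^ 'd) l1 \<Rightarrow> (int ^ 'd) l1" where
  "nonlin H u = (\<Sum>k. conv (H (k + 2)) (cpow u (k + 2)))"

lemma nonlin_0: "nonlin H 0 = 0"
  by (simp add: nonlin_def conv.zero_left conv.zero_right)

context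
  fixes H :: "nat \<Rightarrow> (int ^ 'd) l1" and M N \<rho> :: real
  assumes H: "\<And>k. norm (H k) \<le> M * N ^ k" and N: "0 < N" and \<rho>: "0 \<le> \<rho>" "\<rho> * N \<le> 1 / 4"
begin

lemma M_nonneg: "0 \<le> M"
  using order_trans[OF norm_ge_zero H[of 0]] by simp

lemma nonlin_summable:
  assumes "norm u \<le> \<rho>"
  shows "summable (\<lambda>k. norm (conv (H k) (cpow u k)))"
proof (rule summable_comparison_test'[of "\<lambda>k. M * (1 / 4) ^ k"])
  show "summable (\<lambda>k. M * (1 / 4 :: real) ^ k)"
    by (intro summable_mult summable_geometric) simp
  fix k
  have "norm (conv (H k) (cpow u k)) \<le> M * N ^ k * \<rho> ^ k"
    using M_nonneg N \<rho>(1) assms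
    by (intro order_trans[OF norm_conv] mult_mono H order_trans[OF norm_cpow power_mono]) auto
  also have "\<dots> = M * (\<rho> * N) ^ k"
    by (simp add: power_mult_distrib)
  also have "\<dots> \<le> M * (1 / 4) ^ k"
    using M_nonneg N \<rho> by (intro mult_left_mono power_mono) auto
  finally show "norm (norm (conv (H k) (cpow u k))) \<le> M * (1 / 4) ^ k"
    by simp
qed

lemma nonlin_summable': "norm u \<le> \<rho> \<Longrightarrow> summable (\<lambda>k. conv (H (k + 2)) (cpow u (k + 2)))"
  by (rule summable_ignore_initial_segment[OF summable_norm_cancel[OF nonlin_summable]])

lemma star_nonlin:
  assumes "norm u \<le> \<rho>" "\<And>k. star (H k) = H k"
  shows "star (nonlin H u) = nonlin H (star u)"
  unfolding nonlin_def bounded_linear.suminf[OF bounded_linear_star nonlin_summable'[OF assms(1)]]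
  by (simp only: star_conv star_cpow assms(2))

text \<open>Starting at degree 2 leaves a factor \<open>\<rho>\<close> in the Lipschitz constant, so
  a small ball makes it small.\<close>

lemma nonlin_lipschitz:
  assumes u: "norm u \<le> \<rho>" and v: "norm v \<le> \<rho>"
  shows "norm (nonlin H u - nonlin H v) \<le> 4 * M * N\<^sup>2 * \<rho> * norm (u - v)"
proof -
  define c where "c = 2 * M * N\<^sup>2 * \<rho> * norm (u - v)"
  have le: "norm (conv (H (k + 2)) (cpow u (k + 2)) - conv (H (k + 2)) (cpow v (k + 2))) \<le> c * (1 / 2) ^ k" for k
  proof -
    \<comment> \<open>With \<open>\<rho> * N \<le> 1 / 4\<close> this leaves a geometric series of
      ratio 1/2; its sum 2 and the factor 2 here make up the constant 4.\<close>
    have k2: "real (k + 2) \<le> 2 * 2 ^ k"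
      by (induction k) auto
    have "norm (conv (H (k + 2)) (cpow u (k + 2) - cpow v (k + 2)))
        \<le> (M * N ^ (k + 2)) * (real (k + 2) * \<rho> ^ (k + 2 - 1) * norm (u - v))"
      using M_nonneg N by (intro order_trans[OF norm_conv] mult_mono H norm_cpow_diff u v) auto
    also have "\<dots> = M * N\<^sup>2 * \<rho> * norm (u - v) * (real (k + 2) * (\<rho> * N) ^ k)"
      by (simp add: power_add power_mult_distrib power2_eq_square)
    also have "\<dots> \<le> M * N\<^sup>2 * \<rho> * norm (u - v) * ((2 * 2 ^ k) * (1 / 4) ^ k)"
      using M_nonneg N \<rho> by (intro mult_left_mono mult_mono k2 power_mono mult_nonneg_nonneg) auto
    also have "\<dots> = c * (1 / 2) ^ k"
      unfolding c_def mult.assoc power_mult_distrib[symmetric] by simp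
    finally show ?thesis
      by (simp only: conv.diff_right)
  qed
  have geo: "(\<lambda>k. c * (1 / 2) ^ k) sums (c * 2)"
    using sums_mult[OF geometric_sums[of "1 / 2 :: real"], of c] by simp
  have "nonlin H u - nonlin H v = (\<Sum>k. conv (H (k + 2)) (cpow u (k + 2)) - conv (H (k + 2)) (cpow v (k + 2)))"
    unfolding nonlin_def by (rule suminf_diff[OF nonlin_summable'[OF u] nonlin_summable'[OF v]])
  also have "norm \<dots> \<le> (\<Sum>k. c * (1 / 2) ^ k)"
    by (rule norm_suminf_le[OF le sums_summable[OF geo]])
  also have "\<dots> = 4 * M * N\<^sup>2 * \<rho> * norm (u - v)"
    using sums_unique[OF geo] by (simp add: c_def)
  finally show ?thesis .
qed

text \<open>Evaluation at a point is a bounded algebra homomorphism, so the series in the algebra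
  becomes a scalar power series in the value of \<open>u\<close>.\<close>

lemma ft_nonlin:
  assumes "norm u \<le> \<rho>"
  shows "(\<lambda>k. ft (H k) \<psi> * ft u \<psi> ^ k) sums ft (H 0 + conv (H 1) u + nonlin H u) \<psi>"
proof -
  let ?f = "\<lambda>k. conv (H k) (cpow u k)"
  have summable: "summable ?f"
    by (rule summable_norm_cancel[OF nonlin_summable[OF assms]])
  have "suminf ?f = nonlin H u + (\<Sum>k<2. ?f k)"
    unfolding nonlin_def by (rule suminf_split_initial_segment[OF summable])
  also have "(\<Sum>k<2. ?f k) = H 0 + conv (H 1) u"
    by (simp add: numeral_2_eq_2 conv_unit_right)
  finally have "?f sums (H 0 + conv (H 1) u + nonlin H u)"
    using summable_sums[OF summable] by (simp add: add.commute)
  then have "(\<lambda>k. ev (fc \<psi>) (?f k)) sums ev (fc \<psi>) (H 0 + conv (H 1) u + nonlin H u)"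
    by (rule bounded_linear.sums[OF bounded_linear_ev, rotated]) simp
  then show ?thesis
    by (simp add: ft_def ev_conv[OF is_character_fchar] ev_cpow[OF is_character_fchar])
qed

end

end

definition resolvent :: "real \<Rightarrow> real \<Rightarrow> real \<Rightarrow> complex" where
  "resolvent D \<epsilon> s = of_real \<epsilon> / Complex (\<epsilon> * (D - s\<^sup>2)) s"

text \<open>Two regimes: if \<open>s\<^sup>2 \<le> \<bar>D\<bar> / 2\<close>, the real part of the
  denominator is at least \<open>\<bar>\<epsilon>\<bar> * \<bar>D\<bar> / 2\<close> in size;
  otherwise its imaginary part exceeds \<open>sqrt (\<bar>D\<bar> / 2)\<close> in size. The
  threshold on \<open>\<epsilon>\<close> is the one that gives the same bound in both.\<close>

lemma resolvent_bound:
  assumes "D \<noteq> 0" "\<epsilon> \<noteq> 0"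
  shows "Complex (\<epsilon> * (D - s\<^sup>2)) s \<noteq> 0"
    and "s \<noteq> 0 \<Longrightarrow> norm (resolvent D \<epsilon> s) \<le> \<bar>\<epsilon>\<bar> / \<bar>s\<bar>"
    and "\<bar>\<epsilon>\<bar> \<le> 2 / \<bar>D\<bar> * sqrt (\<bar>D\<bar> / 2) \<Longrightarrow> norm (resolvent D \<epsilon> s) \<le> 2 / \<bar>D\<bar>"
proof -
  let ?d = "Complex (\<epsilon> * (D - s\<^sup>2)) s"
  show "?d \<noteq> 0"
    using assms by (auto simp: complex_eq_iff)
  have im: "\<bar>s\<bar> \<le> norm ?d" and re: "\<bar>\<epsilon> * (D - s\<^sup>2)\<bar> \<le> norm ?d"
    using abs_Im_le_cmod[of ?d] abs_Re_le_cmod[of ?d] by auto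
  have im_bound: "norm (resolvent D \<epsilon> s) \<le> \<bar>\<epsilon>\<bar> / \<bar>s\<bar>" if "s \<noteq> 0"
    unfolding resolvent_def norm_divide using im that by (simp add: frac_le)
  then show "s \<noteq> 0 \<Longrightarrow> norm (resolvent D \<epsilon> s) \<le> \<bar>\<epsilon>\<bar> / \<bar>s\<bar>" .
  assume small: "\<bar>\<epsilon>\<bar> \<le> 2 / \<bar>D\<bar> * sqrt (\<bar>D\<bar> / 2)"
  show "norm (resolvent D \<epsilon> s) \<le> 2 / \<bar>D\<bar>"
  proof (cases "s\<^sup>2 \<le> \<bar>D\<bar> / 2")
    case True
    have "\<bar>D\<bar> / 2 \<le> \<bar>D - s\<^sup>2\<bar>"
      using True zero_le_power2[of s] by linarith
    then have "\<bar>\<epsilon>\<bar> * (\<bar>D\<bar> / 2) \<le> norm ?d"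
      by (rule order_trans[OF mult_left_mono re[unfolded abs_mult]]) simp
    then have "norm (resolvent D \<epsilon> s) \<le> \<bar>\<epsilon>\<bar> / (\<bar>\<epsilon>\<bar> * (\<bar>D\<bar> / 2))"
      unfolding resolvent_def norm_divide using assms by (intro frac_le) auto
    then show ?thesis
      using assms by simp
  next
    case False
    then have "sqrt (\<bar>D\<bar> / 2) < sqrt (s\<^sup>2)"
      by (intro real_sqrt_less_mono) simp
    then have s: "sqrt (\<bar>D\<bar> / 2) < \<bar>s\<bar>"
      by simp
    have pos: "0 < sqrt (\<bar>D\<bar> / 2)"
      using assms by simp
    have "norm (resolvent D \<epsilon> s) \<le> \<bar>\<epsilon>\<bar> / \<bar>s\<bar>"
      using s pos by (intro im_bound) auto
    also have "\<dots> \<le> (2 / \<bar>D\<bar> * sqrt (\<bar>D\<bar> / 2)) / sqrt (\<bar>D\<bar> / 2)"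
      using small s pos by (intro frac_le) auto
    also have "\<dots> = 2 / \<bar>D\<bar>"
      using pos by simp
    finally show ?thesis .
  qed
qed

lemma resolvent_minus: "resolvent D \<epsilon> (- s) = cnj (resolvent D \<epsilon> s)"
  by (simp add: resolvent_def complex_cnj)

text \<open>One of the two frequencies is at least half the difference in size; its factor is at
  most \<open>2 * \<bar>\<epsilon>\<bar> / \<bar>s - r\<bar>\<close>, the other at most
  \<open>2 / \<bar>D\<bar>\<close>. The result depends on \<open>s - r\<close> only, as
  \<open>norm_mult_conv_mult\<close> requires.\<close>

lemma resolvent_cutoff:
  assumes "D \<noteq> 0" "\<epsilon> \<noteq> 0" "\<bar>\<epsilon>\<bar> \<le> 2 / \<bar>D\<bar> * sqrt (\<bar>D\<bar> / 2)"
  shows "norm (resolvent D \<epsilon> s) \<le> cutoff (2 / \<bar>D\<bar>) 1 \<epsilon> s"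
    and "norm (resolvent D \<epsilon> s * resolvent D \<epsilon> r) \<le> cutoff ((2 / \<bar>D\<bar>)\<^sup>2) (4 / \<bar>D\<bar>) \<epsilon> (s - r)"
proof -
  define C where "C = 2 / \<bar>D\<bar>"
  have C: "norm (resolvent D \<epsilon> t) \<le> C" for t
    unfolding C_def by (rule resolvent_bound(3)[OF assms])
  have C_nonneg: "0 \<le> C"
    by (simp add: C_def)
  show "norm (resolvent D \<epsilon> s) \<le> cutoff (2 / \<bar>D\<bar>) 1 \<epsilon> s"
    using C[of s] resolvent_bound(2)[OF assms(1,2), of s]
    by (cases "s = 0") (simp_all add: cutoff_def C_def)
  have sq: "norm (resolvent D \<epsilon> s * resolvent D \<epsilon> r) \<le> C\<^sup>2"
    unfolding norm_mult power2_eq_square using C C_nonneg by (intro mult_mono) auto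
  have half: "norm (resolvent D \<epsilon> x) * norm (resolvent D \<epsilon> y) \<le> 2 * C * \<bar>\<epsilon>\<bar> / \<bar>s - r\<bar>"
    if "s \<noteq> r" "\<bar>s - r\<bar> / 2 \<le> \<bar>x\<bar>" for x y
  proof -
    have "\<bar>s - r\<bar> / 2 > 0"
      using that(1) by simp
    then have "x \<noteq> 0"
      using that(2) by auto
    have "norm (resolvent D \<epsilon> x) \<le> \<bar>\<epsilon>\<bar> / \<bar>x\<bar>"
      by (rule resolvent_bound(2)[OF assms(1,2) \<open>x \<noteq> 0\<close>])
    also have "\<dots> \<le> \<bar>\<epsilon>\<bar> / (\<bar>s - r\<bar> / 2)"
      using that by (intro frac_le) auto
    finally have "norm (resolvent D \<epsilon> x) * norm (resolvent D \<epsilon> y) \<le> \<bar>\<epsilon>\<bar> / (\<bar>s - r\<bar> / 2) * C"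
      using C by (intro mult_mono) auto
    then show ?thesis
      by (simp add: mult_ac)
  qed
  have "norm (resolvent D \<epsilon> s * resolvent D \<epsilon> r) \<le> 2 * C * \<bar>\<epsilon>\<bar> / \<bar>s - r\<bar>" if "s \<noteq> r"
  proof -
    have "\<bar>s - r\<bar> / 2 \<le> \<bar>s\<bar> \<or> \<bar>s - r\<bar> / 2 \<le> \<bar>r\<bar>"
      using abs_triangle_ineq4[of s r] by (cases "\<bar>r\<bar> \<le> \<bar>s\<bar>") auto
    then show ?thesis
      using half[OF that, of s r] half[OF that, of r s] by (auto simp: norm_mult mult.commute)
  qed
  then show "norm (resolvent D \<epsilon> s * resolvent D \<epsilon> r) \<le> cutoff ((2 / \<bar>D\<bar>)\<^sup>2) (4 / \<bar>D\<bar>) \<epsilon> (s - r)"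
    using sq by (cases "s = r") (simp_all add: cutoff_def C_def)
qed

context torus_weight
begin

text \<open>Assembles the fixed point theorem and the multiplier bounds. The equation is stated mode
  by mode, the form that \<open>solves_ode_ft\<close> takes as input.\<close>

lemma response_solution:
  fixes H :: "nat \<Rightarrow> (int ^ 'd) l1" and \<omega> :: "real ^ 'd"
  assumes H: "\<And>k. norm (H k) \<le> M * N ^ k" and N: "0 < N" and star_H: "\<And>k. star (H k) = H k"
    and H0: "coef (H 0) 0 = 0" and H1: "coef (H 1) 0 = of_real D" and D: "D \<noteq> 0"
    and indep: "\<And>\<nu>. \<omega> \<bullet> ivec \<nu> = 0 \<Longrightarrow> \<nu> = 0"
  obtains \<epsilon>\<^sub>0 Y where "\<epsilon>\<^sub>0 > 0" "(Y \<longlongrightarrow> 0) (at 0)"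
    "\<And>\<epsilon>. \<bar>\<epsilon>\<bar> < \<epsilon>\<^sub>0 \<Longrightarrow> star (Y \<epsilon>) = Y \<epsilon>"
    "\<And>\<epsilon>. \<bar>\<epsilon>\<bar> < \<epsilon>\<^sub>0 \<Longrightarrow> norm (Y \<epsilon>) \<le> 1 / (4 * N)"
    "\<And>\<epsilon> \<nu>. \<bar>\<epsilon>\<bar> < \<epsilon>\<^sub>0 \<Longrightarrow> (\<i> * (\<omega> \<bullet> ivec \<nu>) - \<epsilon> * (\<omega> \<bullet> ivec \<nu>)\<^sup>2) * coef (Y \<epsilon>) \<nu>
      = - complex_of_real \<epsilon> * coef (H 0 + conv (H 1) (Y \<epsilon>) + nonlin H (Y \<epsilon>)) \<nu>"
proof -
  interpret star: bounded_linear star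
    by (rule bounded_linear_star)
  define s where "s \<nu> = \<omega> \<bullet> ivec \<nu>" for \<nu> :: "int ^ 'd"
  have s0: "s \<nu> = 0 \<Longrightarrow> \<nu> = 0" for \<nu>
    using indep by (simp add: s_def)
  have s_diff: "s (\<mu> - \<nu>) = s \<mu> - s \<nu>" for \<mu> \<nu>
    using ivec_add[of \<mu> "- \<nu>"] by (simp add: s_def ivec_minus inner_diff_right)
  have s_minus: "s (- \<nu>) = - s \<nu>" for \<nu>
    by (simp add: s_def ivec_minus)
  define b where "b = H 1 - D *\<^sub>R unit"
  have b0: "coef b 0 = 0"
    by (simp add: b_def H1[unfolded One_nat_def] coef_unit scaleR_conv_of_real)
  have star_b: "star b = b"
    by (simp add: b_def star.diff star.scaleR star_H star_unit)
  define C where "C = 2 / \<bar>D\<bar>"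
  have C: "0 < C"
    using D by (simp add: C_def)
  define B where "B = C * norm b"
  have B: "0 \<le> B"
    using C by (simp add: B_def)
  have M: "0 \<le> M"
    using order_trans[OF norm_ge_zero H[of 0]] by simp
  \<comment> \<open>The radius is chosen before \<open>\<epsilon>\<close>: \<open>R * \<rho>\<close>
    is the share of the nonlinear term in the contraction constant, and \<open>1 / (4 * N)\<close>
    keeps the series of \<open>nonlin\<close> convergent.\<close>
  define R where "R = (1 + B) * C * (4 * M * N\<^sup>2)"
  have R: "0 \<le> R"
    using B C M by (simp add: R_def)
  define \<rho> where "\<rho> = min (1 / (4 * N)) (1 / (4 * (R + 1)))"
  have \<rho>: "0 < \<rho>" "\<rho> \<le> 1 / (4 * N)" "\<rho> \<le> 1 / (4 * (R + 1))"
    using N R by (auto simp: \<rho>_def)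
  have \<rho>N: "\<rho> * N \<le> 1 / 4"
    using \<rho>(2) N by (simp add: field_simps)
  have "R * \<rho> \<le> R * (1 / (4 * (R + 1)))"
    using \<rho>(3) R by (rule mult_left_mono)
  also have "\<dots> \<le> 1 / 4"
    using R by (simp add: field_simps)
  finally have small: "(1 + B) * C * (4 * M * N\<^sup>2 * \<rho>) \<le> 1 / 4"
    by (simp add: R_def mult.assoc)
  \<comment> \<open>\<open>\<kappa>\<close> bounds the operator \<open>T b T\<close> and
    \<open>\<tau>\<close> the vector \<open>T (H 0)\<close>. Both tend to 0 because \<open>b\<close>
    and \<open>H 0\<close> have no zero mode and all other frequencies are nonzero by
    independence.\<close>
  define \<kappa> where "\<kappa> \<epsilon> = (\<Sum>\<^sub>\<infinity>\<nu>. norm (coef b \<nu>) * cutoff ((2 / \<bar>D\<bar>)\<^sup>2) (4 / \<bar>D\<bar>) \<epsilon> (s \<nu>))" for \<epsilon>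
  define \<tau> where "\<tau> \<epsilon> = (\<Sum>\<^sub>\<infinity>\<nu>. norm (coef (H 0) \<nu>) * cutoff (2 / \<bar>D\<bar>) 1 \<epsilon> (s \<nu>))" for \<epsilon>
  have \<kappa>: "(\<kappa> \<longlongrightarrow> 0) (at 0)"
    unfolding \<kappa>_def[abs_def] by (rule cutoff_sum_tendsto_0) (auto dest!: s0 simp: b0)
  have \<tau>: "(\<tau> \<longlongrightarrow> 0) (at 0)"
    unfolding \<tau>_def[abs_def] by (rule cutoff_sum_tendsto_0) (auto dest!: s0 simp: H0)
  have lims: "((\<lambda>\<epsilon>. \<kappa> \<epsilon> * norm b) \<longlongrightarrow> 0 * norm b) (at 0)" "((\<lambda>\<epsilon>. (1 + B) * \<tau> \<epsilon>) \<longlongrightarrow> (1 + B) * 0) (at 0)"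
    by (intro tendsto_intros \<kappa> \<tau>)+
  have "\<forall>\<^sub>F \<epsilon> in at 0. \<kappa> \<epsilon> * norm b < 1 / 4" "\<forall>\<^sub>F \<epsilon> in at 0. (1 + B) * \<tau> \<epsilon> < \<rho> / 2"
    using \<rho>(1) by (auto intro!: order_tendstoD(2)[OF lims(1)] order_tendstoD(2)[OF lims(2)] simp del: less_divide_eq_numeral1)
  then have "\<forall>\<^sub>F \<epsilon> in at 0. \<kappa> \<epsilon> * norm b < 1 / 4 \<and> (1 + B) * \<tau> \<epsilon> < \<rho> / 2"
    by (rule eventually_conj)
  then obtain \<delta> where \<delta>: "\<delta> > 0"
    "\<And>\<epsilon>. \<epsilon> \<noteq> 0 \<Longrightarrow> \<bar>\<epsilon>\<bar> < \<delta> \<Longrightarrow> \<kappa> \<epsilon> * norm b < 1 / 4 \<and> (1 + B) * \<tau> \<epsilon> < \<rho> / 2"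
    unfolding eventually_at by (auto simp: dist_real_def)
  define \<epsilon>\<^sub>0 where "\<epsilon>\<^sub>0 = min \<delta> (2 / \<bar>D\<bar> * sqrt (\<bar>D\<bar> / 2))"
  have \<epsilon>\<^sub>0: "\<epsilon>\<^sub>0 > 0"
    using \<delta>(1) D by (simp add: \<epsilon>\<^sub>0_def)
  \<comment> \<open>The bound by \<open>\<tau>\<close> is recorded because
    \<open>norm X \<le> \<rho>\<close> alone would not make the chosen solutions tend to 0.\<close>
  define good where "good \<epsilon> X \<longleftrightarrow> star X = X \<and> norm X \<le> \<rho> \<and> norm X \<le> 2 * (1 + B) * \<tau> \<epsilon> \<and>
      (\<forall>\<nu>. (\<i> * s \<nu> - \<epsilon> * (s \<nu>)\<^sup>2) * coef X \<nu> = - complex_of_real \<epsilon> * coef (H 0 + conv (H 1) X + nonlin H X) \<nu>)" for \<epsilon> X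
  have exists: "\<exists>X. good \<epsilon> X" if \<epsilon>: "\<epsilon> \<noteq> 0" "\<bar>\<epsilon>\<bar> < \<epsilon>\<^sub>0" for \<epsilon>
  proof -
    have \<epsilon>': "\<bar>\<epsilon>\<bar> \<le> 2 / \<bar>D\<bar> * sqrt (\<bar>D\<bar> / 2)" "\<kappa> \<epsilon> * norm b < 1 / 4" "(1 + B) * \<tau> \<epsilon> < \<rho> / 2"
      using \<epsilon> \<delta>(2)[of \<epsilon>] by (auto simp: \<epsilon>\<^sub>0_def)
    define m where "m \<nu> = resolvent D \<epsilon> (s \<nu>)" for \<nu>
    have m_le: "norm (m \<nu>) \<le> C" for \<nu>
      unfolding m_def C_def by (rule resolvent_bound(3)[OF D \<epsilon>(1) \<epsilon>'(1)])
    have m_minus: "m (- \<nu>) = cnj (m \<nu>)" for \<nu>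
      by (simp add: m_def s_minus resolvent_minus)
    define T where "T = mult m"
    define K where "K u = T (conv b u)" for u
    have T_le: "norm (T u) \<le> C * norm u" for u
      unfolding T_def by (rule norm_mult_le[OF m_le])
    have lin_T: "linear T"
      unfolding T_def by (rule linear_mult[OF m_le])
    have KK: "norm (K (K u)) \<le> norm u / 4" for u
    proof -
      have "norm (K (K u)) \<le> \<kappa> \<epsilon> * norm (conv b u)"
        unfolding K_def T_def \<kappa>_def
        by (rule norm_mult_conv_mult[OF m_le])
           (auto simp: m_def s_diff intro!: resolvent_cutoff(2) D \<epsilon> \<epsilon>' cutoff_summable)
      also have "\<dots> \<le> \<kappa> \<epsilon> * (norm b * norm u)"
        unfolding \<kappa>_def by (intro mult_left_mono norm_conv infsum_nonneg mult_nonneg_nonneg cutoff_bounds) auto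
      also have "\<dots> \<le> 1 / 4 * norm u"
        unfolding mult.assoc[symmetric] using \<epsilon>'(2) by (intro mult_right_mono) auto
      finally show ?thesis
        by simp
    qed
    have T_H0: "norm (T (H 0)) \<le> \<tau> \<epsilon>"
    proof -
      have "norm (T (H 0)) = (\<Sum>\<^sub>\<infinity>\<nu>. norm (m \<nu> * coef (H 0) \<nu>))"
        by (simp add: norm_l1_def T_def coef_mult[OF m_le])
      also have "\<dots> \<le> \<tau> \<epsilon>"
        unfolding \<tau>_def
      proof (rule infsum_mono[OF mult_summable[OF m_le] cutoff_summable])
        fix \<nu>
        have "norm (m \<nu>) \<le> cutoff (2 / \<bar>D\<bar>) 1 \<epsilon> (s \<nu>)"
          unfolding m_def by (rule resolvent_cutoff(1)[OF D \<epsilon>(1) \<epsilon>'(1)])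
        then show "norm (m \<nu> * coef (H 0) \<nu>) \<le> norm (coef (H 0) \<nu>) * cutoff (2 / \<bar>D\<bar>) 1 \<epsilon> (s \<nu>)"
          unfolding norm_mult mult.commute[of "norm (m \<nu>)"] by (rule mult_left_mono) simp
      qed auto
      finally show ?thesis .
    qed
    have "\<exists>X. norm X \<le> \<rho> \<and> star X = X \<and> X + K X + T (H 0 + nonlin H X) = 0 \<and>
        norm X \<le> 2 * (1 + B) * norm (T (H 0))"
    proof (rule quasi_newton_fixed_point[where C=C and L="4 * M * N\<^sup>2 * \<rho>", OF lin_T T_le _ _ KK star.linear])
      show "linear K"
        unfolding K_def
        by (rule linearI) (simp_all add: conv.add_right conv.scaleR_right linear_add[OF lin_T] linear_scale[OF lin_T])
      show "norm (K u) \<le> B * norm u" for u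
        using order_trans[OF T_le mult_left_mono[OF norm_conv, of C b u]] C by (simp add: K_def B_def mult.assoc)
      show "star (T u) = T (star u)" for u
        unfolding T_def by (rule star_mult[of m C, OF m_le m_minus])
      then show "star (K u) = K (star u)" for u
        by (simp add: K_def star_conv star_b)
      show "norm (nonlin H u - nonlin H v) \<le> 4 * M * N\<^sup>2 * \<rho> * norm (u - v)" if "norm u \<le> \<rho>" "norm v \<le> \<rho>" for u v
        by (rule nonlin_lipschitz[OF H N _ \<rho>N that]) (use \<rho> in simp)
      show "star (nonlin H u) = nonlin H (star u)" if "norm u \<le> \<rho>" for u
        by (rule star_nonlin[OF H N _ \<rho>N that star_H]) (use \<rho> in simp)
      show "(1 + B) * norm (T (H 0)) \<le> \<rho> / 2"
        using B by (intro order_trans[OF mult_left_mono[OF T_H0] less_imp_le[OF \<epsilon>'(3)]]) simp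
    qed (use small B C \<rho> in \<open>auto simp: norm_star star_H nonlin_0\<close>)
    then obtain X where X: "norm X \<le> \<rho>" "star X = X" "X + K X + T (H 0 + nonlin H X) = 0"
      "norm X \<le> 2 * (1 + B) * norm (T (H 0))"
      by blast
    have "(\<i> * s \<nu> - \<epsilon> * (s \<nu>)\<^sup>2) * coef X \<nu> = - complex_of_real \<epsilon> * coef (H 0 + conv (H 1) X + nonlin H X) \<nu>" for \<nu>
    proof -
      \<comment> \<open>Multiplying by the denominator \<open>d\<close> undoes the resolvent; its
        term \<open>\<epsilon> * D\<close> cancels against the \<open>D\<close> split off from
        \<open>H 1\<close>.\<close>
      define d where "d = Complex (\<epsilon> * (D - (s \<nu>)\<^sup>2)) (s \<nu>)"
      have d: "d \<noteq> 0" "d * m \<nu> = \<epsilon>"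
        using resolvent_bound(1)[OF D \<epsilon>(1), of "s \<nu>"] by (simp_all add: d_def m_def resolvent_def)
      have "X + T (conv b X + (H 0 + nonlin H X)) = 0"
        using X(3) by (simp add: K_def linear_add[OF lin_T] add.assoc)
      from arg_cong[where f="\<lambda>u. coef u \<nu>", OF this]
      have "coef X \<nu> + m \<nu> * coef (conv b X + (H 0 + nonlin H X)) \<nu> = 0"
        unfolding T_def coef_add[of X] coef_mult[OF m_le] by simp
      then have "d * (coef X \<nu> + m \<nu> * coef (conv b X + (H 0 + nonlin H X)) \<nu>) = 0"
        by simp
      then have eq: "d * coef X \<nu> + \<epsilon> * coef (conv b X + (H 0 + nonlin H X)) \<nu> = 0"
        by (simp only: distrib_left mult.assoc[symmetric] d(2))
      have "conv b X = conv (H 1) X - D *\<^sub>R X"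
        by (simp add: b_def conv.diff_left conv.scaleR_left conv_unit)
      then have co: "coef (conv b X + (H 0 + nonlin H X)) \<nu>
          = coef (H 0 + conv (H 1) X + nonlin H X) \<nu> - of_real D * coef X \<nu>"
        by (simp add: scaleR_conv_of_real)
      have "d = \<i> * s \<nu> - \<epsilon> * (s \<nu>)\<^sup>2 + \<epsilon> * of_real D"
        by (simp add: d_def complex_eq_iff power2_eq_square right_diff_distrib)
      with eq show ?thesis
        unfolding co by (simp only: algebra_simps eq_neg_iff_add_eq_0) (simp add: algebra_simps)
    qed
    moreover have "norm X \<le> 2 * (1 + B) * \<tau> \<epsilon>"
      using B by (intro order_trans[OF X(4) mult_left_mono[OF T_H0]]) simp
    ultimately show ?thesis
      unfolding good_def using X by blast
  qed
  \<comment> \<open>The resolvent bounds need \<open>\<epsilon> \<noteq> 0\<close>. At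
    \<open>\<epsilon> = 0\<close> the equation says only that the derivative vanishes, and 0 solves
    it.\<close>
  define Y where "Y \<epsilon> = (if \<epsilon> = 0 then 0 else SOME X. good \<epsilon> X)" for \<epsilon>
  have good: "good \<epsilon> (Y \<epsilon>)" if "\<epsilon> \<noteq> 0" "\<bar>\<epsilon>\<bar> < \<epsilon>\<^sub>0" for \<epsilon>
    using someI_ex[OF exists[OF that]] that by (simp add: Y_def)
  have Y0: "Y 0 = 0"
    by (simp add: Y_def)
  show ?thesis
  proof (rule that[OF \<epsilon>\<^sub>0, of Y])
    show "(Y \<longlongrightarrow> 0) (at 0)"
    proof (rule Lim_null_comparison)
      show "\<forall>\<^sub>F \<epsilon> in at 0. norm (Y \<epsilon>) \<le> 2 * (1 + B) * \<tau> \<epsilon>"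
        unfolding eventually_at using \<epsilon>\<^sub>0 good
        by (intro exI[of _ \<epsilon>\<^sub>0]) (auto simp: dist_real_def good_def)
      show "((\<lambda>\<epsilon>. 2 * (1 + B) * \<tau> \<epsilon>) \<longlongrightarrow> 0) (at 0)"
        by (rule tendsto_mult_right_zero[OF \<tau>])
    qed
    fix \<epsilon> assume \<epsilon>: "\<bar>\<epsilon>\<bar> < \<epsilon>\<^sub>0"
    show "star (Y \<epsilon>) = Y \<epsilon>"
      using good[of \<epsilon>] \<epsilon> by (cases "\<epsilon> = 0") (simp_all add: Y0 star.zero good_def)
    show "norm (Y \<epsilon>) \<le> 1 / (4 * N)"
      using good[of \<epsilon>] \<epsilon> \<rho>(2) N by (cases "\<epsilon> = 0") (auto simp: Y0 good_def)
    show "(\<i> * (\<omega> \<bullet> ivec \<nu>) - \<epsilon> * (\<omega> \<bullet> ivec \<nu>)\<^sup>2) * coef (Y \<epsilon>) \<nu>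
      = - complex_of_real \<epsilon> * coef (H 0 + conv (H 1) (Y \<epsilon>) + nonlin H (Y \<epsilon>)) \<nu>" for \<nu>
    proof (cases "\<epsilon> = 0")
      case False
      then show ?thesis
        using good[OF False \<epsilon>] by (simp only: good_def s_def)
    qed (simp add: Y0)
  qed
qed

end

section \<open>From the function \<open>h\<close> to its coefficient families\<close>

lemma fcoef_minus_of_real:
  assumes "continuous_on UNIV F"
  shows "fcoef (\<lambda>\<psi>. of_real (F \<psi>)) (- \<nu>) = cnj (fcoef (\<lambda>\<psi>. of_real (F \<psi>)) \<nu>)"
proof -
  have "continuous_on UNIV (\<lambda>\<psi>. complex_of_real (F \<psi>) * fchar (- \<nu>) \<psi>)"
    by (intro continuous_intros assms)
  from tavg_cnj[OF this] show ?thesis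
    by (simp add: fcoef_def fchar_minus)
qed

lemma fcoef_of_real_0:
  assumes "continuous_on UNIV F"
  shows "fcoef (\<lambda>\<psi>. of_real (F \<psi>)) 0 = of_real (torus_average F)"
  using tavg_of_real[OF assms] by (simp add: fcoef_def)

text \<open>Averaging termwise turns the expansion of \<open>h\<close> into that of its average,
  whose first two coefficients can be compared with the data of the simple zero.\<close>

lemma torus_average_sums:
  fixes A :: "nat \<Rightarrow> real ^ 'd \<Rightarrow> real"
  assumes cont: "\<And>k. continuous_on UNIV (A k)" and bound: "\<And>k \<psi>. \<bar>A k \<psi>\<bar> \<le> N * N ^ k" and N: "0 < N"
    and y: "\<bar>y\<bar> < 1 / N" and sums: "\<And>\<psi>. (\<lambda>k. A k \<psi> * y ^ k) sums f \<psi>"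
  shows "(\<lambda>k. torus_average (A k) * y ^ k) sums torus_average f"
proof -
  have "norm (N * \<bar>y\<bar>) < 1"
    using y N by (simp add: field_simps)
  then have summable: "summable (\<lambda>k. N * (N * \<bar>y\<bar>) ^ k)"
    by (intro summable_mult summable_geometric)
  then have M: "(\<lambda>k. N * (N * \<bar>y\<bar>) ^ k) summable_on UNIV"
    using N by (intro summable_nonneg_imp_summable_on) auto
  let ?g = "\<lambda>k \<psi>. complex_of_real (A k \<psi> * y ^ k)"
  have le: "norm (?g k \<psi>) \<le> N * (N * \<bar>y\<bar>) ^ k" for k \<psi>
    using mult_right_mono[OF bound[of k \<psi>], of "\<bar>y\<bar> ^ k"]
    by (simp add: norm_mult norm_power power_mult_distrib mult.assoc)
  have cont_g: "continuous_on UNIV (?g k)" for k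
    by (intro continuous_intros cont)
  have sum_g: "(\<Sum>\<^sub>\<infinity>k. ?g k \<psi>) = of_real (f \<psi>)" for \<psi>
  proof (rule infsumI, rule norm_summable_imp_has_sum)
    show "summable (\<lambda>k. norm (?g k \<psi>))"
      by (rule summable_comparison_test'[OF summable]) (use le in simp)
    show "(\<lambda>k. ?g k \<psi>) sums of_real (f \<psi>)"
      by (rule sums_of_real[OF sums])
  qed
  have "continuous_on UNIV (\<lambda>\<psi>. complex_of_real (f \<psi>))"
    using tavg_infsum(1)[of ?g, OF cont_g le M] by (simp only: sum_g)
  from continuous_on_Re[OF this] have cont_f: "continuous_on UNIV f"
    by simp
  have "((\<lambda>k. tavg (?g k)) has_sum tavg (\<lambda>\<psi>. of_real (f \<psi>))) UNIV"
    using tavg_infsum(2)[of ?g, OF cont_g le M] by (simp only: sum_g)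
  moreover have "tavg (?g k) = of_real (torus_average (A k) * y ^ k)" for k
    using tavg_cmult[of "of_real (y ^ k)" "\<lambda>\<psi>. of_real (A k \<psi>)"] tavg_of_real[OF cont[of k]]
    by (simp add: mult.commute)
  ultimately have "(\<lambda>k. complex_of_real (torus_average (A k) * y ^ k)) sums of_real (torus_average f)"
    using tavg_of_real[OF cont_f] by (simp only: has_sum_imp_sums)
  then show ?thesis
    by (simp only: sums_of_real_iff)
qed

theorem theorem2:
  fixes h :: "real \<times> (real ^ 'd) \<Rightarrow> real" and c\<^sub>0 :: real and \<omega> :: "real ^ 'd"
  assumes h_analytic: "real_analytic_on h UNIV"
    and h_periodic: "\<And>x. torus_periodic (\<lambda>\<psi>. h (x, \<psi>))"
    and c\<^sub>0_simple: "simple_zero (\<lambda>x. torus_average (\<lambda>\<psi>. h (x, \<psi>))) c\<^sub>0"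
    and \<omega>_indep: "rationally_independent \<omega>"
  shows "\<exists>\<epsilon>\<^sub>0>0. \<exists>X :: real ^ 'd \<Rightarrow> real \<Rightarrow> real.
    (\<forall>\<epsilon>. \<bar>\<epsilon>\<bar> < \<epsilon>\<^sub>0 \<longrightarrow>
       torus_periodic (\<lambda>\<psi>. X \<psi> \<epsilon>) \<and>
       real_analytic_on (\<lambda>\<psi>. X \<psi> \<epsilon>) UNIV \<and>
       (\<exists>x\<^sub>0. (\<forall>t. x\<^sub>0 t = c\<^sub>0 + X (t *\<^sub>R \<omega>) \<epsilon>) \<and>
             quasi_periodic \<omega> x\<^sub>0 \<and> solves_ode \<epsilon> h \<omega> x\<^sub>0)) \<and>
    uniform_limit UNIV (\<lambda>\<epsilon> \<psi>. X \<psi> \<epsilon>) (\<lambda>\<psi>. 0) (at 0)"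
proof -
  obtain D where zero: "torus_average (\<lambda>\<psi>. h (c\<^sub>0, \<psi>)) = 0" and D: "D \<noteq> 0"
    and deriv: "((\<lambda>x. torus_average (\<lambda>\<psi>. h (x, \<psi>))) has_real_derivative D) (at c\<^sub>0)"
    using c\<^sub>0_simple by (auto simp: simple_zero_def)
  define A where "A k = xcoef h c\<^sub>0 k" for k
  obtain N where N1: "N \<ge> 1" and
    sums: "\<And>x \<psi>. \<bar>x\<bar> < 1 / N \<Longrightarrow> (\<lambda>k. A k \<psi> * x ^ k) sums h (c\<^sub>0 + x, \<psi>)" and
    bound: "\<And>k \<psi>. \<bar>A k \<psi>\<bar> \<le> N * N ^ k" and cont: "\<And>k. continuous_on UNIV (A k)" and
    decay: "\<And>k \<nu> j. norm (fcoef (\<lambda>\<psi>. of_real (A k \<psi>)) \<nu>) \<le> 2 * (N * N ^ k) * exp (- \<bar>of_int (\<nu> $ j)\<bar> / (2 * N))"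
    unfolding A_def by (rule fourier_taylor[OF h_analytic h_periodic, where c=c\<^sub>0]) (rule that[unfolded A_def])
  have N: "N > 0"
    using N1 by simp
  have per: "torus_periodic (A k)" for k
    unfolding A_def by (rule torus_periodic_xcoef[OF h_periodic])
  define a where "a k \<nu> = fcoef (\<lambda>\<psi>. of_real (A k \<psi>)) \<nu>" for k \<nu>

  have avg_sums: "(\<lambda>k. torus_average (A k) * y ^ k) sums torus_average (\<lambda>\<psi>. h (c\<^sub>0 + y, \<psi>))" if "\<bar>y\<bar> < 1 / N" for y
    by (rule torus_average_sums[OF cont bound N that sums[OF that]])
  have a0: "a 0 0 = 0"
    using avg_sums[of 0] N zero by (simp add: a_def fcoef_of_real_0[OF cont])
  \<comment> \<open>Termwise differentiation at 0 and uniqueness of derivatives identify the linear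
    coefficient with the given \<open>D\<close>.\<close>
  have a1: "a 1 0 = of_real D"
  proof -
    have "((\<lambda>y. torus_average (\<lambda>\<psi>. h (c\<^sub>0 + y, \<psi>))) has_real_derivative D) (at 0)"
      using deriv DERIV_shift[of "\<lambda>x. torus_average (\<lambda>\<psi>. h (x, \<psi>))" D 0 c\<^sub>0] by (simp add: add.commute)
    then have "(\<lambda>k. diffs (\<lambda>k. torus_average (A k)) k * 0 ^ k) sums D"
      by (rule termdiffs_sums_strong[where K="1 / N", rotated]) (use avg_sums N in auto)
    then have "diffs (\<lambda>k. torus_average (A k)) 0 = D"
      by simp
    then show ?thesis
      by (simp add: a_def fcoef_of_real_0[OF cont] diffs_def)
  qed

  \<comment> \<open>The rate \<open>1 / (2 * N)\<close> in the largest coordinate amounts to a rate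
    \<open>2 * \<xi>\<close> in \<open>lsize\<close>. Half is spent on the weight, the other half on
    summability over \<open>\<nu>\<close>.\<close>
  define \<xi> where "\<xi> = 1 / (4 * N * CARD('d))"
  interpret torus_weight \<xi> "TYPE('d)"
    by unfold_locales (use N in \<open>simp add: \<xi>_def\<close>)
  have a_le: "norm (a k \<nu> * of_real (wt \<xi> \<nu>)) \<le> 2 * (N * N ^ k) * exp (- (\<xi> * lsize \<nu>))" for k \<nu>
  proof -
    obtain j where "lsize \<nu> \<le> CARD('d) * \<bar>of_int (\<nu> $ j)\<bar>"
      by (rule max_component_ge)
    then have "2 * \<xi> * lsize \<nu> \<le> 2 * \<xi> * (CARD('d) * \<bar>of_int (\<nu> $ j)\<bar>)"
      using \<xi> by (intro mult_left_mono) auto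
    also have "\<dots> = \<bar>of_int (\<nu> $ j)\<bar> / (2 * N)"
      by (simp add: \<xi>_def)
    finally have "exp (- \<bar>of_int (\<nu> $ j)\<bar> / (2 * N)) \<le> exp (- (2 * \<xi> * lsize \<nu>))"
      by simp
    then have "norm (a k \<nu>) \<le> 2 * (N * N ^ k) * exp (- (2 * \<xi> * lsize \<nu>))"
      unfolding a_def using N by (intro order_trans[OF decay mult_left_mono]) auto
    then have "norm (a k \<nu>) * wt \<xi> \<nu> \<le> 2 * (N * N ^ k) * exp (- (2 * \<xi> * lsize \<nu>)) * wt \<xi> \<nu>"
      by (rule mult_right_mono) (simp add: wt_def)
    also have "\<dots> = 2 * (N * N ^ k) * exp (- (\<xi> * lsize \<nu>))"
      unfolding wt_def mult.assoc exp_add[symmetric] by (simp add: mult.assoc)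
    finally show ?thesis
      by (simp add: norm_mult wt_def)
  qed
  have sum_exp: "(\<lambda>\<nu> :: int ^ 'd. 2 * (N * N ^ k) * exp (- (\<xi> * lsize \<nu>))) summable_on UNIV" for k
    by (rule summable_on_cmult_right[OF summable_exp_lsize[OF \<xi>]])
  have a_summable: "(\<lambda>\<nu>. a k \<nu> * of_real (wt \<xi> \<nu>)) asummable_on UNIV" for k
    by (rule Infinite_Sum.abs_summable_on_comparison_test'[OF sum_exp a_le])
  define H where "H k = Abs_l1 (\<lambda>\<nu>. a k \<nu> * of_real (wt \<xi> \<nu>))" for k
  have coef_H: "coef (H k) \<nu> = a k \<nu> * of_real (wt \<xi> \<nu>)" for k \<nu>
    unfolding H_def by (simp only: coef_Abs[OF a_summable])
  define Z where "Z = (\<Sum>\<^sub>\<infinity>\<nu> :: int ^ 'd. exp (- (\<xi> * lsize \<nu>)))"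
  have norm_H: "norm (H k) \<le> (2 * N * Z) * N ^ k" for k
  proof -
    have "norm (H k) \<le> (\<Sum>\<^sub>\<infinity>\<nu> :: int ^ 'd. 2 * (N * N ^ k) * exp (- (\<xi> * lsize \<nu>)))"
      unfolding norm_l1_def coef_H by (rule infsum_mono[OF a_summable sum_exp a_le])
    then show ?thesis
      by (simp add: Z_def infsum_cmult_right' mult_ac)
  qed
  have wt_nz: "wt \<xi> \<nu> \<noteq> 0" for \<nu> :: "int ^ 'd"
    by (simp add: wt_def)
  have star_H: "star (H k) = H k" for k
    by (rule l1_eqI) (simp add: coef_star coef_H a_def fcoef_minus_of_real[OF cont] w_minus)
  have ft_H: "ft (H k) \<psi> = of_real (A k \<psi>)" for k \<psi>
  proof -
    \<comment> \<open>The trivial character in \<open>ev_summable\<close> recovers summability of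
      the unweighted coefficients.\<close>
    have "(\<lambda>\<nu>. norm (a k \<nu>)) summable_on UNIV"
      using ev_summable[of "\<lambda>_. 1" "H k"] by (simp add: coef_H wt_nz)
    moreover have "torus_periodic (\<lambda>\<psi>. complex_of_real (A k \<psi>))"
      using per[of k] by (simp add: torus_periodic_def)
    ultimately have "of_real (A k \<psi>) = (\<Sum>\<^sub>\<infinity>\<nu>. a k \<nu> * fchar \<nu> \<psi>)"
      unfolding a_def by (intro fourier_series continuous_intros cont)
    then show ?thesis
      by (simp add: ft_def ev_def coef_H wt_nz)
  qed

  have H0: "coef (H 0) 0 = 0" and H1: "coef (H 1) 0 = of_real D"
    by (simp_all only: coef_H a0 a1 w_0 of_real_1 mult_1_right)
  have indep: "\<nu> = 0" if "\<omega> \<bullet> ivec \<nu> = 0" for \<nu>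
    using \<omega>_indep that unfolding rationally_independent_def inner_vec_def by auto
  obtain \<epsilon>\<^sub>0 Y where \<epsilon>\<^sub>0: "\<epsilon>\<^sub>0 > 0" and lim: "(Y \<longlongrightarrow> 0) (at 0)"
    and star_Y: "\<And>\<epsilon>. \<bar>\<epsilon>\<bar> < \<epsilon>\<^sub>0 \<Longrightarrow> star (Y \<epsilon>) = Y \<epsilon>"
    and norm_Y: "\<And>\<epsilon>. \<bar>\<epsilon>\<bar> < \<epsilon>\<^sub>0 \<Longrightarrow> norm (Y \<epsilon>) \<le> 1 / (4 * N)"
    and Y: "\<And>\<epsilon> \<nu>. \<bar>\<epsilon>\<bar> < \<epsilon>\<^sub>0 \<Longrightarrow> (\<i> * (\<omega> \<bullet> ivec \<nu>) - \<epsilon> * (\<omega> \<bullet> ivec \<nu>)\<^sup>2) * coef (Y \<epsilon>) \<nu>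
      = - complex_of_real \<epsilon> * coef (H 0 + conv (H 1) (Y \<epsilon>) + nonlin H (Y \<epsilon>)) \<nu>"
    by (rule response_solution[OF norm_H N star_H H0 H1 D, where \<omega>=\<omega>]) (erule indep, rule that)
  define X where "X \<psi> \<epsilon> = Re (ft (Y \<epsilon>) \<psi>)" for \<psi> \<epsilon>
  have X_le: "\<bar>X \<psi> \<epsilon>\<bar> \<le> norm (Y \<epsilon>)" for \<psi> \<epsilon>
    unfolding X_def by (rule order_trans[OF abs_Re_le_cmod norm_ft])
  have per_X: "torus_periodic (\<lambda>\<psi>. X \<psi> \<epsilon>)" for \<epsilon>
    using torus_periodic_ft[of "Y \<epsilon>"] by (simp add: X_def torus_periodic_def)
  have ode: "solves_ode \<epsilon> h \<omega> (\<lambda>t. c\<^sub>0 + X (t *\<^sub>R \<omega>) \<epsilon>)" if \<epsilon>: "\<bar>\<epsilon>\<bar> < \<epsilon>\<^sub>0" for \<epsilon>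
    unfolding X_def
  proof (rule solves_ode_ft[OF Y[OF \<epsilon>]])
    fix t
    define \<psi> where "\<psi> = t *\<^sub>R \<omega>"
    have "(\<lambda>k. ft (H k) \<psi> * ft (Y \<epsilon>) \<psi> ^ k) sums ft (H 0 + conv (H 1) (Y \<epsilon>) + nonlin H (Y \<epsilon>)) \<psi>"
      by (rule ft_nonlin[OF norm_H N _ _ norm_Y[OF \<epsilon>]]) (use N in auto)
    moreover have "ft (H k) \<psi> * ft (Y \<epsilon>) \<psi> ^ k = of_real (A k \<psi> * X \<psi> \<epsilon> ^ k)" for k
      using ft_real[OF star_Y[OF \<epsilon>], of \<psi>] by (simp add: ft_H X_def)
    ultimately have "(\<lambda>k. complex_of_real (A k \<psi> * X \<psi> \<epsilon> ^ k)) sums ft (H 0 + conv (H 1) (Y \<epsilon>) + nonlin H (Y \<epsilon>)) \<psi>"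
      by (simp only:)
    \<comment> \<open>The bound on \<open>Y\<close> serves twice: it makes the series in the algebra
      converge, and it puts the values of \<open>X\<close> inside the radius \<open>1 / N\<close> of
      the expansion of \<open>h\<close>.\<close>
    moreover have "1 / (4 * N) < 1 / N"
      using N by (simp add: frac_less2)
    then have "\<bar>X \<psi> \<epsilon>\<bar> < 1 / N"
      using X_le[of \<psi> \<epsilon>] norm_Y[OF \<epsilon>] by linarith
    then have "(\<lambda>k. complex_of_real (A k \<psi> * X \<psi> \<epsilon> ^ k)) sums of_real (h (c\<^sub>0 + X \<psi> \<epsilon>, \<psi>))"
      by (intro sums_of_real sums)
    ultimately have "ft (H 0 + conv (H 1) (Y \<epsilon>) + nonlin H (Y \<epsilon>)) \<psi> = of_real (h (c\<^sub>0 + X \<psi> \<epsilon>, \<psi>))"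
      by (rule sums_unique2)
    then show "Re (ft (H 0 + conv (H 1) (Y \<epsilon>) + nonlin H (Y \<epsilon>)) (t *\<^sub>R \<omega>))
        = h (c\<^sub>0 + Re (ft (Y \<epsilon>) (t *\<^sub>R \<omega>)), t *\<^sub>R \<omega>)"
      by (simp add: \<psi>_def X_def)
  qed
  have quasi: "quasi_periodic \<omega> (\<lambda>t. c\<^sub>0 + X (t *\<^sub>R \<omega>) \<epsilon>)" for \<epsilon>
    unfolding quasi_periodic_def
  proof (intro exI[of _ "\<lambda>\<psi>. c\<^sub>0 + X \<psi> \<epsilon>"] conjI allI refl)
    show "torus_periodic (\<lambda>\<psi>. c\<^sub>0 + X \<psi> \<epsilon>)"
      using per_X[of \<epsilon>] by (simp add: torus_periodic_def)
    show "continuous_on UNIV (\<lambda>\<psi>. c\<^sub>0 + X \<psi> \<epsilon>)"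
      unfolding X_def by (intro continuous_intros continuous_ft)
  qed
  have limit: "uniform_limit UNIV (\<lambda>\<epsilon> \<psi>. X \<psi> \<epsilon>) (\<lambda>\<psi>. 0) (at 0)"
  proof (rule uniform_limitI)
    fix e :: real assume "e > 0"
    then have "\<forall>\<^sub>F \<epsilon> in at 0. norm (Y \<epsilon>) < e"
      using tendstoD[OF lim] by (simp add: dist_norm)
    then show "\<forall>\<^sub>F \<epsilon> in at 0. \<forall>\<psi>\<in>UNIV. dist (X \<psi> \<epsilon>) 0 < e"
      by (rule eventually_mono) (auto simp: dist_real_def intro: le_less_trans[OF X_le])
  qed
  have analytic: "real_analytic_on (\<lambda>\<psi>. X \<psi> \<epsilon>) UNIV" for \<epsilon>
    unfolding X_def by (rule real_analytic_ft)
  have solution: "\<exists>x\<^sub>0. (\<forall>t. x\<^sub>0 t = c\<^sub>0 + X (t *\<^sub>R \<omega>) \<epsilon>) \<and> quasi_periodic \<omega> x\<^sub>0 \<and> solves_ode \<epsilon> h \<omega> x\<^sub>0"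
    if "\<bar>\<epsilon>\<bar> < \<epsilon>\<^sub>0" for \<epsilon>
    by (intro exI[of _ "\<lambda>t. c\<^sub>0 + X (t *\<^sub>R \<omega>) \<epsilon>"] conjI allI refl quasi ode that)
  show ?thesis
    by (intro exI[of _ \<epsilon>\<^sub>0] exI[of _ X] conjI allI impI \<epsilon>\<^sub>0 per_X analytic solution limit)
qed

end
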